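(* On the Cartan group with the $\ell_\infty$ sub-Finsler structure, every optimal mixed control has not more than $13$ switchings. That is, if $\lambda_t$, $t\in[0,T]$, is a mixed normal extremal whose trajectory $q(t)$ is optimal, then its control $u$ has at most $13$ switchings.
   Context: Cartan group: $M=\mathbb{R}^5$ with coordinates $(x,y,z,v,w)$, the connected simply connected Lie group with left-invariant frame $X_1=\partial_x-\frac y2\partial_z-\frac{x^2+y^2}{2}\partial_w$, $X_2=\partial_y+\frac x2\partial_z+\frac{x^2+y^2}{2}\partial_v$, $X_3=\partial_z+x\partial_v+y\partial_w$, $X_4=\partial_v$, $X_5=\partial_w$, satisfying $[X_1,X_2]=X_3$, $[X_1,X_3]=X_4$, $[X_2,X_3]=X_5$, with $X_4,X_5$ central. Trajectories: a trajectory is an absolutely continuous curve $q:[0,T]\to M$ with $\dot q=u_1X_1(q)+u_2X_2(q)$ for a.e. $t$, for a measurable control $u=(u_1,u_2)$ with $\max(|u_1(t)|,|u_2(t)|)\le 1$. It (and its control) is optimal if $T$ is minimal among the durations of all trajectories with the same initial and final points. Normal extremals: for $\lambda\in T^*M$ put $h_i(\lambda)=\langle\lambda,X_i\rangle$, $i=1,\dots,5$. A normal extremal over a trajectory $q$ with control $u$ is a Lipschitz curve $\lambda_t\in T^*_{q(t)}M$ such that for a.e. $t$ (writing $h_i=h_i(\lambda_t)$) $\dot h_1=-u_2h_3$, $\dot h_2=u_1h_3$, $\dot h_3=u_1h_4+u_2h_5$, $\dot h_4=\dot h_5=0$, and $u_1h_1+u_2h_2=|h_1|+|h_2|=H$,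 where $H>0$ is constant. The restriction of a normal extremal to a nondegenerate time interval $I$ is a bang-bang arc if $\{t\in I: h_1h_2(\lambda_t)=0\}$ is finite; it is a singular arc if $h_1(\lambda_t)\equiv0$ on $I$ or $h_2(\lambda_t)\equiv 0$ on $I$. A normal extremal is mixed if $[0,T]$ is a finite union of consecutive nondegenerate intervals on each of which it is a bang-bang arc or a singular arc, with at least one bang-bang arc and at least one singular arc occurring. Controls of mixed extremals are piecewise constant (after modification on a null set); a switching is an interior time at which the control is discontinuous. *)

theory Defs
  imports "HOL-Analysis.Analysis"
begin

type_synonym point = "real \<times> real \<times> real \<times> real \<times> real"

text \<open>The tangent space at every point of $M = \mathbb{R}^5$ is identified with
  $\mathbb{R}^5$ through the coordinate frame, so that a vector field is a map
  \<^typ>\<open>point \<Rightarrow> point\<close>.\<close>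

definition X1 :: "point \<Rightarrow> point" where
  "X1 = (\<lambda>(x, y, z, v, w). (1, 0, - y / 2, 0, - (x\<^sup>2 + y\<^sup>2) / 2))"

definition X2 :: "point \<Rightarrow> point" where
  "X2 = (\<lambda>(x, y, z, v, w). (0, 1, x / 2, (x\<^sup>2 + y\<^sup>2) / 2, 0))"

definition X3 :: "point \<Rightarrow> point" where
  "X3 = (\<lambda>(x, y, z, v, w). (0, 0, 1, x, y))"

definition X4 :: "point \<Rightarrow> point" where
  "X4 = (\<lambda>(x, y, z, v, w). (0, 0, 0, 1, 0))"

definition X5 :: "point \<Rightarrow> point" where
  "X5 = (\<lambda>(x, y, z, v, w). (0, 0, 0, 0, 1))"

text \<open>An element of the cotangent bundle is a base point together with a linear functional on the
  tangent space at that point (every linear functional on $\mathbb{R}^5$ is bounded).\<close>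

type_synonym covector = "point \<times> (point \<Rightarrow>\<^sub>L real)"

definition hamil :: "(point \<Rightarrow> point) \<Rightarrow> covector \<Rightarrow> real" where
  "hamil X l = blinfun_apply (snd l) (X (fst l))"

abbreviation h1 :: "covector \<Rightarrow> real" where "h1 \<equiv> hamil X1"
abbreviation h2 :: "covector \<Rightarrow> real" where "h2 \<equiv> hamil X2"
abbreviation h3 :: "covector \<Rightarrow> real" where "h3 \<equiv> hamil X3"
abbreviation h4 :: "covector \<Rightarrow> real" where "h4 \<equiv> hamil X4"
abbreviation h5 :: "covector \<Rightarrow> real" where "h5 \<equiv> hamil X5"

text \<open>The classical epsilon-delta notion for functions; the constant
  \<^const>\<open>absolutely_continuous\<close> of the library is the relation between measures.\<close>

definition abs_cont_on :: "real \<Rightarrow> real \<Rightarrow> (real \<Rightarrow> 'a::metric_space) \<Rightarrow> bool" where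
  "abs_cont_on a b f \<longleftrightarrow>
    (\<forall>\<epsilon>>0. \<exists>\<delta>>0. \<forall>(n::nat) l r.
       (\<forall>i<n. a \<le> l i \<and> l i \<le> r i \<and> r i \<le> b) \<longrightarrow>
       (\<forall>i<n. \<forall>j<n. i \<noteq> j \<longrightarrow> {l i<..<r i} \<inter> {l j<..<r j} = {}) \<longrightarrow>
       (\<Sum>i<n. r i - l i) < \<delta> \<longrightarrow>
       (\<Sum>i<n. dist (f (l i)) (f (r i))) < \<epsilon>)"

definition admissible_control :: "real \<Rightarrow> (real \<Rightarrow> real \<times> real) \<Rightarrow> bool" where
  "admissible_control T u \<longleftrightarrow>
    u \<in> borel_measurable (lebesgue_on {0..T}) \<and>
    (\<forall>t\<in>{0..T}. max \<bar>fst (u t)\<bar> \<bar>snd (u t)\<bar> \<le> 1)"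

text \<open>The duration 0 is allowed (constant curve), so that a closed curve of positive duration is
  never optimal.\<close>

definition trajectory :: "real \<Rightarrow> (real \<Rightarrow> point) \<Rightarrow> (real \<Rightarrow> real \<times> real) \<Rightarrow> bool" where
  "trajectory T q u \<longleftrightarrow>
    0 \<le> T \<and> admissible_control T u \<and> abs_cont_on 0 T q \<and>
    (AE t in lebesgue_on {0..T}.
       (q has_vector_derivative (fst (u t) *\<^sub>R X1 (q t) + snd (u t) *\<^sub>R X2 (q t)))
         (at t within {0..T}))"

definition optimal :: "real \<Rightarrow> (real \<Rightarrow> point) \<Rightarrow> (real \<Rightarrow> real \<times> real) \<Rightarrow> bool" where
  "optimal T q u \<longleftrightarrow>
    trajectory T q u \<and>
    (\<forall>T' q' u'. trajectory T' q' u' \<and> q' 0 = q 0 \<and> q' T' = q T \<longrightarrow> T \<le> T')"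

definition normal_extremal ::
  "real \<Rightarrow> (real \<Rightarrow> point) \<Rightarrow> (real \<Rightarrow> real \<times> real) \<Rightarrow> (real \<Rightarrow> covector) \<Rightarrow> bool" where
  "normal_extremal T q u lam \<longleftrightarrow>
    trajectory T q u \<and>
    (\<forall>t\<in>{0..T}. fst (lam t) = q t) \<and>
    (\<exists>L. L-lipschitz_on {0..T} lam) \<and>
    (\<exists>H>0. AE t in lebesgue_on {0..T}.
       ((\<lambda>s. h1 (lam s)) has_real_derivative - snd (u t) * h3 (lam t)) (at t within {0..T}) \<and>
       ((\<lambda>s. h2 (lam s)) has_real_derivative fst (u t) * h3 (lam t)) (at t within {0..T}) \<and>
       ((\<lambda>s. h3 (lam s)) has_real_derivative
          fst (u t) * h4 (lam t) + snd (u t) * h5 (lam t)) (at t within {0..T}) \<and>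
       ((\<lambda>s. h4 (lam s)) has_real_derivative 0) (at t within {0..T}) \<and>
       ((\<lambda>s. h5 (lam s)) has_real_derivative 0) (at t within {0..T}) \<and>
       fst (u t) * h1 (lam t) + snd (u t) * h2 (lam t) = \<bar>h1 (lam t)\<bar> + \<bar>h2 (lam t)\<bar> \<and>
       \<bar>h1 (lam t)\<bar> + \<bar>h2 (lam t)\<bar> = H)"

definition bang_bang_arc :: "(real \<Rightarrow> covector) \<Rightarrow> real set \<Rightarrow> bool" where
  "bang_bang_arc lam I \<longleftrightarrow> finite {t\<in>I. h1 (lam t) * h2 (lam t) = 0}"

definition singular_arc :: "(real \<Rightarrow> covector) \<Rightarrow> real set \<Rightarrow> bool" where
  "singular_arc lam I \<longleftrightarrow> (\<forall>t\<in>I. h1 (lam t) = 0) \<or> (\<forall>t\<in>I. h2 (lam t) = 0)"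

definition subdivision :: "real \<Rightarrow> nat \<Rightarrow> (nat \<Rightarrow> real) \<Rightarrow> bool" where
  "subdivision T n \<tau> \<longleftrightarrow> \<tau> 0 = 0 \<and> \<tau> n = T \<and> (\<forall>i<n. \<tau> i < \<tau> (Suc i))"

definition mixed :: "real \<Rightarrow> (real \<Rightarrow> covector) \<Rightarrow> bool" where
  "mixed T lam \<longleftrightarrow>
    (\<exists>n \<tau>. subdivision T n \<tau> \<and>
       (\<forall>i<n. bang_bang_arc lam {\<tau> i..\<tau> (Suc i)} \<or> singular_arc lam {\<tau> i..\<tau> (Suc i)}) \<and>
       (\<exists>i<n. bang_bang_arc lam {\<tau> i..\<tau> (Suc i)}) \<and>
       (\<exists>i<n. singular_arc lam {\<tau> i..\<tau> (Suc i)}))"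

definition piecewise_constant :: "real \<Rightarrow> (real \<Rightarrow> 'a) \<Rightarrow> bool" where
  "piecewise_constant T v \<longleftrightarrow>
    (\<exists>n \<tau>. subdivision T n \<tau> \<and> (\<forall>i<n. v constant_on {\<tau> i<..<\<tau> (Suc i)}))"

definition switchings :: "real \<Rightarrow> (real \<Rightarrow> 'a::topological_space) \<Rightarrow> real set" where
  "switchings T v = {t\<in>{0<..<T}. \<not> isCont v t}"

text \<open>Controls matter only up to null sets, so switchings are counted on a piecewise constant
  representative. A removable discontinuity of a representative can only increase the count.\<close>

definition at_most_switchings :: "real \<Rightarrow> (real \<Rightarrow> real \<times> real) \<Rightarrow> nat \<Rightarrow> bool" where
  "at_most_switchings T u N \<longleftrightarrow>
    (\<exists>v. (AE t in lebesgue_on {0..T}. v t = u t) \<and> piecewise_constant T v \<and>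
         finite (switchings T v) \<and> card (switchings T v) \<le> N)"

end

theory Submission
  imports Defs
begin

text \<open>
  Read in a frame \<open>(G, K)\<close> of two adjacent vertices of the control square, the vector
  \<open>(h1, h2)\<close> runs along the square \<open>max |X| |Y| = h\<close> and \<open>C = \<plusminus>h3\<close> is its speed; the motion is that
  of a pendulum with piecewise linear potential. A singular arc rests at the unstable equilibrium
  \<open>X = Y = h\<close>, so a mixed extremal lies on the separatrix: it is a concatenation of singular arcs and
  of complete loops around the square, with a partial loop at either end.

  If the equilibrium is isolated, a loop of size \<open>r\<close> moves the base point in the same way as a
  singular arc followed by the central translation by \<open>r ^ 3\<close> times a fixed element. Two loops,
  with any singular arcs in between, can therefore be replaced by one loop enlarged by the factor
  \<open>root 3 2\<close> and a singular arc, which is shorter; with at most one complete loop there are at most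
  14 arcs. If \<open>\<bar>h4\<bar> = \<bar>h5\<bar>\<close>, the equilibria fill an edge of the square, the trajectory is
  rectilinear in the frame \<open>(G, K)\<close>, and three loops, or two loops between two almost complete ones,
  are shortened explicitly by merging excursions of equal height.
\<close>

section \<open>Lipschitz curves\<close>

text \<open>Why a loop acts like a singular arc: \<open>C\<close> changes as
  \<open>P a - Q b\<close>, where \<open>(a, b)\<close> is the planar displacement in the frame. A
  loop starts and ends with \<open>C = 0\<close>, so its displacement is parallel to
  \<open>(Q, P)\<close>, the direction of the singular control. As \<open>X\<close> returns too, the
  integral of \<open>C\<close> with respect to \<open>b\<close> vanishes, which means that the loop
  and its chord enclose no signed area. Only the two moments of degree three are left; they scale
  with the cube of the size, hence the factor \<open>root 3 2\<close>. Origin of 14: with an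
  isolated equilibrium, the first rest occurs after at most 4 arcs and a singular arc with a loop
  has 5 arcs, so 15 arcs contain two such blocks ending at an interior node. In the flat case the
  numbers are 3 and 4, and three blocks fit into 15 arcs except in one extreme configuration, which
  is why a second replacement exists. The replacement of three flat loops saves nothing if no time
  is spent at rest, so a singular arc has to lie among the pieces that are replaced.\<close>

lemma lipschitz_pos_deriv_mono:
  fixes f :: "real \<Rightarrow> real"
  assumes L: "L-lipschitz_on {a..b} f" and "a \<le> b" and N: "negligible N"
    and d: "\<And>t. t \<in> {a..b} - N \<Longrightarrow> \<exists>D>0. (f has_real_derivative D) (at t within {a..b})"
  shows "f a \<le> f b"
proof (rule ccontr)
  assume "\<not> f a \<le> f b"
  then have lt: "f b < f a" by simp
  have cont: "continuous_on {a..b} f"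
    using L lipschitz_on_continuous_on by blast
  \<comment> \<open>A Lipschitz image of a null set is null, so some value \<open>y\<close> between
    \<open>f b\<close> and \<open>f a\<close> is not taken on \<open>N\<close>. The last time with
    \<open>f\<close> at least \<open>y\<close> is then a regular time, and a positive derivative
    there contradicts being last.\<close>
  have "negligible (f ` (N \<inter> {a..b}))"
  proof (rule negligible_locally_Lipschitz_image)
    show "negligible (N \<inter> {a..b})" using N by (simp add: negligible_Int)
    fix x assume "x \<in> N \<inter> {a..b}"
    then have "\<forall>y\<in>N \<inter> {a..b} \<inter> UNIV. norm (f y - f x) \<le> L * norm (y - x)"
      using L by (auto simp: lipschitz_on_def dist_norm)
    then show "\<exists>T B. open T \<and> x \<in> T \<and> (\<forall>y\<in>N \<inter> {a..b} \<inter> T. norm (f y - f x) \<le> B * norm (y - x))"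
      by (intro exI[of _ UNIV] exI[of _ L]) auto
  qed simp
  moreover have "\<not> negligible {f b<..<f a}"
    using lt by (metis box_real(1) box_ne_empty(2) inner_real_def negligible_interval(2) box_eq_empty(1) greaterThanLessThan_empty_iff linorder_not_less)
  ultimately obtain y where y: "f b < y" "y < f a" "y \<notin> f ` (N \<inter> {a..b})"
    by (meson greaterThanLessThan_iff negligible_subset subsetI)
  define S where "S = {t\<in>{a..b}. y \<le> f t}"
  have "closed S"
    unfolding S_def using continuous_closed_preimage[OF cont, of "{y..}"]
    by (simp add: vimage_def Int_def)
  moreover have "a \<in> S" "bdd_above S"
    using y assms(2) by (auto simp: S_def intro: bdd_aboveI[of _ b])
  ultimately have sS: "Sup S \<in> S"
    using closed_contains_Sup by blast
  define s where "s = Sup S"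
  have s: "s \<in> {a..b}" "y \<le> f s" using sS unfolding s_def[symmetric] by (auto simp: S_def)
  have gt: "f t < y" if "s < t" "t \<le> b" for t
    using s that cSup_upper[OF _ \<open>bdd_above S\<close>, of t] unfolding s_def[symmetric]
    by (force simp: S_def)
  then have "s \<noteq> b" using y s by auto
  with s have "s < b" by auto
  have "f s = y"
  proof (rule antisym)
    have "(f \<longlongrightarrow> f s) (at s within {s<..b})"
      using cont s by (meson atLeastAtMost_iff continuous_on_def greaterThanAtMost_iff less_imp_le
          order_trans subsetI tendsto_within_subset)
    moreover have "at s within {s<..b} \<noteq> bot"
      using \<open>s < b\<close> by (simp add: at_within_eq_bot_iff closure_greaterThanAtMost)
    ultimately show "f s \<le> y"
      by (intro tendsto_upperbound[of f]) (auto simp: eventually_at_filter gt less_imp_le)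
  qed (use s in simp)
  with y s have "s \<notin> N" by auto
  with d s obtain D where D: "D > 0" "(f has_real_derivative D) (at s within {a..b})" by blast
  obtain e where e: "e > 0" "\<And>h. 0 < h \<Longrightarrow> s + h \<in> {a..b} \<Longrightarrow> h < e \<Longrightarrow> f s < f (s + h)"
    using has_real_derivative_pos_inc_right[OF D(2,1)] by blast
  define h where "h = min (e / 2) (b - s)"
  have "0 < h" "s + h \<in> {a..b}" "h < e" using e \<open>s < b\<close> s by (auto simp: h_def)
  then show False using e(2)[of h] gt[of "s + h"] \<open>f s = y\<close> by auto
qed

lemma lipschitz_zero_deriv_const:
  fixes f :: "real \<Rightarrow> real"
  assumes L: "L-lipschitz_on {a..b} f" and ab: "a \<le> b" and N: "negligible N"
    and d: "\<And>t. t \<in> {a..b} - N \<Longrightarrow> (f has_real_derivative 0) (at t within {a..b})"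
  shows "f b = f a"
proof -
  have *: "g a \<le> g b" if Lg: "M-lipschitz_on {a..b} g"
    and dg: "\<And>t. t \<in> {a..b} - N \<Longrightarrow> (g has_real_derivative 0) (at t within {a..b})"
    for g :: "real \<Rightarrow> real" and M
  proof (rule field_le_epsilon)
    fix e :: real assume "e > 0"
    \<comment> \<open>A small added slope makes the derivative strictly positive; the summand 1
      covers \<open>a = b\<close>.\<close>
    define k where "k = e / (b - a + 1)"
    have k: "k > 0" "k * (b - a) \<le> e" using \<open>e > 0\<close> ab by (auto simp: k_def field_simps)
    have "g a + k * a \<le> g b + k * b"
    proof (rule lipschitz_pos_deriv_mono[where f = "\<lambda>t. g t + k * t", OF _ ab N])
      show "(M + \<bar>k\<bar> * 1)-lipschitz_on {a..b} (\<lambda>t. g t + k * t)"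
        by (intro lipschitz_intros Lg)
      fix t assume "t \<in> {a..b} - N"
      then have "((\<lambda>t. g t + k * t) has_real_derivative k) (at t within {a..b})"
        by (auto intro!: derivative_eq_intros dg)
      then show "\<exists>D>0. ((\<lambda>t. g t + k * t) has_real_derivative D) (at t within {a..b})"
        using k by blast
    qed
    then show "g a \<le> g b + e" using k by (simp add: algebra_simps)
  qed
  have "f a \<le> f b" using *[OF L d] .
  moreover have "- f a \<le> - f b"
  proof (rule *)
    show "L-lipschitz_on {a..b} (\<lambda>t. - f t)" using L by simp
    show "((\<lambda>t. - f t) has_real_derivative 0) (at t within {a..b})" if "t \<in> {a..b} - N" for t
      using DERIV_minus[OF d[OF that]] by simp
  qed
  ultimately show ?thesis by simp
qed

lemma AE_lebesgue_on_iff: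
  fixes S :: "real set"
  assumes "S \<in> sets lebesgue"
  shows "(AE t in lebesgue_on S. P t) \<longleftrightarrow> (\<exists>N. negligible N \<and> (\<forall>t\<in>S - N. P t))"
proof -
  have "(AE t in lebesgue_on S. P t) \<longleftrightarrow> (AE t in lebesgue. t \<in> S \<longrightarrow> P t)"
    using assms by (simp add: AE_restrict_space_iff)
  also have "\<dots> \<longleftrightarrow> (\<exists>N. negligible N \<and> (\<forall>t\<in>S - N. P t))"
  proof
    assume "AE t in lebesgue. t \<in> S \<longrightarrow> P t"
    then obtain N where "N \<in> null_sets lebesgue" "{t. \<not> (t \<in> S \<longrightarrow> P t)} \<subseteq> N"
      unfolding eventually_ae_filter by auto
    then show "\<exists>N. negligible N \<and> (\<forall>t\<in>S - N. P t)"
      by (intro exI[of _ N]) (auto simp: negligible_iff_null_sets)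
  next
    assume "\<exists>N. negligible N \<and> (\<forall>t\<in>S - N. P t)"
    then obtain N where "N \<in> null_sets lebesgue" "\<forall>t\<in>S - N. P t"
      by (auto simp: negligible_iff_null_sets)
    then show "AE t in lebesgue. t \<in> S \<longrightarrow> P t"
      by (intro AE_I'[of N]) auto
  qed
  finally show ?thesis .
qed

definition lip :: "real \<Rightarrow> real \<Rightarrow> (real \<Rightarrow> 'a::metric_space) \<Rightarrow> bool" where
  "lip a b f \<longleftrightarrow> (\<exists>L. L-lipschitz_on {a..b} f)"

lemma lip_const [intro!]: "lip a b (\<lambda>t. c)"
  and lip_id [intro!]: "lip a b (\<lambda>t. t)"
  unfolding lip_def using lipschitz_on_constant lipschitz_on_id by blast+

lemma lip_add [intro!]: "lip a b f \<Longrightarrow> lip a b g \<Longrightarrow> lip a b (\<lambda>t. f t + g t)"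
  for f g :: "real \<Rightarrow> 'a::real_normed_vector"
  unfolding lip_def using lipschitz_on_add by blast

lemma lip_minus [intro!]: "lip a b f \<Longrightarrow> lip a b (\<lambda>t. - f t)"
  for f :: "real \<Rightarrow> 'a::real_normed_vector"
  unfolding lip_def using lipschitz_on_minus by blast

lemma lip_diff [intro!]: "lip a b f \<Longrightarrow> lip a b g \<Longrightarrow> lip a b (\<lambda>t. f t - g t)"
  for f g :: "real \<Rightarrow> 'a::real_normed_vector"
  unfolding lip_def using lipschitz_on_diff by blast

lemma lip_Pair [intro!]: "lip a b f \<Longrightarrow> lip a b g \<Longrightarrow> lip a b (\<lambda>t. (f t, g t))"
  unfolding lip_def using lipschitz_on_Pair by blast

lemma lip_bounded_linear:
  assumes "bounded_linear h" "lip a b f" shows "lip a b (\<lambda>t. h (f t))"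
proof -
  from assms(2) obtain L where L: "L-lipschitz_on {a..b} f" by (auto simp: lip_def)
  obtain B where B: "B-lipschitz_on (f ` {a..b}) h"
    using bounded_linear.lipschitz_boundE[OF assms(1)] by blast
  show ?thesis unfolding lip_def using lipschitz_on_compose2[OF L B] by blast
qed

lemmas lip_fst [intro!] = lip_bounded_linear[OF bounded_linear_fst]
  and lip_snd [intro!] = lip_bounded_linear[OF bounded_linear_snd]

lemma lip_imp_continuous: "lip a b f \<Longrightarrow> continuous_on {a..b} f"
  unfolding lip_def using lipschitz_on_continuous_on by blast

lemma lip_mult [intro!]:
  fixes f g :: "real \<Rightarrow> real"
  assumes "lip a b f" "lip a b g" shows "lip a b (\<lambda>t. f t * g t)"
proof -
  obtain L M where L: "L-lipschitz_on {a..b} f" and M: "M-lipschitz_on {a..b} g"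
    using assms by (auto simp: lip_def)
  have "bounded (f ` {a..b})" "bounded (g ` {a..b})"
    using assms by (auto intro!: compact_imp_bounded compact_continuous_image lip_imp_continuous)
  then obtain A B where A: "A > 0" "\<And>t. t \<in> {a..b} \<Longrightarrow> \<bar>f t\<bar> \<le> A"
    and B: "B > 0" "\<And>t. t \<in> {a..b} \<Longrightarrow> \<bar>g t\<bar> \<le> B"
    by (auto simp: bounded_pos)
  have "(A * M + B * L)-lipschitz_on {a..b} (\<lambda>t. f t * g t)"
  proof (rule lipschitz_onI)
    fix s t assume st: "s \<in> {a..b}" "t \<in> {a..b}"
    have "f s * g s - f t * g t = f s * (g s - g t) + g t * (f s - f t)" by (simp add: algebra_simps)
    then have "\<bar>f s * g s - f t * g t\<bar> \<le> \<bar>f s\<bar> * \<bar>g s - g t\<bar> + \<bar>g t\<bar> * \<bar>f s - f t\<bar>"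
      by (simp flip: abs_mult)
    also have "\<dots> \<le> A * (M * dist s t) + B * (L * dist s t)"
      using st A B lipschitz_onD[OF L st] lipschitz_onD[OF M st]
      by (intro add_mono mult_mono) (auto simp: dist_real_def)
    finally show "dist (f s * g s) (f t * g t) \<le> (A * M + B * L) * dist s t"
      by (simp add: dist_real_def algebra_simps)
  qed (use A B lipschitz_on_nonneg[OF L] lipschitz_on_nonneg[OF M] in auto)
  then show ?thesis by (auto simp: lip_def)
qed

lemma lip_power [intro!]: "lip a b f \<Longrightarrow> lip a b (\<lambda>t. f t ^ n)" for f :: "real \<Rightarrow> real"
  by (induction n) auto

lemma lip_divide [intro!]: "lip a b f \<Longrightarrow> lip a b (\<lambda>t. f t / c)" for f :: "real \<Rightarrow> real"
  unfolding divide_inverse by auto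

lemma lip_subset: "lip a b f \<Longrightarrow> a \<le> c \<Longrightarrow> d \<le> b \<Longrightarrow> lip c d f"
  unfolding lip_def by (meson atLeastatMost_subset_iff lipschitz_on_subset)

lemma lip_concat: "lip a b f \<Longrightarrow> lip b c g \<Longrightarrow> f b = g b \<Longrightarrow> lip a c (\<lambda>t. if t \<le> b then f t else g t)"
  unfolding lip_def using lipschitz_on_concat_max by blast

text \<open>Derivatives are required at interior times only, so that the lemma applies to a single
  arc whose ends are switching times; the two ends join the exceptional set.\<close>

lemma lip_AE_unique:
  fixes f g :: "real \<Rightarrow> real"
  assumes f: "lip a b f" and g: "lip a b g" and "negligible N"
    and d: "\<And>t. t \<in> {a<..<b} - N \<Longrightarrow> \<exists>D. (f has_real_derivative D) (at t within {a..b})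
         \<and> (g has_real_derivative D) (at t within {a..b})"
    and t: "t \<in> {a..b}" and eq: "f a = g a"
  shows "f t = g t"
proof -
  have "lip a t (\<lambda>s. f s - g s)" by (rule lip_subset[OF lip_diff[OF f g]]) (use t in auto)
  then obtain L where L: "L-lipschitz_on {a..t} (\<lambda>s. f s - g s)" by (auto simp: lip_def)
  have "f t - g t = f a - g a"
  proof (rule lipschitz_zero_deriv_const[OF L, where N = "insert a (insert b N)"])
    fix s assume "s \<in> {a..t} - insert a (insert b N)"
    then have "s \<in> {a<..<b} - N" using t by auto
    from d[OF this] obtain D where "(f has_real_derivative D) (at s within {a..b})"
      "(g has_real_derivative D) (at s within {a..b})" by blast
    from DERIV_diff[OF this] have "((\<lambda>s. f s - g s) has_real_derivative 0) (at s within {a..b})"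
      by simp
    then show "((\<lambda>s. f s - g s) has_real_derivative 0) (at s within {a..t})"
      by (rule DERIV_subset) (use t in auto)
  qed (use t assms(3) in auto)
  with eq show ?thesis by simp
qed

lemma lip_zero_deriv_const:
  fixes f :: "real \<Rightarrow> real"
  assumes "lip a b f" "negligible N" "\<And>t. t \<in> {a..b} - N \<Longrightarrow> (f has_real_derivative 0) (at t within {a..b})"
    and "t \<in> {a..b}"
  shows "f t = f a"
proof (rule lip_AE_unique[OF assms(1) lip_const assms(2) _ assms(4)])
  fix t assume "t \<in> {a<..<b} - N"
  then have "t \<in> {a..b} - N" by auto
  from assms(3)[OF this] show "\<exists>D. (f has_real_derivative D) (at t within {a..b}) \<and>
      ((\<lambda>_. f a) has_real_derivative D) (at t within {a..b})"
    by (intro exI[of _ 0]) simp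
qed simp

lemma lip_imp_abs_cont:
  assumes "lip a b f" shows "abs_cont_on a b f"
proof -
  obtain L where L: "L-lipschitz_on {a..b} f" using assms by (auto simp: lip_def)
  have L0: "L \<ge> 0" using lipschitz_on_nonneg[OF L] .
  show ?thesis
    unfolding abs_cont_on_def
  proof (intro allI impI)
    fix e :: real assume e: "e > 0"
    show "\<exists>\<delta>>0. \<forall>(n::nat) l r. (\<forall>i<n. a \<le> l i \<and> l i \<le> r i \<and> r i \<le> b) \<longrightarrow>
        (\<forall>i<n. \<forall>j<n. i \<noteq> j \<longrightarrow> {l i<..<r i} \<inter> {l j<..<r j} = {}) \<longrightarrow>
        (\<Sum>i<n. r i - l i) < \<delta> \<longrightarrow> (\<Sum>i<n. dist (f (l i)) (f (r i))) < e"
    proof (intro exI[of _ "e / (L + 1)"] conjI allI impI)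
      show "e / (L + 1) > 0" using e L0 by simp
      fix n :: nat and l r :: "nat \<Rightarrow> real"
      assume lr: "\<forall>i<n. a \<le> l i \<and> l i \<le> r i \<and> r i \<le> b" and s: "(\<Sum>i<n. r i - l i) < e / (L + 1)"
      have "(\<Sum>i<n. dist (f (l i)) (f (r i))) \<le> (\<Sum>i<n. L * (r i - l i))"
      proof (rule sum_mono)
        fix i assume "i \<in> {..<n}"
        then have "l i \<in> {a..b}" "r i \<in> {a..b}" "l i \<le> r i" using lr by force+
        then show "dist (f (l i)) (f (r i)) \<le> L * (r i - l i)"
          using lipschitz_onD[OF L, of "l i" "r i"] by (simp add: dist_real_def)
      qed
      also have "\<dots> \<le> (L + 1) * (\<Sum>i<n. r i - l i)"
        unfolding sum_distrib_left[symmetric] using lr by (intro mult_right_mono sum_nonneg) auto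
      also have "\<dots> < e" using s L0 by (simp add: field_simps)
      finally show "(\<Sum>i<n. dist (f (l i)) (f (r i))) < e" .
    qed
  qed
qed

lemma continuous_negligible_zero:
  fixes f :: "real \<Rightarrow> real"
  assumes cont: "continuous_on {a..b} f" and ab: "a < b" and N: "negligible N"
    and z: "\<And>t. t \<in> {a<..<b} - N \<Longrightarrow> f t = 0" and t: "t \<in> {a..b}"
  shows "f t = 0"
proof -
  have "open ({a<..<b} \<inter> f -` (- {0}))"
    using cont by (intro continuous_open_preimage) (auto intro: continuous_on_subset)
  moreover have "negligible ({a<..<b} \<inter> f -` (- {0}))"
    by (rule negligible_subset[OF N]) (use z in auto)
  ultimately have "{a<..<b} \<inter> f -` (- {0}) = {}" using open_not_negligible by blast
  then have "\<forall>t\<in>{a<..<b}. f t = 0" by auto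
  moreover have "closure {a<..<b} = {a..b}" using ab by simp
  ultimately show ?thesis
    using continuous_constant_on_closure[of "{a<..<b}" f 0 t] cont t by auto
qed

section \<open>Flows of constant controls\<close>

text \<open>A word is a list of pairs of a duration and a constant control. Durations may be negative: the flow of \<open>c\<close> for the
  time \<open>-t\<close> is the flow of the admissible control \<open>-c\<close> for the time \<open>t\<close>, and is charged as \<open>t\<close> by \<open>dur\<close> below.\<close>

type_synonym arc = "real \<times> (real \<times> real)"

fun flow :: "arc \<Rightarrow> point \<Rightarrow> point" where
  "flow (t, a, b) (x, y, z, v, w) =
    (let r = (x\<^sup>2 + y\<^sup>2) * t + (x * a + y * b) * t\<^sup>2 + (a\<^sup>2 + b\<^sup>2) * t ^ 3 / 3
     in (x + a * t, y + b * t, z + (x * b - y * a) * t / 2, v + b * r / 2, w - a * r / 2))"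

text \<open>Moment coordinates of a planar path \<open>a G + b K\<close>: besides \<open>a\<close> and \<open>b\<close> the integrals of \<open>a\<close>, \<open>a\<^sup>2\<close> and \<open>a b\<close> with
  respect to \<open>b\<close>. They make word identities short, because a move along \<open>G\<close> changes only \<open>a\<close>; the map
  \<open>embed\<close> below turns them into the endpoint of the trajectory for an arbitrary frame and starting point.\<close>

fun mflow :: "arc \<Rightarrow> point \<Rightarrow> point" where
  "mflow (t, p, q) (a, b, A, J, K) =
    (a + p * t, b + q * t, A + q * (a * t + p * t\<^sup>2 / 2),
     J + q * (a\<^sup>2 * t + a * p * t\<^sup>2 + p\<^sup>2 * t ^ 3 / 3),
     K + q * (a * b * t + (a * q + b * p) * t\<^sup>2 / 2 + p * q * t ^ 3 / 3))"

definition comb :: "real \<times> real \<Rightarrow> real \<times> real \<Rightarrow> real \<times> real \<Rightarrow> real \<times> real" where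
  "comb G K c = fst c *\<^sub>R G + snd c *\<^sub>R K"

text \<open>The integrals of \<open>x\<^sup>2 + y\<^sup>2\<close> with respect to \<open>a\<close> and to \<open>b\<close>, in terms of moments and of the scalar products of
  the starting point \<open>R, G, L\<close> and of the frame \<open>GG, GK, KK\<close>.\<close>

definition intA :: "real \<Rightarrow> real \<Rightarrow> real \<Rightarrow> real \<Rightarrow> real \<Rightarrow> real \<Rightarrow> real \<Rightarrow> real \<Rightarrow> real \<Rightarrow> real \<Rightarrow> real \<Rightarrow> real" where
  "intA R G L GG GK KK a b A J K =
     R * a + G * a\<^sup>2 + 2 * L * (a * b - A) + GG * a ^ 3 / 3 + GK * (a\<^sup>2 * b - J) + KK * (a * b\<^sup>2 - 2 * K)"

definition intB :: "real \<Rightarrow> real \<Rightarrow> real \<Rightarrow> real \<Rightarrow> real \<Rightarrow> real \<Rightarrow> real \<Rightarrow> real \<Rightarrow> real \<Rightarrow> real \<Rightarrow> real \<Rightarrow> real" where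
  "intB R G L GG GK KK a b A J K =
     R * b + 2 * G * A + L * b\<^sup>2 + GG * J + 2 * GK * K + KK * b ^ 3 / 3"

fun embed :: "real \<times> real \<Rightarrow> real \<times> real \<Rightarrow> point \<Rightarrow> point \<Rightarrow> point" where
  "embed (g1, g2) (k1, k2) (x, y, z, v, w) (a, b, A, J, K) =
    (let int = (\<lambda>f. f (x\<^sup>2 + y\<^sup>2) (x * g1 + y * g2) (x * k1 + y * k2)
           (g1\<^sup>2 + g2\<^sup>2) (g1 * k1 + g2 * k2) (k1\<^sup>2 + k2\<^sup>2) a b A J K)
     in (x + a * g1 + b * k1, y + a * g2 + b * k2,
         z + ((x * g2 - y * g1) * a + (x * k2 - y * k1) * b + (g1 * k2 - g2 * k1) * (2 * A - a * b)) / 2,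
         v + (g2 * int intA + k2 * int intB) / 2, w - (g1 * int intA + k1 * int intB) / 2))"

text \<open>\<open>r\<close> is the time integral over the arc of the squared norm of the planar
  base point, expanded in the frame. Under a constant control its integrals with respect to
  \<open>a\<close> and \<open>b\<close> are \<open>p * r\<close> and \<open>q * r\<close>.
  \<open>intA\<close> reduces integrals against \<open>a\<close> to moments against \<open>b\<close>
  by integration by parts.\<close>

lemma int_mflow:
  assumes "mflow (t, p, q) (a, b, A, J, K) = (a', b', A', J', K')"
    and "r = (R + 2 * G * a + 2 * L * b + GG * a\<^sup>2 + 2 * GK * a * b + KK * b\<^sup>2) * t
      + (p * (G + a * GG + b * GK) + q * (L + a * GK + b * KK)) * t\<^sup>2
      + (p\<^sup>2 * GG + 2 * p * q * GK + q\<^sup>2 * KK) * t ^ 3 / 3"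
  shows "intA R G L GG GK KK a' b' A' J' K' = intA R G L GG GK KK a b A J K + p * r"
    and "intB R G L GG GK KK a' b' A' J' K' = intB R G L GG GK KK a b A J K + q * r"
proof -
  have e: "a' = a + p * t" "b' = b + q * t" "A' = A + q * (a * t + p * t\<^sup>2 / 2)"
     "J' = J + q * (a\<^sup>2 * t + a * p * t\<^sup>2 + p\<^sup>2 * t ^ 3 / 3)"
     "K' = K + q * (a * b * t + (a * q + b * p) * t\<^sup>2 / 2 + p * q * t ^ 3 / 3)"
    using assms(1) by auto
  show "intA R G L GG GK KK a' b' A' J' K' = intA R G L GG GK KK a b A J K + p * r"
    unfolding intA_def e assms(2) by (simp add: field_simps power2_eq_square power3_eq_cube)
  show "intB R G L GG GK KK a' b' A' J' K' = intB R G L GG GK KK a b A J K + q * r"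
    unfolding intB_def e assms(2) by (simp add: field_simps power2_eq_square power3_eq_cube)
qed

lemma embed_0: "embed G K p (0, 0, 0, 0, 0) = p"
  by (cases G; cases K; cases p) (auto simp: intA_def intB_def)

text \<open>\<open>embed\<close> intertwines the two flows. An identity of words in moment
  coordinates therefore holds for trajectories from every starting point and in every frame.\<close>

lemma flow_embed:
  "flow (t, comb G K c) (embed G K p s) = embed G K p (mflow (t, c) s)"
proof -
  obtain g1 g2 k1 k2 c1 c2 where [simp]: "G = (g1, g2)" "K = (k1, k2)" "c = (c1, c2)"
    by (metis surj_pair)
  obtain x y z v w where [simp]: "p = (x, y, z, v, w)" by (metis surj_pair)
  obtain a b A J L where [simp]: "s = (a, b, A, J, L)" by (metis surj_pair)
  obtain a' b' A' J' L' where s': "mflow (t, c1, c2) (a, b, A, J, L) = (a', b', A', J', L')"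
    by (metis surj_pair)
  define X Y U1 U2 where "X = x + a * g1 + b * k1" "Y = y + a * g2 + b * k2"
    "U1 = c1 * g1 + c2 * k1" "U2 = c1 * g2 + c2 * k2"
  define r where "r = (X\<^sup>2 + Y\<^sup>2) * t + (X * U1 + Y * U2) * t\<^sup>2 + (U1\<^sup>2 + U2\<^sup>2) * t ^ 3 / 3"
  define i1 where "i1 = (\<lambda>a b A J K. intA (x\<^sup>2 + y\<^sup>2) (x * g1 + y * g2) (x * k1 + y * k2)
           (g1\<^sup>2 + g2\<^sup>2) (g1 * k1 + g2 * k2) (k1\<^sup>2 + k2\<^sup>2) a b A J K)"
  define i2 where "i2 = (\<lambda>a b A J K. intB (x\<^sup>2 + y\<^sup>2) (x * g1 + y * g2) (x * k1 + y * k2)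
           (g1\<^sup>2 + g2\<^sup>2) (g1 * k1 + g2 * k2) (k1\<^sup>2 + k2\<^sup>2) a b A J K)"
  have r: "r = ((x\<^sup>2 + y\<^sup>2) + 2 * (x * g1 + y * g2) * a + 2 * (x * k1 + y * k2) * b + (g1\<^sup>2 + g2\<^sup>2) * a\<^sup>2
        + 2 * (g1 * k1 + g2 * k2) * a * b + (k1\<^sup>2 + k2\<^sup>2) * b\<^sup>2) * t
      + (c1 * ((x * g1 + y * g2) + a * (g1\<^sup>2 + g2\<^sup>2) + b * (g1 * k1 + g2 * k2))
         + c2 * ((x * k1 + y * k2) + a * (g1 * k1 + g2 * k2) + b * (k1\<^sup>2 + k2\<^sup>2))) * t\<^sup>2
      + (c1\<^sup>2 * (g1\<^sup>2 + g2\<^sup>2) + 2 * c1 * c2 * (g1 * k1 + g2 * k2) + c2\<^sup>2 * (k1\<^sup>2 + k2\<^sup>2)) * t ^ 3 / 3"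
    unfolding r_def X_Y_U1_U2_def by (simp add: field_simps power2_eq_square)
  have i: "i1 a' b' A' J' L' = i1 a b A J L + c1 * r" "i2 a' b' A' J' L' = i2 a b A J L + c2 * r"
    unfolding i1_def i2_def using int_mflow[OF s' r] by blast+
  have abA: "a' = a + c1 * t" "b' = b + c2 * t" "A' = A + c2 * (a * t + c1 * t\<^sup>2 / 2)"
    using s' by auto
  have "flow (t, comb G K c) (embed G K p s) =
      (X + U1 * t, Y + U2 * t,
       z + ((x * g2 - y * g1) * a + (x * k2 - y * k1) * b + (g1 * k2 - g2 * k1) * (2 * A - a * b)) / 2
        + (X * U2 - Y * U1) * t / 2,
       v + (g2 * i1 a b A J L + k2 * i2 a b A J L) / 2 + U2 * r / 2,
       w - (g1 * i1 a b A J L + k1 * i2 a b A J L) / 2 - U1 * r / 2)"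
    by (simp add: comb_def Let_def i1_def i2_def r_def X_Y_U1_U2_def)
  also have "\<dots> = embed G K p (a', b', A', J', L')"
    unfolding embed.simps \<open>G = _\<close> \<open>K = _\<close> \<open>p = _\<close> Let_def i[unfolded i1_def i2_def]
    unfolding i1_def i2_def by (auto simp: X_Y_U1_U2_def abA field_simps power2_eq_square)
  finally show ?thesis by (simp only: s' \<open>c = _\<close> \<open>s = _\<close>)
qed

section \<open>Words and their replacements in moment coordinates\<close>

definition run :: "arc list \<Rightarrow> point \<Rightarrow> point" where "run = fold flow"
definition mrun :: "arc list \<Rightarrow> point \<Rightarrow> point" where "mrun = fold mflow"

lemma run_simps [simp]: "run [] p = p" "run (a # w) p = run w (flow a p)" "run (w @ w') p = run w' (run w p)"
  by (simp_all add: run_def)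
lemma mrun_simps [simp]: "mrun [] p = p" "mrun (a # w) p = mrun w (mflow a p)" "mrun (w @ w') p = mrun w' (mrun w p)"
  by (simp_all add: mrun_def)

definition in_frame :: "real \<times> real \<Rightarrow> real \<times> real \<Rightarrow> arc list \<Rightarrow> arc list" where
  "in_frame G K = map (\<lambda>(t, c). (t, comb G K c))"

lemma run_in_frame_embed: "run (in_frame G K w) (embed G K p s) = embed G K p (mrun w s)"
  by (induction w arbitrary: s) (auto simp: in_frame_def flow_embed)

lemma run_in_frame: "run (in_frame G K w) p = embed G K p (mrun w (0, 0, 0, 0, 0))"
  by (metis embed_0 run_in_frame_embed)

definition dur :: "arc list \<Rightarrow> real" where "dur w = (\<Sum>(t, c)\<leftarrow>w. \<bar>t\<bar>)"

definition quad :: "real \<Rightarrow> real \<Rightarrow> real \<Rightarrow> real \<Rightarrow> arc list" where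
  "quad t1 t2 t3 t4 = [(t1, 1, 0), (t2, 0, -1), (t3, -1, 0), (t4, 0, 1)]"

fun shift :: "real \<Rightarrow> real \<Rightarrow> point \<Rightarrow> point" where
  "shift j k (a, b, A, J, K) = (a, b, A, J + j, K + k)"

lemma mflow_zero [simp]: "mflow (0, c) s = s"
  by (cases c; cases s) auto

lemma mflow_shift: "mflow c (shift j k s) = shift j k (mflow c s)"
  by (cases c; cases s) auto

text \<open>Moment of the loop started at the origin minus the moment of the straight chord with the
  same ends; \<open>quad_K\<close> is the same for the integral of \<open>a b\<close>.\<close>

definition quad_J :: "real \<Rightarrow> real \<Rightarrow> real \<Rightarrow> real \<Rightarrow> real" where
  "quad_J t1 t2 t3 t4 = - t1\<^sup>2 * t2 + (t1 - t3)\<^sup>2 * t4 - (t1 - t3)\<^sup>2 * (t4 - t2) / 3"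
definition quad_K :: "real \<Rightarrow> real \<Rightarrow> real \<Rightarrow> real \<Rightarrow> real" where
  "quad_K t1 t2 t3 t4 = t1 * t2\<^sup>2 / 2 + (t1 - t3) * (t4\<^sup>2 / 2 - t2 * t4) - (t1 - t3) * (t4 - t2)\<^sup>2 / 3"

text \<open>The third hypothesis says that the area between the loop and the chord of its endpoints vanishes.\<close>

lemma mrun_quad:
  assumes 1: "t1 - t3 = d * p" and 2: "t4 - t2 = d * q" and 3: "(t1 - t3) * t4 = (t1 + t3) * t2"
  shows "mrun (quad t1 t2 t3 t4) s = shift (quad_J t1 t2 t3 t4) (quad_K t1 t2 t3 t4) (mflow (d, p, q) s)"
    and "mrun (rev (quad t1 t2 t3 t4)) s = shift (quad_J t1 t2 t3 t4) (quad_K t1 t2 t3 t4) (mflow (d, p, q) s)"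
proof -
  obtain a b A J L where [simp]: "s = (a, b, A, J, L)" by (metis surj_pair)
  have t: "t1 = t3 + d * p" "t4 = t2 + d * q" using 1 2 by auto
  have E: "d * (d * (p * q)) = t2 * (t3 * 2)"
    using 3 unfolding t by (simp add: algebra_simps)
  show "mrun (quad t1 t2 t3 t4) s = shift (quad_J t1 t2 t3 t4) (quad_K t1 t2 t3 t4) (mflow (d, p, q) s)"
    unfolding t
    by (simp add: quad_def quad_J_def quad_K_def power2_eq_square power3_eq_cube field_simps)
       (use E in \<open>auto; algebra\<close>)
  \<comment> \<open>The reversed word runs backwards along the path reflected in the midpoint of its
    chord. This preserves the quadratic moments about the midpoint and negates the area between path
    and chord; as the area vanishes, both words have the same effect.\<close>
  show "mrun (rev (quad t1 t2 t3 t4)) s = shift (quad_J t1 t2 t3 t4) (quad_K t1 t2 t3 t4) (mflow (d, p, q) s)"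
    unfolding t
    by (simp add: quad_def quad_J_def quad_K_def power2_eq_square power3_eq_cube field_simps)
       (use E in \<open>auto; algebra\<close>)
qed

lemma mrun_straight: "mrun [(s, c), (t, c)] p = mflow (s + t, c) p"
  by (cases c; cases p) (simp add: power2_eq_square power3_eq_cube field_simps)

lemma shift_shift: "shift j k (shift j' k' s) = shift (j' + j) (k' + k) s"
  by (cases s) auto

lemma quad_JK_scale: "quad_J (r * t1) (r * t2) (r * t3) (r * t4) = r ^ 3 * quad_J t1 t2 t3 t4"
  "quad_K (r * t1) (r * t2) (r * t3) (r * t4) = r ^ 3 * quad_K t1 t2 t3 t4"
  unfolding quad_J_def quad_K_def by (simp_all add: power2_eq_square power3_eq_cube field_simps)

text \<open>Shifts commute with all moves, so the straight displacements simply add up: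
  \<open>2 d\<close> from two loops against \<open>r d\<close> from the enlarged one, with
  \<open>(2 - r) d\<close> to be made up. The shift of the enlarged loop is \<open>r ^ 3 = 2\<close>
  times that of one loop.\<close>

lemma two_loops_eq:
  assumes 1: "t1 - t3 = d * p" and 2: "t4 - t2 = d * q" and 3: "(t1 - t3) * t4 = (t1 + t3) * t2"
    and L: "L \<in> {quad t1 t2 t3 t4, rev (quad t1 t2 t3 t4)}"
    and L': "L' \<in> {quad t1 t2 t3 t4, rev (quad t1 t2 t3 t4)}"
    and r: "r ^ 3 = 2"
  shows "mrun ([(s1, p, q)] @ L @ [(s2, p, q)] @ L') s
    = mrun (quad (r * t1) (r * t2) (r * t3) (r * t4) @ [(s1 + s2 + (2 - r) * d, p, q)]) s"
proof -
  let ?j = "quad_J t1 t2 t3 t4" and ?k = "quad_K t1 t2 t3 t4"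
  have l: "mrun L s = shift ?j ?k (mflow (d, p, q) s)" "mrun L' s = shift ?j ?k (mflow (d, p, q) s)" for s
    using L L' mrun_quad[OF 1 2 3] by (metis empty_iff insert_iff)+
  have add: "mflow (t', p, q) (mflow (t, p, q) s) = mflow (t + t', p, q) s" for t t' s
    using mrun_straight[of t "(p, q)" t' s] by (simp del: mflow.simps)
  have "r * t1 - r * t3 = (r * d) * p" "r * t4 - r * t2 = (r * d) * q"
    using 1 2 by (simp_all flip: right_diff_distrib)
  moreover have "(r * t1 - r * t3) * (r * t4) = (r * t1 + r * t3) * (r * t2)"
    using 3 by (metis (no_types, lifting) distrib_left mult.assoc mult.left_commute right_diff_distrib)
  ultimately have q: "mrun (quad (r * t1) (r * t2) (r * t3) (r * t4)) s = shift (2 * ?j) (2 * ?k) (mflow (r * d, p, q) s)"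
    for s using mrun_quad(1) quad_JK_scale r by metis
  show ?thesis
    by (simp del: mflow.simps shift.simps add: l q add mflow_shift shift_shift)
       (simp add: algebra_simps)
qed

text \<open>A loop when the fourth side of the square consists of equilibria. The middle side is
  crossed at constant full speed, the outer ones at half that mean speed, hence the ratio 2 : 1 : 2
  of durations.\<close>

definition hook :: "real \<Rightarrow> real \<Rightarrow> arc list" where
  "hook g y = [(2 * y, g, 0), (y, 0, -1), (2 * y, - g, 0)]"

text \<open>The two excursions along \<open>g\<close> are merged into one with the doubled horizontal part, which preserves the first two
  moments; \<open>q\<close> then corrects the moment of \<open>a b\<close> and \<open>r\<close> the displacement.\<close>

lemma three_hooks_eq:
  assumes "q = p - (s0 + s2) + 2 * y" and "r = (s1 + s3) + 2 * (s0 + s2) - 2 * y - 2 * p"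
  shows "mrun ([(s0, 0, 1)] @ hook g y @ [(s1, 0, 1)] @ hook (- g) y @ [(s2, 0, 1)] @ hook g y @ [(s3, 0, 1)]) s
    = mrun [(p, 0, 1), (2 * y, g, 0), (2 * y, 0, -1), (2 * y, - g, 0), (q, 0, 1),
        (2 * y, - g, 0), (y, 0, -1), (2 * y, g, 0), (r, 0, 1)] s"
  unfolding assms
  by (cases s) (simp add: hook_def power2_eq_square power3_eq_cube field_simps)

text \<open>All moves along the second frame vector take place on three parallel lines at distance
  \<open>2 * y\<close>. Both words have the same total on each line, which fixes the first two
  moments; the division of the middle total into \<open>q\<close> and \<open>r\<close> is dictated
  by the moment of \<open>a b\<close>.\<close>

lemma half_hooks_eq:
  assumes "q = (a + b) / 2 + y" and "r = (a + b) / 2 + s - y"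
  shows "mrun ([(y, 0, -1), (2 * y, g, 0), (a, 0, 1)] @ hook g y @ [(s, 0, 1)] @ hook (- g) y
      @ [(b, 0, 1), (2 * y, g, 0), (y, 0, -1)]) p
    = mrun [(2 * y, 0, -1), (2 * y, g, 0), (q, 0, 1), (2 * y, g, 0), (2 * y, 0, -1), (2 * y, - g, 0),
        (r, 0, 1), (2 * y, g, 0)] p"
  unfolding assms
  by (cases p) (simp add: hook_def power2_eq_square power3_eq_cube field_simps)

declare flow.simps [simp del] mflow.simps [simp del] shift.simps [simp del]

section \<open>Realising words by trajectories\<close>

lemma flow_has_vector_derivative:
  "((\<lambda>t. flow (t, c) p) has_vector_derivative
     fst c *\<^sub>R X1 (flow (t, c) p) + snd c *\<^sub>R X2 (flow (t, c) p)) (at t within S)"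
proof -
  obtain a b where [simp]: "c = (a, b)" by (metis surj_pair)
  obtain x y z v w where [simp]: "p = (x, y, z, v, w)" by (metis surj_pair)
  define r where "r = (\<lambda>t. (x\<^sup>2 + y\<^sup>2) * t + (x * a + y * b) * t\<^sup>2 + (a\<^sup>2 + b\<^sup>2) * t ^ 3 / 3)"
  have r [derivative_intros]: "(r has_real_derivative (x + a * t)\<^sup>2 + (y + b * t)\<^sup>2) (at t within S)"
    unfolding r_def by (auto intro!: derivative_eq_intros simp: power2_eq_square algebra_simps)
  have flow: "flow (t, c) p = (x + a * t, y + b * t, z + (x * b - y * a) * t / 2, v + b * r t / 2, w - a * r t / 2)"
    for t by (simp add: r_def Let_def flow.simps)
  have "((\<lambda>t. x + a * t) has_real_derivative a) (at t within S)"
    "((\<lambda>t. y + b * t) has_real_derivative b) (at t within S)"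
    "((\<lambda>t. z + (x * b - y * a) * t / 2) has_real_derivative (x * b - y * a) / 2) (at t within S)"
    "((\<lambda>t. v + b * r t / 2) has_real_derivative b * ((x + a * t)\<^sup>2 + (y + b * t)\<^sup>2) / 2) (at t within S)"
    "((\<lambda>t. w - a * r t / 2) has_real_derivative - (a * ((x + a * t)\<^sup>2 + (y + b * t)\<^sup>2) / 2)) (at t within S)"
    by (rule derivative_eq_intros r refl | simp)+
  then have "((\<lambda>t. flow (t, c) p) has_vector_derivative
     (a, b, (x * b - y * a) / 2, b * ((x + a * t)\<^sup>2 + (y + b * t)\<^sup>2) / 2,
       - (a * ((x + a * t)\<^sup>2 + (y + b * t)\<^sup>2) / 2))) (at t within S)"
    unfolding flow has_real_derivative_iff_has_vector_derivative
    by (intro has_vector_derivative_Pair)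
  moreover have "fst c *\<^sub>R X1 (flow (t, c) p) + snd c *\<^sub>R X2 (flow (t, c) p)
     = (a, b, (x * b - y * a) / 2, b * ((x + a * t)\<^sup>2 + (y + b * t)\<^sup>2) / 2,
       - (a * ((x + a * t)\<^sup>2 + (y + b * t)\<^sup>2) / 2))"
    unfolding flow by (simp add: X1_def X2_def field_simps)
  ultimately show ?thesis by simp
qed

lemma flow_lip: "lip a b (\<lambda>t. flow (t - s, c) p)"
  by (cases c; cases p; simp add: Let_def flow.simps)
     (intro lip_const lip_id lip_Pair lip_add lip_diff lip_divide lip_mult lip_power)

lemma flow_zero [simp]: "flow (0, c) p = p"
  by (cases c; cases p) (auto simp: flow.simps)

lemma flow_uminus: "flow (- t, - c) p = flow (t, c) p"
  by (cases c; cases p) (auto simp: Let_def flow.simps field_simps)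

text \<open>The system is triangular: the first two coordinates have constant velocity, and
  \<open>X1\<close>, \<open>X2\<close> depend on these two alone. Once they agree with the flow, the
  other three coordinates have the same derivatives as the flow almost everywhere.\<close>

lemma flow_unique:
  assumes q: "lip a b q" and N: "negligible N"
    and d: "\<And>t. t \<in> {a<..<b} - N \<Longrightarrow> (q has_vector_derivative (fst c *\<^sub>R X1 (q t) + snd c *\<^sub>R X2 (q t))) (at t within {a..b})"
    and t: "t \<in> {a..b}"
  shows "q t = flow (t - a, c) (q a)"
proof -
  define r where "r = (\<lambda>t. flow (t - a, c) (q a))"
  have r: "lip a b r" unfolding r_def by (rule flow_lip)
  have dr: "(r has_vector_derivative (fst c *\<^sub>R X1 (r t) + snd c *\<^sub>R X2 (r t))) (at t within {a..b})" for t
  proof -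
    have "((\<lambda>s. s - a) has_vector_derivative 1) (at t)"
      unfolding has_real_derivative_iff_has_vector_derivative[symmetric]
      by (auto intro!: derivative_eq_intros)
    from vector_diff_chain_at[OF this flow_has_vector_derivative[of c "q a"]]
    show ?thesis by (simp add: o_def r_def has_vector_derivative_at_within)
  qed
  have ra: "r a = q a" by (simp add: r_def)
  have comp: "L (q t) = L (r t)"
    if L: "bounded_linear L" and eq: "\<And>t. t \<in> {a..b} \<Longrightarrow>
        L (fst c *\<^sub>R X1 (q t) + snd c *\<^sub>R X2 (q t)) = L (fst c *\<^sub>R X1 (r t) + snd c *\<^sub>R X2 (r t))"
      and t: "t \<in> {a..b}" for L :: "point \<Rightarrow> real" and t
  proof (rule lip_AE_unique[OF _ _ N _ t])
    show "lip a b (\<lambda>t. L (q t))" "lip a b (\<lambda>t. L (r t))" using lip_bounded_linear[OF L] q r by auto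
    fix s assume s: "s \<in> {a<..<b} - N"
    have "((\<lambda>t. L (q t)) has_real_derivative L (fst c *\<^sub>R X1 (q s) + snd c *\<^sub>R X2 (q s))) (at s within {a..b})"
      unfolding has_real_derivative_iff_has_vector_derivative
      by (rule bounded_linear.has_vector_derivative[OF L d[OF s]])
    moreover have "((\<lambda>t. L (r t)) has_real_derivative L (fst c *\<^sub>R X1 (r s) + snd c *\<^sub>R X2 (r s))) (at s within {a..b})"
      unfolding has_real_derivative_iff_has_vector_derivative
      by (rule bounded_linear.has_vector_derivative[OF L dr])
    ultimately show "\<exists>D. ((\<lambda>t. L (q t)) has_real_derivative D) (at s within {a..b}) \<and>
        ((\<lambda>t. L (r t)) has_real_derivative D) (at s within {a..b})"
      using eq[of s] s by auto
  qed (simp add: ra)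
  define px py pz pv pw where p: "px = (\<lambda>p :: point. fst p)" "py = (\<lambda>p :: point. fst (snd p))"
    "pz = (\<lambda>p :: point. fst (snd (snd p)))" "pv = (\<lambda>p :: point. fst (snd (snd (snd p))))"
    "pw = (\<lambda>p :: point. snd (snd (snd (snd p))))"
  note bl = bounded_linear_fst bounded_linear_snd and compose = bounded_linear_compose
  have B: "bounded_linear px" "bounded_linear py" "bounded_linear pz" "bounded_linear pv" "bounded_linear pw"
    unfolding p
    by (rule bl(1) compose[OF bl(1) bl(2)] compose[OF bl(1) compose[OF bl(2) bl(2)]]
      compose[OF bl(1) compose[OF bl(2) compose[OF bl(2) bl(2)]]]
      compose[OF bl(2) compose[OF bl(2) compose[OF bl(2) bl(2)]]])+
  have x1: "X1 p = (1, 0, - py p / 2, 0, - ((px p)\<^sup>2 + (py p)\<^sup>2) / 2)"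
    and x2: "X2 p = (0, 1, px p / 2, ((px p)\<^sup>2 + (py p)\<^sup>2) / 2, 0)" for p
    by (cases p; simp add: X1_def X2_def p)+
  have X: "px (q t) = px (r t)" if "t \<in> {a..b}" for t
    by (rule comp[OF B(1) _ that]) (simp add: x1 x2 p)
  have Y: "py (q t) = py (r t)" if "t \<in> {a..b}" for t
    by (rule comp[OF B(2) _ that]) (simp add: x1 x2 p)
  have "X1 (q t) = X1 (r t)" "X2 (q t) = X2 (r t)" if "t \<in> {a..b}" for t
    using X[OF that] Y[OF that] by (simp_all add: x1 x2)
  then have "pz (q t) = pz (r t)" "pv (q t) = pv (r t)" "pw (q t) = pw (r t)"
    using comp[OF B(3) _ t] comp[OF B(4) _ t] comp[OF B(5) _ t] by auto
  then show ?thesis using X[OF t] Y[OF t] by (simp add: p prod_eq_iff r_def)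
qed

definition unit_controls :: "arc list \<Rightarrow> bool" where
  "unit_controls w \<longleftrightarrow> (\<forall>(t, c)\<in>set w. \<bar>fst c\<bar> \<le> 1 \<and> \<bar>snd c\<bar> \<le> 1)"

lemma run_trajectory:
  assumes "unit_controls w"
  shows "\<exists>q u. trajectory (dur w) q u \<and> q 0 = p \<and> q (dur w) = run w p"
proof -
  \<comment> \<open>The induction carries Borel measurability on the whole line and a finite
    exceptional set, which survive appending an arc, and passes to the Lebesgue statements only at
    the end.\<close>
  have "\<exists>q u S. 0 \<le> dur w \<and> u \<in> borel_measurable borel \<and> (\<forall>t. \<bar>fst (u t)\<bar> \<le> 1 \<and> \<bar>snd (u t)\<bar> \<le> 1)
     \<and> lip 0 (dur w) q \<and> finite S \<and> q 0 = p \<and> q (dur w) = run w p \<and>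
     (\<forall>t\<in>{0..dur w} - S. (q has_vector_derivative (fst (u t) *\<^sub>R X1 (q t) + snd (u t) *\<^sub>R X2 (q t)))
         (at t within {0..dur w}))"
    using assms
  proof (induction w rule: rev_induct)
    case Nil
    show ?case
      by (intro exI[of _ "\<lambda>_. p"] exI[of _ "\<lambda>_. (0, 0)"] exI[of _ "{0}"]) (auto simp: dur_def)
  next
    case (snoc a w)
    obtain t0 c0 where a: "a = (t0, c0)" by (metis surj_pair)
    define t where "t = \<bar>t0\<bar>"
    define c where "c = (if t0 < 0 then - c0 else c0)"
    have fa: "flow a = flow (t, c)" and t: "t \<ge> 0" and c: "\<bar>fst c\<bar> \<le> 1" "\<bar>snd c\<bar> \<le> 1"
      using flow_uminus[of t0 c0] snoc.prems
      by (auto simp: a t_def c_def unit_controls_def)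
    define T where "T = dur w"
    have dT: "dur (w @ [a]) = T + t" by (simp add: dur_def T_def a t_def)
    obtain q u S where IH: "0 \<le> T" "u \<in> borel_measurable borel" "\<And>t. \<bar>fst (u t)\<bar> \<le> 1 \<and> \<bar>snd (u t)\<bar> \<le> 1"
     "lip 0 T q" "finite S" "q 0 = p" "q T = run w p"
     "\<And>t. t\<in>{0..T} - S \<Longrightarrow> (q has_vector_derivative (fst (u t) *\<^sub>R X1 (q t) + snd (u t) *\<^sub>R X2 (q t)))
         (at t within {0..T})"
      using snoc.IH snoc.prems unfolding T_def by (auto simp: unit_controls_def)
    define q' where "q' = (\<lambda>s. if s \<le> T then q s else flow (s - T, c) (q T))"
    define u' where "u' = (\<lambda>s. if s \<le> T then u s else c)"
    have "u' \<in> borel_measurable borel" unfolding u'_def using IH(2) by measurable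
    moreover have "\<bar>fst (u' t)\<bar> \<le> 1 \<and> \<bar>snd (u' t)\<bar> \<le> 1" for t using IH(3) c by (auto simp: u'_def)
    moreover have "lip 0 (T + t) q'"
      unfolding q'_def by (intro lip_concat IH flow_lip) auto
    moreover have "q' 0 = p" "q' (T + t) = run (w @ [a]) p"
      using IH t by (auto simp: q'_def fa)
    moreover have "(q' has_vector_derivative (fst (u' s) *\<^sub>R X1 (q' s) + snd (u' s) *\<^sub>R X2 (q' s)))
         (at s within {0..T + t})" if s: "s \<in> {0..T + t} - insert T S" for s
    proof (cases "s < T")
      case True
      then have "(q has_vector_derivative (fst (u s) *\<^sub>R X1 (q s) + snd (u s) *\<^sub>R X2 (q s))) (at s within {0..T})"
        using IH(8) s by auto
      moreover have "at s within {0..T} = at s within {0..T + t}"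
        by (rule at_within_nhd[of _ "{..<T}"]) (use True t in auto)
      ultimately have "(q has_vector_derivative (fst (u s) *\<^sub>R X1 (q s) + snd (u s) *\<^sub>R X2 (q s))) (at s within {0..T + t})"
        by simp
      moreover have "\<forall>\<^sub>F r in nhds s. q r = q' r"
        using True by (intro eventually_nhds_in_open[of "{..<T}", THEN eventually_mono]) (auto simp: q'_def)
      ultimately have "(q' has_vector_derivative (fst (u s) *\<^sub>R X1 (q s) + snd (u s) *\<^sub>R X2 (q s))) (at s within {0..T + t})"
        by (subst has_vector_derivative_cong_ev[of _ q' q])
           (use True in \<open>auto simp: q'_def elim!: eventually_mono\<close>)
      with True show ?thesis by (simp add: q'_def u'_def)
    next
      case False
      then have "s > T" using s by auto
      have "((\<lambda>s. flow (s, c) (q T)) has_vector_derivative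
           (fst c *\<^sub>R X1 (flow (s - T, c) (q T)) + snd c *\<^sub>R X2 (flow (s - T, c) (q T)))) (at (s - T))"
        by (rule flow_has_vector_derivative)
      moreover have "((\<lambda>s. s - T) has_vector_derivative 1) (at s)"
        unfolding has_real_derivative_iff_has_vector_derivative[symmetric]
        by (auto intro!: derivative_eq_intros)
      ultimately
      have "((\<lambda>s. flow (s - T, c) (q T)) has_vector_derivative
           (fst c *\<^sub>R X1 (flow (s - T, c) (q T)) + snd c *\<^sub>R X2 (flow (s - T, c) (q T)))) (at s)"
        using vector_diff_chain_at[where f = "\<lambda>s. s - T" and f' = 1 and x = s] by (simp add: o_def)
      then have "((\<lambda>s. flow (s - T, c) (q T)) has_vector_derivative
           (fst c *\<^sub>R X1 (flow (s - T, c) (q T)) + snd c *\<^sub>R X2 (flow (s - T, c) (q T)))) (at s within {0..T+t})"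
        by (rule has_vector_derivative_at_within)
      moreover have "\<forall>\<^sub>F r in nhds s. flow (r - T, c) (q T) = q' r"
        using \<open>s > T\<close> by (intro eventually_nhds_in_open[of "{T<..}", THEN eventually_mono]) (auto simp: q'_def)
      ultimately have "(q' has_vector_derivative
           (fst c *\<^sub>R X1 (flow (s - T, c) (q T)) + snd c *\<^sub>R X2 (flow (s - T, c) (q T)))) (at s within {0..T+t})"
        by (subst has_vector_derivative_cong_ev[of _ q' "\<lambda>s. flow (s - T, c) (q T)"])
           (use \<open>s > T\<close> in \<open>auto simp: q'_def elim!: eventually_mono\<close>)
      with \<open>s > T\<close> show ?thesis by (simp add: q'_def u'_def)
    qed
    ultimately show ?case
      unfolding dT using IH(1,5) t
      by (intro exI[of _ q'] exI[of _ u'] exI[of _ "insert T S"]) auto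
  qed
  then obtain q u S where *: "0 \<le> dur w" "u \<in> borel_measurable borel" "\<And>t. \<bar>fst (u t)\<bar> \<le> 1 \<and> \<bar>snd (u t)\<bar> \<le> 1"
     "lip 0 (dur w) q" "finite S" "q 0 = p" "q (dur w) = run w p"
     "\<forall>t\<in>{0..dur w} - S. (q has_vector_derivative (fst (u t) *\<^sub>R X1 (q t) + snd (u t) *\<^sub>R X2 (q t)))
         (at t within {0..dur w})" by blast
  have "u \<in> borel_measurable (lebesgue_on {0..dur w})"
    using *(2) by (intro measurable_restrict_space1 measurable_completion) simp
  moreover have "AE t in lebesgue_on {0..dur w}.
       (q has_vector_derivative (fst (u t) *\<^sub>R X1 (q t) + snd (u t) *\<^sub>R X2 (q t))) (at t within {0..dur w})"
    using *(5,8) by (subst AE_lebesgue_on_iff) (auto intro!: exI[of _ S])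
  ultimately have "trajectory (dur w) q u"
    using * lip_imp_abs_cont by (auto simp: trajectory_def admissible_control_def)
  then show ?thesis using * by blast
qed

lemma optimal_le_dur:
  assumes "optimal T q u" "unit_controls w" "run w (q 0) = q T"
  shows "T \<le> dur w"
  using assms run_trajectory[of w "q 0"] unfolding optimal_def by metis

section \<open>Words that are not shortest\<close>

text \<open>If \<open>G\<close> and \<open>K\<close> are adjacent vertices of the control square,
  the frame carries the unit ball of the l1 norm onto that square.\<close>

definition ell1 :: "arc list \<Rightarrow> bool" where
  "ell1 w \<longleftrightarrow> (\<forall>(t, a, b)\<in>set w. \<bar>a\<bar> + \<bar>b\<bar> \<le> 1)"

text \<open>Competitors must act in the same way on every state, not only on one endpoint. A
  replacement can then be made inside any longer word, so the property passes to infixes.\<close>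

definition shortest :: "arc list \<Rightarrow> bool" where
  "shortest w \<longleftrightarrow> (\<forall>w'. ell1 w' \<longrightarrow> (\<forall>s. mrun w' s = mrun w s) \<longrightarrow> dur w \<le> dur w')"

lemma dur_simps [simp]: "dur [] = 0" "dur ((t, c) # w) = \<bar>t\<bar> + dur w" "dur (w @ w') = dur w + dur w'"
  by (simp_all add: dur_def)

lemma ell1_simps [simp]: "ell1 []" "ell1 ((t, a, b) # w) \<longleftrightarrow> \<bar>a\<bar> + \<bar>b\<bar> \<le> 1 \<and> ell1 w"
    "ell1 (w @ w') \<longleftrightarrow> ell1 w \<and> ell1 w'"
  unfolding ell1_def set_append ball_Un by simp_all

lemma shortest_infix:
  assumes "shortest (u @ w @ v)" "ell1 (u @ w @ v)" shows "shortest w"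
  using assms unfolding shortest_def
  by (metis add_le_cancel_left add_le_cancel_right dur_simps(3) ell1_simps(3) mrun_simps(3))

lemma three_hooks_not_shortest:
  assumes "y > 0" "\<bar>g\<bar> = 1" "s0 \<ge> 0" "s1 \<ge> 0" "s2 \<ge> 0" "s3 \<ge> 0" "s0 + s1 + s2 + s3 > 0"
    and o: "\<And>s. mrun o0 s = mflow (s0, 0, 1) s" "\<And>s. mrun o1 s = mflow (s1, 0, 1) s"
      "\<And>s. mrun o2 s = mflow (s2, 0, 1) s" "\<And>s. mrun o3 s = mflow (s3, 0, 1) s"
    and do: "dur o0 = s0" "dur o1 = s1" "dur o2 = s2" "dur o3 = s3"
  shows "\<not> shortest (o0 @ hook g y @ o1 @ hook (- g) y @ o2 @ hook g y @ o3)"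
proof
  assume short: "shortest (o0 @ hook g y @ o1 @ hook (- g) y @ o2 @ hook g y @ o3)"
  \<comment> \<open>The merged word has one free parameter; this choice keeps \<open>p\<close> and
    \<open>q\<close> nonnegative. The saving is \<open>4 * y\<close> if \<open>r\<close> is
    nonnegative, and otherwise \<open>4 * (s0 + s2) + 2 * (s1 + s3)\<close>, which is where some
    positive rest is required.\<close>
  define p where "p = max 0 (s0 + s2 - 2 * y)"
  define q where "q = p - (s0 + s2) + 2 * y"
  define r where "r = (s1 + s3) + 2 * (s0 + s2) - 2 * y - 2 * p"
  let ?w = "[(p, 0, 1), (2 * y, g, 0), (2 * y, 0, -1), (2 * y, - g, 0), (q, 0, 1),
        (2 * y, - g, 0), (y, 0, -1), (2 * y, g, 0), (r, 0, 1)]"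
  have "mrun ?w s = mrun (o0 @ hook g y @ o1 @ hook (- g) y @ o2 @ hook g y @ o3) s" for s
    using three_hooks_eq[OF q_def r_def, of g s] by (simp add: o)
  moreover have "ell1 ?w" using assms(2) by simp
  ultimately have "dur (o0 @ hook g y @ o1 @ hook (- g) y @ o2 @ hook g y @ o3) \<le> dur ?w"
    using short unfolding shortest_def by blast
  then have "15 * y + s0 + s1 + s2 + s3 \<le> 11 * y + \<bar>p\<bar> + \<bar>q\<bar> + \<bar>r\<bar>"
    using assms(1) by (simp add: do hook_def)
  then show False
    using assms(1-7) unfolding q_def r_def p_def by (auto simp: max_def abs_if split: if_splits)
qed

lemma half_hooks_not_shortest:
  assumes "y > 0" "\<bar>g\<bar> = 1" "a \<ge> 0" "b \<ge> 0" "s \<ge> 0"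
  shows "\<not> shortest ([(y, 0, -1), (2 * y, g, 0), (a, 0, 1)] @ hook g y @ [(s, 0, 1)] @ hook (- g) y
      @ [(b, 0, 1), (2 * y, g, 0), (y, 0, -1)])" (is "\<not> shortest ?v")
proof
  assume short: "shortest ?v"
  define q where "q = (a + b) / 2 + y"
  define r where "r = (a + b) / 2 + s - y"
  let ?w = "[(2 * y, 0, -1), (2 * y, g, 0), (q, 0, 1), (2 * y, g, 0), (2 * y, 0, -1), (2 * y, - g, 0),
        (r, 0, 1), (2 * y, g, 0)]"
  have "ell1 ?w" using assms(2) by simp
  moreover have "mrun ?w p = mrun ?v p" for p
    using half_hooks_eq[OF q_def r_def, of g p] by simp
  ultimately have "dur ?v \<le> dur ?w"
    using short unfolding shortest_def by blast
  \<comment> \<open>For nonnegative \<open>r\<close> the saving is \<open>4 * y\<close>; for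
    negative \<open>r\<close> it is still at least \<open>2 * y\<close>.\<close>
  then have "16 * y + a + b + s \<le> 12 * y + \<bar>q\<bar> + \<bar>r\<bar>"
    using assms by (simp add: hook_def)
  then show False
    using assms unfolding q_def r_def by (auto simp: abs_if split: if_splits)
qed

text \<open>\<open>al\<close>, \<open>ka\<close>, \<open>ga\<close> are the speeds at the three
  vertices away from the equilibrium and \<open>h\<close> is twice the length of a side. Under
  constant force a side takes \<open>h\<close> divided by the sum of the speeds at its ends, whence
  the durations in \<open>lp\<close>.\<close>

lemma two_loops_not_shortest:
  assumes al: "al > 0" and ga: "ga > 0" and ka: "ka > 0" "ka\<^sup>2 = al\<^sup>2 + ga\<^sup>2" and h: "h > 0"
    and p: "p = ga\<^sup>2 / ka\<^sup>2" and q: "q = al\<^sup>2 / ka\<^sup>2"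
    and lp: "lp = quad (h / al) (h / (al + ka)) (h / (ka + ga)) (h / ga)"
    and L: "L \<in> {lp, rev lp}" "L' \<in> {lp, rev lp}"
    and o: "\<And>s. mrun o1 s = mflow (s1, p, q) s" "\<And>s. mrun o2 s = mflow (s2, p, q) s"
    and do: "dur o1 = s1" "dur o2 = s2" and s: "s1 \<ge> 0" "s2 \<ge> 0"
  shows "\<not> shortest (o1 @ L @ o2 @ L')"
proof
  assume short: "shortest (o1 @ L @ o2 @ L')"
  define t1 t2 t3 t4 where t: "t1 = h / al" "t2 = h / (al + ka)" "t3 = h / (ka + ga)" "t4 = h / ga"
  define d where "d = h * ka\<^sup>2 * (al + ga - ka) / (al\<^sup>2 * ga\<^sup>2)"
  have lt: "ka < al + ga"
    using al ga ka by (intro power2_less_imp_less[of ka]) (auto simp: power2_sum)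
  have t2: "t2 = h * (ka - al) / ga\<^sup>2" 
    unfolding t using al ga ka by (simp add: field_simps power2_eq_square)
  have t3: "t3 = h * (ka - ga) / al\<^sup>2" 
    unfolding t using al ga ka by (simp add: field_simps power2_eq_square)
  have 1: "t1 - t3 = d * p"
    unfolding t3 unfolding t d_def p using al ga ka(1) by (simp add: field_simps power2_eq_square)
  have 2: "t4 - t2 = d * q"
    unfolding t2 unfolding t d_def q using al ga ka(1) by (simp add: field_simps power2_eq_square)
  have "(al - (ka - ga)) * ga = (al + (ka - ga)) * (ka - al)"
    using ka(2) by (simp add: algebra_simps power2_eq_square)
  moreover have "(t1 - t3) * t4 = h\<^sup>2 * ((al - (ka - ga)) * ga) / (al\<^sup>2 * ga\<^sup>2)"
    "(t1 + t3) * t2 = h\<^sup>2 * ((al + (ka - ga)) * (ka - al)) / (al\<^sup>2 * ga\<^sup>2)"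
    unfolding t2 t3 unfolding t using al ga by (simp_all add: field_simps power2_eq_square)
  ultimately have 3: "(t1 - t3) * t4 = (t1 + t3) * t2" by simp
  define r where "r = root 3 (2::real)"
  have r: "r ^ 3 = 2" "r > 1" by (auto simp: r_def odd_real_root_pow)
  have r2: "r < 2"
  proof (rule ccontr)
    assume "\<not> r < 2"
    then have "2 ^ 3 \<le> r ^ 3" by (intro power_mono) auto
    then show False using r by simp
  qed
  have pq: "p \<ge> 0" "q \<ge> 0" "p + q = 1" unfolding p q ka(2) using al ga by (auto simp: add_divide_distrib[symmetric])
  have d: "d > 0" unfolding d_def using lt al ga ka(1) h by (intro divide_pos_pos mult_pos_pos) auto
  let ?w = "quad (r * t1) (r * t2) (r * t3) (r * t4) @ [(s1 + s2 + (2 - r) * d, p, q)]"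
  have lp': "lp = quad t1 t2 t3 t4" by (simp add: lp t)
  have "mrun ?w s = mrun (o1 @ L @ o2 @ L') s" for s
    using two_loops_eq[OF 1 2 3 L[unfolded lp'] r(1), of s1 s2 s] by (simp add: o)
  moreover have "ell1 ?w" using pq by (simp add: quad_def)
  ultimately have "dur (o1 @ L @ o2 @ L') \<le> dur ?w"
    using short unfolding shortest_def by blast
  moreover have tp: "t1 > 0" "t2 > 0" "t3 > 0" "t4 > 0" unfolding t using al ga ka h by auto
  have "dur L = t1 + t2 + t3 + t4" "dur L' = t1 + t2 + t3 + t4"
    using L tp unfolding lp' quad_def by auto
  moreover have "dur ?w = r * (t1 + t2 + t3 + t4) + (s1 + s2 + (2 - r) * d)"
  proof -
    have "\<bar>s1 + s2 + (2 - r) * d\<bar> = s1 + s2 + (2 - r) * d" using r2 s d by simp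
    then show ?thesis using r tp by (simp add: quad_def distrib_left)
  qed
  \<comment> \<open>One unit of loop size costs \<open>t1 + t2 + t3 + t4\<close>, whereas its
    displacement costs only \<open>d = t1 - t3 + (t4 - t2)\<close> along the singular direction. The
    saving is thus \<open>2 * (2 - r) * (t2 + t3)\<close>.\<close>
  ultimately have "(2 - r) * (t1 + t2 + t3 + t4) \<le> (2 - r) * d"
    using do by (simp add: algebra_simps)
  then have "t1 + t2 + t3 + t4 \<le> d" using r2 by (simp add: mult_le_cancel_left)
  moreover have "d = t1 - t3 + (t4 - t2)" unfolding 1 2 using pq(3) by (simp flip: distrib_left)
  ultimately show False using tp by linarith
qed

lemma optimal_shortest_word:
  assumes "optimal T q u" "run (in_frame G K w) (q 0) = q T" "dur w = T"
    and G: "\<bar>fst G\<bar> \<le> 1" "\<bar>snd G\<bar> \<le> 1" "\<bar>fst K\<bar> \<le> 1" "\<bar>snd K\<bar> \<le> 1"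
  shows "shortest w"
  unfolding shortest_def
proof (intro allI impI)
  fix w' assume w': "ell1 w'" "\<forall>s. mrun w' s = mrun w s"
  have "T \<le> dur (in_frame G K w')"
  proof (rule optimal_le_dur[OF assms(1)])
    show "run (in_frame G K w') (q 0) = q T"
      using assms(2) by (simp add: run_in_frame w'(2))
    have "\<bar>a * g + b * k\<bar> \<le> 1" if "\<bar>a\<bar> + \<bar>b\<bar> \<le> 1" "\<bar>g\<bar> \<le> 1" "\<bar>k\<bar> \<le> 1" for a b g k :: real
    proof -
      have "\<bar>a * g + b * k\<bar> \<le> \<bar>a\<bar> * \<bar>g\<bar> + \<bar>b\<bar> * \<bar>k\<bar>" by (metis abs_mult abs_triangle_ineq)
      also have "\<dots> \<le> \<bar>a\<bar> * 1 + \<bar>b\<bar> * 1" using that by (intro add_mono mult_left_mono) auto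
      finally show ?thesis using that by simp
    qed
    then show "unit_controls (in_frame G K w')"
      using w'(1) G by (fastforce simp: ell1_def unit_controls_def in_frame_def comb_def)
  qed
  moreover have "dur (in_frame G K w') = dur w'"
    unfolding dur_def in_frame_def by (induction w') auto
  ultimately show "dur w \<le> dur w'" using assms(3) by simp
qed

section \<open>Combinatorics of the arcs\<close>

text \<open>The state at the switching times in the frame \<open>(G, K)\<close>: \<open>(h1, h2) = X G + Y K\<close>, \<open>C = \<plusminus>h3\<close>, and the \<open>i\<close>-th arc has
  duration \<open>d i\<close> and control \<open>c i\<close> in frame coordinates. The quantities \<open>P\<close> and \<open>-Q\<close> are the rates of change of \<open>C\<close> under
  the controls \<open>G\<close> and \<open>K\<close>.\<close>

locale chain =
  fixes n :: nat and P Q h :: real and d X Y C :: "nat \<Rightarrow> real" and c :: "nat \<Rightarrow> real \<times> real"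
    and sing :: "nat \<Rightarrow> bool"
  assumes h: "h > 0" and PQ: "P \<ge> 0" "Q \<ge> 0" "P + Q > 0" and n: "n \<ge> 2"
    and d: "i < n \<Longrightarrow> d i > 0"
    and box: "i \<le> n \<Longrightarrow> \<bar>X i\<bar> \<le> h" "i \<le> n \<Longrightarrow> \<bar>Y i\<bar> \<le> h"
    and vert: "0 < i \<Longrightarrow> i < n \<Longrightarrow> \<bar>X i\<bar> = h \<and> \<bar>Y i\<bar> = h"
    and energy: "i \<le> n \<Longrightarrow> (C i)\<^sup>2 = 2 * (P * (h - Y i) + Q * (h - X i))"
    and sing: "i < n \<Longrightarrow> sing i \<Longrightarrow> C i = 0 \<and> C (Suc i) = 0 \<and> X (Suc i) = X i \<and> Y (Suc i) = Y i
          \<and> \<bar>X i\<bar> = h \<and> \<bar>Y i\<bar> = h \<and> fst (c i) * P = snd (c i) * Q \<and> fst (c i) * X i + snd (c i) * Y i = h"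
    and edge: "i < n \<Longrightarrow> \<not> sing i \<Longrightarrow> c i \<in> {(1, 0), (0, -1), (-1, 0), (0, 1)}
          \<and> fst (c i) * X i + snd (c i) * Y i = h
          \<and> (\<forall>s\<in>{0<..<d i}. \<bar>fst (c i) * Y i - snd (c i) * X i
                - (C i * s + (fst (c i) * P - snd (c i) * Q) * s\<^sup>2 / 2)\<bar> < h)
          \<and> X (Suc i) = X i + snd (c i) * (C i * d i + (fst (c i) * P - snd (c i) * Q) * (d i)\<^sup>2 / 2)
          \<and> Y (Suc i) = Y i - fst (c i) * (C i * d i + (fst (c i) * P - snd (c i) * Q) * (d i)\<^sup>2 / 2)
          \<and> C (Suc i) = C i + (fst (c i) * P - snd (c i) * Q) * d i"
    and sing_not_adjacent: "Suc i < n \<Longrightarrow> sing i \<Longrightarrow> \<not> sing (Suc i)"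
begin

text \<open>Exchanging \<open>G\<close> and \<open>K\<close> reflects the square in its diagonal and
  reverses the sense of rotation, hence the sign of \<open>C\<close>. This reduces negative
  \<open>C\<close> to positive \<open>C\<close>, and \<open>P = 0\<close> to
  \<open>Q = 0\<close>.\<close>

lemma swap: "chain n Q P h d Y X (\<lambda>i. - C i) (\<lambda>i. (snd (c i), fst (c i))) sing"
proof unfold_locales
  fix i assume i: "i < n" "\<not> sing i"
  have "\<bar>snd (c i) * X i - fst (c i) * Y i - (- C i * s + (snd (c i) * Q - fst (c i) * P) * s\<^sup>2 / 2)\<bar>
     = \<bar>fst (c i) * Y i - snd (c i) * X i - (C i * s + (fst (c i) * P - snd (c i) * Q) * s\<^sup>2 / 2)\<bar>" for s
    unfolding abs_eq_iff by (simp add: field_simps)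
  with edge[OF i] show "(snd (c i), fst (c i)) \<in> {(1, 0), (0, -1), (-1, 0), (0, 1)}
      \<and> fst (snd (c i), fst (c i)) * Y i + snd (snd (c i), fst (c i)) * X i = h
      \<and> (\<forall>s\<in>{0<..<d i}. \<bar>fst (snd (c i), fst (c i)) * X i - snd (snd (c i), fst (c i)) * Y i
                - (- C i * s + (fst (snd (c i), fst (c i)) * Q - snd (snd (c i), fst (c i)) * P) * s\<^sup>2 / 2)\<bar> < h)
      \<and> Y (Suc i) = Y i + snd (snd (c i), fst (c i)) *
            (- C i * d i + (fst (snd (c i), fst (c i)) * Q - snd (snd (c i), fst (c i)) * P) * (d i)\<^sup>2 / 2)
      \<and> X (Suc i) = X i - fst (snd (c i), fst (c i)) *
            (- C i * d i + (fst (snd (c i), fst (c i)) * Q - snd (snd (c i), fst (c i)) * P) * (d i)\<^sup>2 / 2)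
      \<and> - C (Suc i) = - C i + (fst (snd (c i), fst (c i)) * Q - snd (snd (c i), fst (c i)) * P) * d i"
    by (auto simp: field_simps)
qed (use h PQ n d box vert energy sing sing_not_adjacent in \<open>auto simp: algebra_simps\<close>)

text \<open>For \<open>Q = 0\<close> the potential depends on \<open>Y\<close> alone, so the motion
  is symmetric in the axis \<open>X = 0\<close>; the sense of rotation is reversed.\<close>

lemma reflect:
  assumes "Q = 0"
  shows "chain n P 0 h d (\<lambda>i. - X i) Y (\<lambda>i. - C i) (\<lambda>i. (- fst (c i), snd (c i))) sing"
proof unfold_locales
  fix i assume i: "i < n" "\<not> sing i"
  have "\<bar>- fst (c i) * Y i + snd (c i) * X i - (- C i * s - fst (c i) * P * s\<^sup>2 / 2)\<bar>
     = \<bar>fst (c i) * Y i - snd (c i) * X i - (C i * s + fst (c i) * P * s\<^sup>2 / 2)\<bar>" for s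
    unfolding abs_eq_iff by (simp add: field_simps)
  with edge[OF i] show "(- fst (c i), snd (c i)) \<in> {(1, 0), (0, -1), (-1, 0), (0, 1)}
      \<and> fst (- fst (c i), snd (c i)) * - X i + snd (- fst (c i), snd (c i)) * Y i = h
      \<and> (\<forall>s\<in>{0<..<d i}. \<bar>fst (- fst (c i), snd (c i)) * Y i - snd (- fst (c i), snd (c i)) * - X i
                - (- C i * s + (fst (- fst (c i), snd (c i)) * P - snd (- fst (c i), snd (c i)) * 0) * s\<^sup>2 / 2)\<bar> < h)
      \<and> - X (Suc i) = - X i + snd (- fst (c i), snd (c i)) *
            (- C i * d i + (fst (- fst (c i), snd (c i)) * P - snd (- fst (c i), snd (c i)) * 0) * (d i)\<^sup>2 / 2)
      \<and> Y (Suc i) = Y i - fst (- fst (c i), snd (c i)) *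
            (- C i * d i + (fst (- fst (c i), snd (c i)) * P - snd (- fst (c i), snd (c i)) * 0) * (d i)\<^sup>2 / 2)
      \<and> - C (Suc i) = - C i + (fst (- fst (c i), snd (c i)) * P - snd (- fst (c i), snd (c i)) * 0) * d i"
    using assms by (auto simp: field_simps)
next
  fix i assume "i < n" "sing i"
  from sing[OF this] show "- C i = 0 \<and> - C (Suc i) = 0 \<and> - X (Suc i) = - X i \<and> Y (Suc i) = Y i
          \<and> \<bar>- X i\<bar> = h \<and> \<bar>Y i\<bar> = h
          \<and> fst (- fst (c i), snd (c i)) * P = snd (- fst (c i), snd (c i)) * 0
          \<and> fst (- fst (c i), snd (c i)) * - X i + snd (- fst (c i), snd (c i)) * Y i = h"
    using assms by simp
qed (use h PQ n d box vert energy sing_not_adjacent assms in \<open>auto simp: algebra_simps\<close>)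

text \<open>By \<open>energy\<close> the speed cannot vanish inside an arc, so the motion never turns back within an edge.\<close>

lemma step:
  assumes i: "\<not> sing i" and v: "\<bar>X i\<bar> = h" "\<bar>Y i\<bar> = h" and v': "Suc i < n"
    and C: "C i > 0 \<or> C i = 0 \<and> fst (c i) * Y i - snd (c i) * X i = h"
  shows "c i = ((X i + Y i) / (2 * h), (Y i - X i) / (2 * h))"
    "X (Suc i) = Y i" "Y (Suc i) = - X i"
    "C (Suc i) \<ge> 0" "C i + C (Suc i) > 0" "d i = 4 * h / (C i + C (Suc i))"
proof -
  obtain a b where c: "c i = (a, b)" by (metis surj_pair)
  \<comment> \<open>\<open>F\<close> is the force, \<open>Z\<close> the position on the side at the
    start, counted downwards from \<open>h\<close> to \<open>- h\<close>, and
    \<open>\<phi> s\<close> the distance covered up to time \<open>s\<close>.\<close>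
  define F where "F = a * P - b * Q"
  define Z where "Z = a * Y i - b * X i"
  define \<phi> where "\<phi> = (\<lambda>s. C i * s + F * s\<^sup>2 / 2)"
  have "i < n" using v' by simp
  note e = edge[OF this i, unfolded c fst_conv snd_conv, folded F_def, folded Z_def]
  have ab: "(a, b) \<in> {(1, 0), (0, -1), (-1, 0), (0, 1)}" and ax: "a * X i + b * Y i = h"
    and Zs: "\<And>s. 0 < s \<Longrightarrow> s < d i \<Longrightarrow> \<bar>Z - \<phi> s\<bar> < h"
    and X': "X (Suc i) = X i + b * \<phi> (d i)" and Y': "Y (Suc i) = Y i - a * \<phi> (d i)"
    and C': "C (Suc i) = C i + F * d i"
    using e by (auto simp: \<phi>_def)
  have di: "d i > 0" using d \<open>i < n\<close> .
  have C0: "C i \<ge> 0" using C by auto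
  have absZ: "\<bar>Z\<bar> = h" using ab v by (auto simp: Z_def)
  \<comment> \<open>At the far end \<open>- h\<close>, a positive speed would lead off the side at
    once.\<close>
  have Z: "Z = h"
  proof (rule ccontr)
    assume "Z \<noteq> h"
    then have Zh: "Z = - h" and Ci: "C i > 0" using absZ C c by (auto simp: Z_def)
    define s where "s = min (d i / 2) (C i / (\<bar>F\<bar> + 1))"
    have s: "0 < s" "s < d i" using di Ci by (auto simp: s_def)
    have "s * \<bar>F\<bar> \<le> s * (\<bar>F\<bar> + 1)" using s by simp
    also have "s \<le> C i / (\<bar>F\<bar> + 1)" by (simp add: s_def)
    then have "s * (\<bar>F\<bar> + 1) \<le> C i" by (subst (asm) pos_le_divide_eq) auto
    finally have "s * \<bar>F\<bar> \<le> C i" .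
    moreover have "s * (- F) \<le> s * \<bar>F\<bar>" using s by (intro mult_left_mono) auto
    ultimately have "C i + F * s / 2 > 0" using Ci by (simp add: mult.commute)
    then have "\<phi> s > 0" using s unfolding \<phi>_def
      by (metis (no_types, lifting) distrib_left mult.commute mult.left_commute mult_pos_pos power2_eq_square times_divide_eq_right)
    then show False using Zs[OF s] Zh by linarith
  qed
  have sq: "(C i + F * s)\<^sup>2 = (C i)\<^sup>2 + 2 * F * \<phi> s" for s
    by (simp add: \<phi>_def power2_eq_square field_simps)
  have en: "(C i)\<^sup>2 = 2 * (P * (h - Y i) + Q * (h - X i))" using energy \<open>i < n\<close> by simp
  have nz: "C i + F * s \<noteq> 0" if s: "0 < s" "s < d i" for s
  proof
    assume "C i + F * s = 0"
    then have "2 * (P * (h - Y i) + Q * (h - X i)) + 2 * F * \<phi> s = 0"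
      using sq[of s] en by simp
    then have 0: "P * (h - (Y i - a * \<phi> s)) + Q * (h - (X i + b * \<phi> s)) = 0"
      unfolding F_def by (simp add: algebra_simps)
    have posP: False if "x > 0" "P * x + Q * (2 * h) = 0" for x
      using that h PQ mult_nonneg_nonneg[of P x] mult_nonneg_nonneg[of Q "2 * h"]
      by (smt (verit) mult_pos_pos)
    have posQ: False if "x > 0" "P * (2 * h) + Q * x = 0" for x
      using that h PQ mult_nonneg_nonneg[of P "2 * h"] mult_nonneg_nonneg[of Q x]
      by (smt (verit) mult_pos_pos)
    \<comment> \<open>The arc has left the vertex at time \<open>s\<close>, so it cannot have both
      speed and force zero. This excludes sides made of equilibria, where the energy alone would
      allow the speed to vanish.\<close>
    have still: "F \<noteq> 0 \<or> C i \<noteq> 0"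
      using Zs[OF s] Z by (auto simp: \<phi>_def)
    from ab consider "a = 1" "b = 0" | "a = 0" "b = -1" | "a = -1" "b = 0" | "a = 0" "b = 1" by auto
    then show False
    proof cases
      case 1
      then show ?thesis using 0 ax Zs[OF s] still en by (auto simp: Z_def F_def)
    next
      case 2
      then have "Y i = - h" "X i = Z" "\<bar>X i - \<phi> s\<bar> < h" using ax Zs[OF s] by (auto simp: Z_def)
      then have "P * (2 * h) + Q * (h - (X i - \<phi> s)) = 0" "h - (X i - \<phi> s) > 0"
        using 0 2 by (auto simp: algebra_simps)
      then show ?thesis using posQ by blast
    next
      case 3
      then have "X i = - h" "Y i = - Z" "\<bar>Y i + \<phi> s\<bar> < h" using ax Zs[OF s] by (auto simp: Z_def)
      then have "P * (h - (Y i + \<phi> s)) + Q * (2 * h) = 0" "h - (Y i + \<phi> s) > 0"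
        using 0 3 by (auto simp: algebra_simps)
      then show ?thesis using posP by blast
    next
      case 4
      then show ?thesis using 0 ax Zs[OF s] still en by (auto simp: Z_def F_def)
    qed
  qed
  have "a * a + b * b = 1" using ab by auto
  then have Z': "a * Y (Suc i) - b * X (Suc i) = Z - \<phi> (d i)"
    unfolding X' Y' Z_def by (simp add: algebra_simps) (simp add: distrib_right[symmetric] mult.assoc[symmetric])
  have "\<bar>a * Y (Suc i) - b * X (Suc i)\<bar> = h" using ab vert[of "Suc i"] v' by auto
  then have "\<phi> (d i) = 0 \<or> \<phi> (d i) = 2 * h" using Z' Z by auto
  moreover have "\<phi> (d i) \<noteq> 0"
  proof
    assume "\<phi> (d i) = 0"
    then have "d i * (C i + F * (d i / 2)) = 0" by (simp add: \<phi>_def power2_eq_square algebra_simps)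
    then show False using nz[of "d i / 2"] di by simp
  qed
  \<comment> \<open>The whole side is covered. Under constant force the mean speed is the mean of
    the end speeds, which yields the duration.\<close>
  ultimately have \<phi>: "\<phi> (d i) = 2 * h" by simp
  then have sum: "(C i + C (Suc i)) * d i = 4 * h"
    unfolding C' by (simp add: \<phi>_def power2_eq_square algebra_simps)
  then show CC: "C i + C (Suc i) > 0" using h di by (metis mult_pos_pos zero_less_mult_pos2 zero_less_numeral)
  from sum show "d i = 4 * h / (C i + C (Suc i))" using CC by (simp add: field_simps)
  show "C (Suc i) \<ge> 0"
  proof (rule ccontr)
    assume neg: "\<not> C (Suc i) \<ge> 0"
    then have "C i > 0" using CC by simp
    define s where "s = C i * d i / (C i - C (Suc i))"
    have "0 < s" "s < d i" using \<open>C i > 0\<close> neg di mult_pos_neg[OF di, of "C (Suc i)"]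
      by (auto simp: s_def field_simps)
    moreover have "C i + F * s = 0"
      using neg \<open>C i > 0\<close> di unfolding s_def C' by (auto simp: field_simps)
    ultimately show False using nz by blast
  qed
  show "c i = ((X i + Y i) / (2 * h), (Y i - X i) / (2 * h))"
    using ab ax Z h by (auto simp: c Z_def)
  show "X (Suc i) = Y i" "Y (Suc i) = - X i"
    unfolding X' Y' \<phi> using ab ax Z by (auto simp: Z_def)
qed

abbreviation seg :: "nat \<Rightarrow> nat \<Rightarrow> arc list" where
  "seg i j \<equiv> map (\<lambda>k. (d k, c k)) [i..<j]"

lemma seg_split: "i \<le> j \<Longrightarrow> j \<le> k \<Longrightarrow> seg i k = seg i j @ seg j k"
  using upt_add_eq_append[of i j "k - j"] by simp

lemma shortest_seg:
  assumes "shortest (seg 0 n)" "ell1 (seg 0 n)" "i \<le> j" "j \<le> n" shows "shortest (seg i j)"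
proof -
  have "seg 0 n = seg 0 i @ seg i j @ seg j n"
    using seg_split[of 0 i n] seg_split[of i j n] assms by simp
  with assms(1,2) show ?thesis using shortest_infix[of "seg 0 i" "seg i j" "seg j n"] by simp
qed

lemma sqrt_unique: "x \<ge> 0 \<Longrightarrow> x\<^sup>2 = y \<Longrightarrow> x = sqrt y" for x y :: real
  by (simp add: real_sqrt_unique)

text \<open>The vertices of the square are passed in the order
  \<open>(h, h)\<close>, \<open>(h, -h)\<close>, \<open>(-h, -h)\<close>, \<open>(-h, h)\<close> when \<open>C\<close> is positive.\<close>

lemma run_positive:
  assumes "0 < i" "Suc i < n" "C i > 0"
  shows "\<not> sing i" "X (Suc i) = Y i" "Y (Suc i) = - X i" "C (Suc i) \<ge> 0"
    "c i = ((X i + Y i) / (2 * h), (Y i - X i) / (2 * h))" "d i = 4 * h / (C i + C (Suc i))"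
proof -
  show ns: "\<not> sing i" using sing[of i] assms by auto
  show "X (Suc i) = Y i" "Y (Suc i) = - X i" "C (Suc i) \<ge> 0"
    "c i = ((X i + Y i) / (2 * h), (Y i - X i) / (2 * h))" "d i = 4 * h / (C i + C (Suc i))"
    using step[OF ns] vert[of i] assms by auto
qed

section \<open>Isolated equilibrium: \<open>P\<close> and \<open>Q\<close> positive\<close>

lemma generic_zero:
  assumes "P > 0" "Q > 0" "i \<le> n" "C i = 0" shows "X i = h" "Y i = h"
proof -
  have "P * (h - Y i) + Q * (h - X i) = 0" "h - Y i \<ge> 0" "h - X i \<ge> 0"
    using energy[OF assms(3)] box[OF assms(3)] assms(4) by auto
  moreover have "P * (h - Y i) \<ge> 0" "Q * (h - X i) \<ge> 0" using calculation assms(1,2) by auto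
  ultimately have "P * (h - Y i) = 0" "Q * (h - X i) = 0" by linarith+
  then show "X i = h" "Y i = h" using assms(1,2) by auto
qed

text \<open>While \<open>C\<close> stays positive, four consecutive nodes run through all four
  vertices. One of them is \<open>(h, h)\<close>, where the energy relation makes \<open>C\<close>
  vanish.\<close>

lemma generic_hit:
  assumes "P > 0" "Q > 0" "0 < i" "i + 3 < n" "C i > 0"
  shows "\<exists>k\<in>{i + 1..i + 3}. C k = 0"
proof (rule ccontr)
  assume "\<not> ?thesis"
  then have nz: "C (Suc i) \<noteq> 0" "C (Suc (Suc i)) \<noteq> 0" "C (Suc (Suc (Suc i))) \<noteq> 0" by auto
  note r0 = run_positive[of i] and r1 = run_positive[of "Suc i"] and r2 = run_positive[of "Suc (Suc i)"]
  have 1: "X (Suc i) = Y i" "Y (Suc i) = - X i" "C (Suc i) > 0" using r0 assms nz by auto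
  have 2: "X (Suc (Suc i)) = Y (Suc i)" "Y (Suc (Suc i)) = - X (Suc i)" "C (Suc (Suc i)) > 0"
    using r1 assms nz 1 by auto
  have 3: "X (Suc (Suc (Suc i))) = Y (Suc (Suc i))" "Y (Suc (Suc (Suc i))) = - X (Suc (Suc i))"
    using r2 assms nz 2 by auto
  have zero: "C k = 0" if "X k = h" "Y k = h" "k \<le> n" for k
    using energy[of k] that by simp
  have 4: "X (Suc (Suc i)) = - X i" "Y (Suc (Suc i)) = - Y i"
    "X (Suc (Suc (Suc i))) = - Y i" "Y (Suc (Suc (Suc i))) = X i"
    using 1(1,2) 2(1,2) 3 by auto
  have "\<bar>X i\<bar> = h" "\<bar>Y i\<bar> = h" using vert[of i] assms by auto
  then consider "X i = h" "Y i = h" | "X i = h" "Y i = - h" | "X i = - h" "Y i = - h" | "X i = - h" "Y i = h"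
    by linarith
  then show False
  proof cases
    case 1 then show ?thesis using zero[of i] assms by simp
  next
    case 2 then show ?thesis using zero[of "Suc (Suc (Suc i))"] 4 nz(3) assms by simp
  next
    case 3 then show ?thesis using zero[of "Suc (Suc i)"] 4 nz(2) assms by simp
  next
    case 4 then show ?thesis using zero[of "Suc i"] 1(1,2) nz(1) assms by simp
  qed
qed

text \<open>By the energy relation the squared speeds at the vertices after \<open>(h, h)\<close>
  are \<open>4 * h * P\<close>, \<open>4 * h * (P + Q)\<close> and \<open>4 * h * Q\<close>; each
  duration is \<open>4 * h\<close> over the sum of the two end speeds.\<close>

definition loop :: "arc list" where
  "loop = quad (4 * h / sqrt (4 * h * P)) (4 * h / (sqrt (4 * h * P) + sqrt (4 * h * (P + Q))))
     (4 * h / (sqrt (4 * h * (P + Q)) + sqrt (4 * h * Q))) (4 * h / sqrt (4 * h * Q))"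

lemma generic_loop_first:
  assumes "P > 0" "Q > 0" "i + 4 < n" "\<not> sing i" "C i = 0" "c i = (1, 0)"
  shows "seg i (i + 4) = loop \<and> C (i + 4) = 0"
proof -
  have 0: "X i = h" "Y i = h" using generic_zero assms by auto
  have s0: "X (Suc i) = h" "Y (Suc i) = - h" "C (Suc i) > 0" "d i = 4 * h / C (Suc i)"
    using step[OF assms(4)] assms 0 h by auto
  have s1: "X (i + 2) = - h" "Y (i + 2) = - h" "C (i + 2) \<ge> 0" "c (Suc i) = (0, -1)"
    "d (Suc i) = 4 * h / (C (Suc i) + C (i + 2))"
    using run_positive[of "Suc i"] s0 assms h by auto
  have e: "(C (Suc i))\<^sup>2 = 4 * h * P" "(C (i + 2))\<^sup>2 = 4 * h * (P + Q)"
    using energy[of "Suc i"] energy[of "i + 2"] s0 s1 assms by (auto simp: algebra_simps)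
  then have p2: "C (i + 2) > 0" using s1(3) h PQ by (cases "C (i + 2) = 0") auto
  have s2: "X (i + 3) = - h" "Y (i + 3) = h" "C (i + 3) \<ge> 0" "c (i + 2) = (-1, 0)"
    "d (i + 2) = 4 * h / (C (i + 2) + C (i + 3))"
    using run_positive[of "i + 2"] s1 assms h p2 by (auto simp: eval_nat_numeral)
  have e3: "(C (i + 3))\<^sup>2 = 4 * h * Q"
    using energy[of "i + 3"] s2 assms by (auto simp: algebra_simps)
  then have p3: "C (i + 3) > 0" using s2(3) h assms by (cases "C (i + 3) = 0") auto
  have s3: "X (i + 4) = h" "Y (i + 4) = h" "c (i + 3) = (0, 1)"
    "d (i + 3) = 4 * h / (C (i + 3) + C (i + 4))"
    using run_positive[of "i + 3"] s2 assms h p3 by (auto simp: eval_nat_numeral)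
  have e4: "C (i + 4) = 0" using energy[of "i + 4"] s3 assms by auto
  have "C (Suc i) = sqrt (4 * h * P)" "C (i + 2) = sqrt (4 * h * (P + Q))" "C (i + 3) = sqrt (4 * h * Q)"
    using sqrt_unique[OF less_imp_le[OF s0(3)] e(1)] sqrt_unique[OF s1(3) e(2)] sqrt_unique[OF s2(3) e3] by auto
  moreover have "[i..<i + 4] = [i, Suc i, i + 2, i + 3]" by (simp add: upt_rec)
  ultimately show ?thesis
    using s0 s1 s2 s3 e4 assms(6) by (simp add: loop_def quad_def)
qed

end

text \<open>The equilibrium can be left along \<open>G\<close> or along \<open>K\<close>. Exchanging
  the frame vectors turns the second departure into the first and reverses the loop.\<close>

lemma (in chain) generic_loop:
  assumes PQ0: "P > 0" "Q > 0" and i: "i + 4 < n" "\<not> sing i" "C i = 0"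
  shows "seg i (i + 4) \<in> {loop, rev loop} \<and> C (i + 4) = 0"
proof -
  interpret sw: chain n Q P h d Y X "\<lambda>i. - C i" "\<lambda>i. (snd (c i), fst (c i))" sing by (rule swap)
  have "X i = h" "Y i = h" using generic_zero assms by auto
  then have "c i = (1, 0) \<or> c i = (0, 1)" using edge[of i] i h by auto
  then show ?thesis
  proof
    assume "c i = (1, 0)" then show ?thesis using generic_loop_first assms by simp
  next
    assume c: "c i = (0, 1)"
    have "sw.seg i (i + 4) = sw.loop \<and> C (i + 4) = 0"
      using sw.generic_loop_first[of i] assms c by simp
    moreover have "seg i (i + 4) = map (\<lambda>(t, a, b). (t, b, a)) (sw.seg i (i + 4))" by simp
    moreover have "map (\<lambda>(t, a, b). (t, b, a)) sw.loop = rev loop"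
      by (simp add: sw.loop_def loop_def quad_def add.commute)
    ultimately show ?thesis by simp
  qed
qed

text \<open>A block is an optional singular arc and a full loop; singular arcs are never adjacent,
  so rest recurs after at most 5 arcs. The singular control is the point of the segment from
  \<open>G\<close> to \<open>K\<close> on which the force vanishes.\<close>

lemma (in chain) generic_block:
  assumes PQ0: "P > 0" "Q > 0" and i: "i + 5 < n" "C i = 0"
  obtains o' s L k where "i < k" "k \<le> i + 5" "C k = 0" "seg i k = o' @ L" "L \<in> {loop, rev loop}"
    "\<And>x. mrun o' x = mflow (s, Q / (P + Q), P / (P + Q)) x" "dur o' = s" "s \<ge> 0"
proof (cases "sing i")
  case True
  have XY: "X i = h" "Y i = h" using generic_zero assms by auto
  have "fst (c i) * P = snd (c i) * Q" "fst (c i) + snd (c i) = 1" "C (Suc i) = 0"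
    using sing[OF _ True] i XY h by (auto simp flip: distrib_right)
  then have "fst (c i) * (P + Q) = Q" "snd (c i) * (P + Q) = P"
    by (metis add.commute distrib_left distrib_right mult.commute mult.left_neutral)+
  then have c: "c i = (Q / (P + Q), P / (P + Q))" using PQ(3) by (simp add: prod_eq_iff field_simps)
  have "seg (Suc i) (Suc i + 4) \<in> {loop, rev loop} \<and> C (Suc i + 4) = 0"
    using generic_loop[OF PQ0, of "Suc i"] sing_not_adjacent[OF _ True] i \<open>C (Suc i) = 0\<close> by simp
  moreover have "seg i (i + 5) = [(d i, c i)] @ seg (Suc i) (Suc i + 4)"
    by (simp add: upt_conv_Cons)
  ultimately show ?thesis
    using that[of "i + 5" "[(d i, c i)]" "seg (Suc i) (Suc i + 4)" "d i"] d[of i] i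
    by (simp add: c add.commute[of _ 5] del: upt_Suc)
next
  case False
  have "seg i (i + 4) \<in> {loop, rev loop} \<and> C (i + 4) = 0"
    using generic_loop[OF PQ0 _ False i(2)] i by simp
  then show ?thesis
    by (intro that[of "i + 4" "[]" "seg i (i + 4)" 0]) (simp_all del: upt_Suc)
qed

text \<open>The first zero of \<open>C\<close> is among the nodes up to 4: node 1 is the first sure
  vertex, and three further sides suffice. Two blocks then end at node 14 at the latest, which must
  be interior for the second loop to be known complete.\<close>

lemma (in chain) generic_bound:
  assumes PQ0: "P > 0" "Q > 0" and "shortest (seg 0 n)" "ell1 (seg 0 n)"
  shows "n \<le> 14"
proof (rule ccontr)
  assume "\<not> n \<le> 14"
  then have n15: "n \<ge> 15" by simp
  have "\<exists>j\<le>4. C j = 0"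
  proof -
    interpret sw: chain n Q P h d Y X "\<lambda>i. - C i" "\<lambda>i. (snd (c i), fst (c i))" sing by (rule swap)
    consider "C 1 = 0" | "C 1 > 0" | "C 1 < 0" by linarith
    then show ?thesis
    proof cases
      case 2
      then show ?thesis using generic_hit[OF PQ0, of 1] n15 by force
    next
      case 3
      then show ?thesis using sw.generic_hit[OF PQ0(2,1), of 1] n15 by force
    next
      case 1
      then show ?thesis by (intro exI[of _ 1]) auto
    qed
  qed
  then obtain j where j: "j \<le> 4" "C j = 0" by blast
  obtain o1 s1 L1 k where 1: "j < k" "k \<le> j + 5" "C k = 0" "seg j k = o1 @ L1" "L1 \<in> {loop, rev loop}"
    "\<And>x. mrun o1 x = mflow (s1, Q / (P + Q), P / (P + Q)) x" "dur o1 = s1" "s1 \<ge> 0"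
    by (rule generic_block[OF PQ0, of j]) (use j n15 in auto)
  obtain o2 s2 L2 l where 2: "k < l" "l \<le> k + 5" "C l = 0" "seg k l = o2 @ L2" "L2 \<in> {loop, rev loop}"
    "\<And>x. mrun o2 x = mflow (s2, Q / (P + Q), P / (P + Q)) x" "dur o2 = s2" "s2 \<ge> 0"
    by (rule generic_block[OF PQ0, of k]) (use j 1 n15 in auto)
  have "shortest (seg j l)" by (rule shortest_seg[OF assms(3,4)]) (use 1 2 j n15 in auto)
  moreover have "seg j l = o1 @ L1 @ o2 @ L2" using seg_split[of j k l] 1 2 by simp
  moreover have "\<not> shortest (o1 @ L1 @ o2 @ L2)"
  proof (rule two_loops_not_shortest[where ?s1.0 = s1 and ?s2.0 = s2])
    show "sqrt (4 * h * P) > 0" "sqrt (4 * h * Q) > 0" "sqrt (4 * h * (P + Q)) > 0" "4 * h > 0"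
      using h PQ0 by auto
    show "(sqrt (4 * h * (P + Q)))\<^sup>2 = (sqrt (4 * h * P))\<^sup>2 + (sqrt (4 * h * Q))\<^sup>2"
      using h PQ0 by (simp add: distrib_left)
    show "Q / (P + Q) = (sqrt (4 * h * Q))\<^sup>2 / (sqrt (4 * h * (P + Q)))\<^sup>2"
      "P / (P + Q) = (sqrt (4 * h * P))\<^sup>2 / (sqrt (4 * h * (P + Q)))\<^sup>2"
      using h PQ0 by simp_all
  qed (use 1(5-8) 2(5-8) in \<open>simp_all only: loop_def\<close>)
  ultimately show False by simp
qed

section \<open>Flat case: a whole side of equilibria\<close>

context chain begin

text \<open>When \<open>Q = 0\<close> the equilibria fill the edge \<open>Y = h\<close>, and the loops join its two ends alternately.\<close>

definition side :: real where "side = 2 * h / sqrt (4 * h * P)"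

lemma flat_zero_iff:
  assumes "Q = 0" "i \<le> n" shows "C i = 0 \<longleftrightarrow> Y i = h"
  using energy[OF assms(2)] assms(1) PQ by auto

text \<open>No bang arc runs along the side \<open>Y = h\<close>: speed and force vanish there, so
  it would stay strictly inside that side, although one of its ends is an interior node and hence a
  vertex. This is where \<open>n\<close> at least 2 enters.\<close>

lemma flat_direction:
  assumes "Q = 0" "i < n" "C i = 0"
  shows "\<bar>X i\<bar> = h" "\<bar>Y i\<bar> = h" "\<not> sing i \<Longrightarrow> c i = (X i / h, 0)"
proof -
  have Y: "Y i = h" using flat_zero_iff assms by simp
  have *: "c i = (X i / h, 0) \<and> \<bar>X i\<bar> = h" if ns: "\<not> sing i"
  proof -
    note e = edge[OF assms(2) ns]
    then consider "c i = (1, 0)" | "c i = (0, -1)" | "c i = (-1, 0)" | "c i = (0, 1)" by auto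
    then show ?thesis
    proof cases
      case 4
      have "d i / 2 \<in> {0<..<d i}" using d[OF assms(2)] by simp
      then have "\<bar>fst (c i) * Y i - snd (c i) * X i
          - (C i * (d i / 2) + (fst (c i) * P - snd (c i) * Q) * (d i / 2)\<^sup>2 / 2)\<bar> < h"
        using e by blast
      then have "\<bar>X i\<bar> < h" using 4 assms by simp
      moreover have "X (Suc i) = X i" using e 4 assms by auto
      ultimately show ?thesis using vert[of i] vert[of "Suc i"] assms(2) n by (cases "i = 0") auto
    qed (use e Y h in \<open>auto simp: field_simps\<close>)
  qed
  show "\<bar>X i\<bar> = h" "\<bar>Y i\<bar> = h" using * sing[OF assms(2)] Y h by (cases "sing i"; auto)+
  show "\<not> sing i \<Longrightarrow> c i = (X i / h, 0)" using * by simp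
qed

lemma flat_corners:
  assumes "Q = 0" "i \<le> n" "C i \<ge> 0"
  shows "Y i = - h \<Longrightarrow> C i = sqrt (4 * h * P)" "Y i = h \<Longrightarrow> C i = 0"
  using energy[OF assms(2)] sqrt_unique[OF assms(3), of "4 * h * P"] assms(1) by (auto simp: algebra_simps)

lemma side_eq: "e = 4 * h / (0 + sqrt (4 * h * P)) \<Longrightarrow> e = 2 * side"
  "e = 4 * h / (sqrt (4 * h * P) + 0) \<Longrightarrow> e = 2 * side"
  "e = 4 * h / (sqrt (4 * h * P) + sqrt (4 * h * P)) \<Longrightarrow> e = side"
  by (simp_all add: side_def)

text \<open>The three sides are asserted under separate bounds because the final loop may be cut off
  by the end of the chain.\<close>

lemma flat_hook_right:
  assumes Q: "Q = 0" and i: "i < n" "\<not> sing i" "C i = 0" "X i = h"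
  shows "Suc i < n \<Longrightarrow> C (Suc i) > 0 \<and> X (Suc i) = h \<and> c i = (1, 0) \<and> d i = 2 * side"
    and "i + 2 < n \<Longrightarrow> C (i + 2) > 0 \<and> c (Suc i) = (0, -1) \<and> d (Suc i) = side"
    and "i + 3 < n \<Longrightarrow> C (i + 3) = 0 \<and> X (i + 3) = - h \<and> c (i + 2) = (-1, 0) \<and> d (i + 2) = 2 * side"
proof -
  have P: "P > 0" using PQ Q by simp
  then have al: "sqrt (4 * h * P) > 0" using h by simp
  have Y: "Y i = h" and c: "c i = (1, 0)"
    using flat_zero_iff[OF Q] flat_direction[OF Q i(1,3)] i h by auto
  have 1: "X (Suc i) = h" "Y (Suc i) = - h" "C (Suc i) = sqrt (4 * h * P)" "d i = 2 * side" if "Suc i < n"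
  proof -
    have s: "X (Suc i) = h" "Y (Suc i) = - h" "C (Suc i) \<ge> 0" "d i = 4 * h / (C i + C (Suc i))"
      using step[OF i(2)] that i h c Y by auto
    then show "X (Suc i) = h" "Y (Suc i) = - h" by auto
    show C1: "C (Suc i) = sqrt (4 * h * P)" using flat_corners(1)[OF Q] s that by simp
    show "d i = 2 * side" using s(4) side_eq(1) i C1 by metis
  qed
  then show "Suc i < n \<Longrightarrow> C (Suc i) > 0 \<and> X (Suc i) = h \<and> c i = (1, 0) \<and> d i = 2 * side"
    using al c by simp
  have 2: "X (i + 2) = - h" "Y (i + 2) = - h" "C (i + 2) = sqrt (4 * h * P)" "c (Suc i) = (0, -1)"
    "d (Suc i) = side" if "i + 2 < n"
  proof -
    have "Suc i < n" using that by simp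
    note 1 = 1[OF this]
    have s: "X (i + 2) = - h" "Y (i + 2) = - h" "C (i + 2) \<ge> 0" "c (Suc i) = (0, -1)"
      "d (Suc i) = 4 * h / (C (Suc i) + C (i + 2))"
      using run_positive[of "Suc i"] that 1 h al by auto
    then show "X (i + 2) = - h" "Y (i + 2) = - h" "c (Suc i) = (0, -1)" by auto
    show C2: "C (i + 2) = sqrt (4 * h * P)" using flat_corners(1)[OF Q] s that by simp
    show "d (Suc i) = side" using s(5) side_eq(3) 1(3) C2 by metis
  qed
  then show "i + 2 < n \<Longrightarrow> C (i + 2) > 0 \<and> c (Suc i) = (0, -1) \<and> d (Suc i) = side"
    using al by simp
  show "C (i + 3) = 0 \<and> X (i + 3) = - h \<and> c (i + 2) = (-1, 0) \<and> d (i + 2) = 2 * side" if "i + 3 < n"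
  proof -
    have "i + 2 < n" using that by simp
    note 2 = 2[OF this]
    have s: "X (i + 3) = - h" "Y (i + 3) = h" "C (i + 3) \<ge> 0" "c (i + 2) = (-1, 0)"
      "d (i + 2) = 4 * h / (C (i + 2) + C (i + 3))"
      using run_positive[of "i + 2"] that 2 h al by (auto simp: eval_nat_numeral)
    have C3: "C (i + 3) = 0" using flat_corners(2)[OF Q] s that by simp
    moreover have "d (i + 2) = 2 * side" using s(5) side_eq(2) 2(3) C3 by metis
    ultimately show ?thesis using s by simp
  qed
qed

end

lemma (in chain) flat_hook:
  assumes Q: "Q = 0" and i: "i < n" "\<not> sing i" "C i = 0"
  shows "Suc i < n \<Longrightarrow> C (Suc i) \<noteq> 0 \<and> c i = (X i / h, 0) \<and> d i = 2 * side"
    and "i + 2 < n \<Longrightarrow> C (i + 2) \<noteq> 0 \<and> c (Suc i) = (0, -1) \<and> d (Suc i) = side"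
    and "i + 3 < n \<Longrightarrow> C (i + 3) = 0 \<and> X (i + 3) = - X i \<and> c (i + 2) = (- X i / h, 0) \<and> d (i + 2) = 2 * side"
proof -
  interpret re: chain n P 0 h d "\<lambda>i. - X i" Y "\<lambda>i. - C i" "\<lambda>i. (- fst (c i), snd (c i))" sing
    by (rule reflect[OF Q])
  have "X i = h \<or> X i = - h" using flat_direction[OF Q i(1,3)] by auto
  then show "Suc i < n \<Longrightarrow> C (Suc i) \<noteq> 0 \<and> c i = (X i / h, 0) \<and> d i = 2 * side"
    and "i + 2 < n \<Longrightarrow> C (i + 2) \<noteq> 0 \<and> c (Suc i) = (0, -1) \<and> d (Suc i) = side"
    and "i + 3 < n \<Longrightarrow> C (i + 3) = 0 \<and> X (i + 3) = - X i \<and> c (i + 2) = (- X i / h, 0) \<and> d (i + 2) = 2 * side"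
    using flat_hook_right[OF Q i] re.flat_hook_right[of i] i h by (auto simp: prod_eq_iff re.side_def side_def)
qed

text \<open>Nonzero speed at nodes 1 and 2 puts both on the side \<open>Y = - h\<close>, so the arcs
  after node 1 are the last two sides of a hook.\<close>

lemma (in chain) flat_start_right:
  assumes Q: "Q = 0" and n: "3 < n" and C: "C 1 > 0" "C 2 \<noteq> 0"
  shows "C 3 = 0 \<and> X 3 = - h \<and> seg 1 3 = [(side, 0, -1), (2 * side, -1, 0)]"
proof -
  have Y1: "Y 1 = - h" using flat_zero_iff[OF Q, of 1] vert[of 1] C n by auto
  have "\<bar>X 1\<bar> = h" using vert[of 1] n by auto
  have r: "X 2 = Y 1" "Y 2 = - X 1" "C 2 \<ge> 0" "c 1 = ((X 1 + Y 1) / (2 * h), (Y 1 - X 1) / (2 * h))"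
    "d 1 = 4 * h / (C 1 + C 2)"
    using run_positive[of 1] C n by (auto simp: numeral_2_eq_2)
  have "Y 2 \<noteq> h" using flat_zero_iff[OF Q, of 2] C n by auto
  then have X1: "X 1 = h" using r \<open>\<bar>X 1\<bar> = h\<close> by auto
  have "C 2 > 0" using r C by auto
  then have s: "X 3 = Y 2" "Y 3 = - X 2" "C 3 \<ge> 0" "c 2 = ((X 2 + Y 2) / (2 * h), (Y 2 - X 2) / (2 * h))"
    "d 2 = 4 * h / (C 2 + C 3)"
    using run_positive[of 2] n by (auto simp: numeral_3_eq_3)
  have "C 1 = sqrt (4 * h * P)" "C 2 = sqrt (4 * h * P)" "C 3 = 0"
    using flat_corners[OF Q, of 1] flat_corners[OF Q, of 2] flat_corners[OF Q, of 3] n C r s X1 Y1 by auto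
  moreover have "d 1 = side" "d 2 = 2 * side" using r(5) s(5) side_eq calculation by metis+
  ultimately show ?thesis using r s X1 Y1 h by (simp add: upt_conv_Cons numeral_2_eq_2 numeral_3_eq_3)
qed

lemma (in chain) flat_start:
  assumes Q: "Q = 0" and n: "3 < n" and C: "C 1 \<noteq> 0" "C 2 \<noteq> 0"
  shows "C 3 = 0 \<and> seg 1 3 = [(side, 0, -1), (2 * side, X 3 / h, 0)]"
proof -
  interpret re: chain n P 0 h d "\<lambda>i. - X i" Y "\<lambda>i. - C i" "\<lambda>i. (- fst (c i), snd (c i))" sing
    by (rule reflect[OF Q])
  have "C 1 > 0 \<or> - C 1 > 0" using C by auto
  then show ?thesis
    using flat_start_right[OF Q n] re.flat_start_right[OF _ n] C h
    by (auto simp: prod_eq_iff re.side_def side_def upt_conv_Cons)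
qed

context chain begin

text \<open>With \<open>opt\<close>, this treats a missing singular arc as one of duration 0, so
  that all blocks have one form.\<close>

definition stay :: "nat \<Rightarrow> real" where "stay i = (if sing i then d i else 0)"
definition opt :: "nat \<Rightarrow> arc list" where "opt i = (if sing i then [(d i, 0, 1)] else [])"

lemma opt_mrun: "mrun (opt i) x = mflow (stay i, 0, 1) x" by (simp add: opt_def stay_def)
lemma opt_dur: "i < n \<Longrightarrow> dur (opt i) = stay i" and stay_nonneg: "i < n \<Longrightarrow> stay i \<ge> 0"
  using d[of i] by (auto simp: opt_def stay_def)

text \<open>The nodes at which the blocks following a first rest at \<open>j\<close> begin; a block
  is an optional singular arc and the three sides of a hook.\<close>

fun visit :: "nat \<Rightarrow> nat \<Rightarrow> nat" where
  "visit j 0 = j"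
| "visit j (Suc l) = (if sing (visit j l) then visit j l + 4 else visit j l + 3)"

lemma visit_less: "visit j l < visit j (Suc l)" and visit_step: "visit j (Suc l) \<le> visit j l + 4"
  by auto

lemma flat_sing_control:
  assumes "Q = 0" "i < n" "sing i" shows "c i = (0, 1)"
proof -
  have "Y i = h" using flat_zero_iff[OF assms(1), of i] sing[OF assms(2,3)] assms by auto
  then show ?thesis using sing[OF assms(2,3)] assms PQ h by (auto simp: prod_eq_iff)
qed

lemma flat_block:
  assumes Q: "Q = 0" and i: "C i = 0" and k: "k = (if sing i then i + 4 else i + 3)" "k < n"
  shows "C k = 0 \<and> X k = - X i \<and> seg i k = opt i @ hook (X i / h) side"
proof (cases "sing i")
  case True
  have "i < n" using k True by simp
  have s: "C (Suc i) = 0" "X (Suc i) = X i" "\<not> sing (Suc i)" "c i = (0, 1)"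
    using sing[OF \<open>i < n\<close> True] sing_not_adjacent[of i] True k flat_sing_control[OF Q \<open>i < n\<close> True] by auto
  have "[i..<k] = [i, Suc i, Suc i + 1, Suc i + 2]" using k True by (simp add: upt_rec)
  then show ?thesis
    using flat_hook[OF Q, of "Suc i"] k True s by (auto simp: opt_def hook_def numeral_3_eq_3 add.commute[of _ 4] eval_nat_numeral)
next
  case False
  have "[i..<k] = [i, Suc i, i + 2]" using k False by (simp add: upt_rec)
  then show ?thesis
    using flat_hook[OF Q _ False i] k False by (auto simp: opt_def hook_def)
qed

lemma flat_visit:
  assumes Q: "Q = 0" and j: "C j = 0" and l: "visit j l < n"
  shows "C (visit j l) = 0 \<and> X (visit j l) = (- 1) ^ l * X j"
  using l
proof (induction l)
  case (Suc l)
  then have "visit j l < n" using visit_less[of j l] by linarith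
  with Suc.IH flat_block[OF Q, of "visit j l" "visit j (Suc l)"] Suc.prems show ?case by auto
qed (use j in simp)

text \<open>Inside a hook the speed is nonzero, so a singular arc can start only where a block
  starts.\<close>

lemma flat_sing_visit:
  assumes Q: "Q = 0" and j: "C j = 0" "j \<le> i" and i: "i < n" "sing i"
  obtains l where "visit j l = i"
proof -
  have "l \<le> visit j l" for l by (induction l) auto
  then have ex: "\<exists>l. i < visit j l" by (meson lessI order_less_le_trans)
  define m where "m = (LEAST l. i < visit j l)"
  have m: "i < visit j m" unfolding m_def by (rule LeastI_ex[OF ex])
  then have "m \<noteq> 0" using j by (cases m) auto
  then obtain l where l: "m = Suc l" by (cases m) auto
  then have le: "visit j l \<le> i" using not_less_Least[of l "\<lambda>l. i < visit j l"] by (auto simp: m_def)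
  let ?k = "visit j l"
  have C: "C ?k = 0" using flat_visit[OF Q j(1), of l] le i by simp
  have Ci: "C i = 0" using sing i by simp
  have "?k = i"
  proof (rule ccontr)
    assume ne: "?k \<noteq> i"
    \<comment> \<open>\<open>e\<close> is the first bang arc of the block that would contain
      \<open>i\<close> in its interior.\<close>
    define e where "e = (if sing ?k then Suc ?k else ?k)"
    have e: "\<not> sing e" "C e = 0" "e < n"
      using sing[of ?k] sing_not_adjacent[of ?k] C le ne i by (auto simp: e_def)
    have "i = e + 1 \<or> i = e + 2"
    proof -
      have "i \<noteq> e" using e i by auto
      then show ?thesis using m le ne unfolding l e_def by (auto split: if_splits)
    qed
    then show False using flat_hook(1,2)[OF Q e(3,1,2)] i(1) Ci by auto
  qed
  then show thesis by (rule that)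
qed

text \<open>The rest following the third hook is included in the replaced word, so a singular arc at
  any of the four visits makes the replacement strictly shorter.\<close>

lemma flat_three:
  assumes Q: "Q = 0" and j: "C j = 0" and l: "visit j (l + 3) < n" and short: "shortest (seg 0 n)" "ell1 (seg 0 n)"
    and s: "sing (visit j l) \<or> sing (visit j (l + 1)) \<or> sing (visit j (l + 2)) \<or> sing (visit j (l + 3))"
  shows False
proof -
  let ?v = "visit j"
  have ord: "?v l < ?v (l + 1)" "?v (l + 1) < ?v (l + 2)" "?v (l + 2) < ?v (l + 3)"
    using visit_less[of j l] visit_less[of j "l + 1"] visit_less[of j "l + 2"] by (simp_all add: eval_nat_numeral)
  define g where "g = X (?v l) / h"
  have b: "seg (?v l) (?v (l + 1)) = opt (?v l) @ hook g side"
    "seg (?v (l + 1)) (?v (l + 2)) = opt (?v (l + 1)) @ hook (- g) side"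
    "seg (?v (l + 2)) (?v (l + 3)) = opt (?v (l + 2)) @ hook g side"
    using flat_block[OF Q, of "?v l" "?v (l + 1)"] flat_block[OF Q, of "?v (l + 1)" "?v (l + 2)"]
      flat_block[OF Q, of "?v (l + 2)" "?v (l + 3)"] flat_visit[OF Q j, of l] ord l
    by (auto simp: g_def eval_nat_numeral)
  let ?e = "if sing (?v (l + 3)) then Suc (?v (l + 3)) else ?v (l + 3)"
  have e: "seg (?v (l + 3)) ?e = opt (?v (l + 3))"
    using flat_sing_control[OF Q l] by (auto simp: opt_def)
  have "shortest (seg (?v l) ?e)" by (rule shortest_seg[OF short]) (use ord l in auto)
  moreover have "seg (?v l) ?e = opt (?v l) @ hook g side @ opt (?v (l + 1)) @ hook (- g) side
      @ opt (?v (l + 2)) @ hook g side @ opt (?v (l + 3))"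
    using seg_split[of "?v l" "?v (l + 1)" ?e] seg_split[of "?v (l + 1)" "?v (l + 2)" ?e]
      seg_split[of "?v (l + 2)" "?v (l + 3)" ?e] ord b e by simp
  moreover have "\<not> shortest (opt (?v l) @ hook g side @ opt (?v (l + 1)) @ hook (- g) side
      @ opt (?v (l + 2)) @ hook g side @ opt (?v (l + 3)))"
  proof (rule three_hooks_not_shortest)
    show "side > 0" using h PQ Q by (simp add: side_def)
    show "\<bar>g\<bar> = 1" using flat_direction(1)[OF Q, of "?v l"] flat_visit[OF Q j, of l] ord l h
      by (simp add: g_def)
    have "stay (?v l) > 0 \<or> stay (?v (l + 1)) > 0 \<or> stay (?v (l + 2)) > 0 \<or> stay (?v (l + 3)) > 0"
      using s d[of "?v l"] d[of "?v (l + 1)"] d[of "?v (l + 2)"] d[of "?v (l + 3)"] ord l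
      by (auto simp: stay_def simp del: visit.simps)
    then show "stay (?v l) + stay (?v (l + 1)) + stay (?v (l + 2)) + stay (?v (l + 3)) > 0"
      using stay_nonneg[of "?v l"] stay_nonneg[of "?v (l + 1)"] stay_nonneg[of "?v (l + 2)"]
        stay_nonneg[of "?v (l + 3)"] ord l by linarith
  qed (use ord l in \<open>auto intro: opt_mrun opt_dur stay_nonneg simp del: visit.simps\<close>)
  ultimately show False by simp
qed

lemma flat_bound:
  assumes Q: "Q = 0" and short: "shortest (seg 0 n)" "ell1 (seg 0 n)" and ex: "\<exists>i<n. sing i"
  shows "n \<le> 14"
proof (rule ccontr)
  assume "\<not> n \<le> 14"
  then have n15: "n \<ge> 15" by simp
  obtain i where i: "i < n" "sing i" using ex by blast
  then have Ci: "C i = 0" using sing by simp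
  define j where "j = (LEAST k. C k = 0)"
  have j: "C j = 0" "j \<le> i" and jmin: "\<And>k. k < j \<Longrightarrow> C k \<noteq> 0"
    unfolding j_def using Ci by (auto intro: LeastI Least_le dest: not_less_Least)
  have j3: "j \<le> 3"
  proof (rule ccontr)
    assume "\<not> j \<le> 3"
    then show False using flat_start[OF Q] jmin[of 1] jmin[of 2] jmin[of 3] n15 by auto
  qed
  obtain l where l: "visit j l = i" using flat_sing_visit[OF Q j i] .
  show False
  \<comment> \<open>If three hooks precede the known singular arc, these are merged. Otherwise it
    lies at one of the first three visits, and the first three hooks serve, provided that they
    fit.\<close>
  proof (cases "l \<ge> 3")
    case True
    then show False using flat_three[OF Q j(1), of "l - 3"] short l i by (simp add: numeral_3_eq_3 Suc_diff_Suc)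
  next
    case False
    then have l3: "l = 0 \<or> l = 1 \<or> l = 2" by auto
    show False
    proof (cases "visit j 3 < n")
      case True
      then show False using flat_three[OF Q j(1), of 0] short l i l3
        by (auto simp: numeral_2_eq_2 simp del: visit.simps)
    next
      \<comment> \<open>As \<open>visit j 3\<close> is at most \<open>3 + 3 * 4\<close>, all bounds
        are attained and \<open>n = 15\<close>: every hook is preceded by a singular arc. Without
        arcs 0 and 14 the word starts with the last two sides of one hook and ends with the first
        two of another.\<close>
      case big: False
      have v3: "visit j 3 \<ge> 15" using big n15 by simp
      have st: "visit j 1 \<le> j + 4" "visit j 2 \<le> visit j 1 + 4" "visit j 3 \<le> visit j 2 + 4"
        using visit_step[of j 0] visit_step[of j 1] visit_step[of j 2] by (simp_all add: eval_nat_numeral del: visit.simps(2))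
      have v: "j = 3" "visit j 1 = 7" "visit j 2 = 11" "visit j 3 = 15"
        using j3 v3 st by linarith+
      have sg: "sing 3" "sing 7" "sing 11"
        using v by (auto simp: eval_nat_numeral split: if_splits)
      note C3 = \<open>C j = 0\<close>[unfolded v(1)]
      define g where "g = X 3 / h"
      have s1: "seg 1 3 = [(side, 0, -1), (2 * side, g, 0)]"
        using flat_start[OF Q] jmin[of 1] jmin[of 2] v(1) n15 by (simp add: g_def)
      have s2: "C 7 = 0 \<and> X 7 = - X 3 \<and> seg 3 7 = opt 3 @ hook g side"
        using flat_block[OF Q C3, of 7] sg n15 by (simp add: g_def)
      have s3: "C 11 = 0 \<and> X 11 = X 3 \<and> seg 7 11 = opt 7 @ hook (- g) side"
        using flat_block[OF Q, of 7 11] s2 sg n15 by (simp add: g_def)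
      have "C 12 = 0" "X 12 = X 3" "\<not> sing 12" "c 11 = (0, 1)"
        using sing[of 11] sing_not_adjacent[of 11] sg n15 s3 flat_sing_control[OF Q, of 11] by auto
      then have s4: "seg 11 14 = [(d 11, 0, 1), (2 * side, g, 0), (side, 0, -1)]"
        using flat_hook(1,2)[OF Q, of 12] n15 by (simp add: upt_rec g_def)
      have "shortest (seg 1 14)" by (rule shortest_seg[OF short]) (use n15 in auto)
      moreover have "seg 1 14 = [(side, 0, -1), (2 * side, g, 0), (d 3, 0, 1)] @ hook g side
         @ [(d 7, 0, 1)] @ hook (- g) side @ [(d 11, 0, 1), (2 * side, g, 0), (side, 0, -1)]"
        using seg_split[of 1 3 14] seg_split[of 3 7 14] seg_split[of 7 11 14] s1 s2 s3 s4 sg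
        by (simp add: opt_def del: upt_Suc)
      moreover have "side > 0" using h PQ Q by (simp add: side_def)
      moreover have "\<bar>g\<bar> = 1" using flat_direction(1)[OF Q _ C3] n15 h by (simp add: g_def)
      ultimately show False using half_hooks_not_shortest[of side g "d 3" "d 11" "d 7"] d[of 3] d[of 7] d[of 11] n15
        by simp
    qed
  qed
qed

end

section \<open>Arcs of a mixed extremal\<close>

text \<open>Here \<open>a\<close>, \<open>b\<close>, \<open>e\<close> stand for \<open>h1\<close>, \<open>h2\<close>, \<open>h3\<close> along the extremal, \<open>m4\<close>, \<open>m5\<close> for the constants \<open>h4\<close>, \<open>h5\<close>, and \<open>N\<close>
  collects the exceptional times.\<close>

locale extremal_arc =
  fixes T H m4 m5 :: real and q :: "real \<Rightarrow> point" and u :: "real \<Rightarrow> real \<times> real"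
    and a b e :: "real \<Rightarrow> real" and N :: "real set"
  assumes T: "T > 0" and H: "H > 0" and N: "negligible N"
    and lips: "lip 0 T q" "lip 0 T a" "lip 0 T b" "lip 0 T e"
    and control: "t \<in> {0..T} \<Longrightarrow> \<bar>fst (u t)\<bar> \<le> 1" "t \<in> {0..T} \<Longrightarrow> \<bar>snd (u t)\<bar> \<le> 1"
    and deriv: "t \<in> {0..T} - N \<Longrightarrow> (a has_real_derivative - snd (u t) * e t) (at t within {0..T})"
      "t \<in> {0..T} - N \<Longrightarrow> (b has_real_derivative fst (u t) * e t) (at t within {0..T})"
      "t \<in> {0..T} - N \<Longrightarrow> (e has_real_derivative fst (u t) * m4 + snd (u t) * m5) (at t within {0..T})"
      "t \<in> {0..T} - N \<Longrightarrow> (q has_vector_derivative (fst (u t) *\<^sub>R X1 (q t) + snd (u t) *\<^sub>R X2 (q t))) (at t within {0..T})"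
    and maximum: "t \<in> {0..T} - N \<Longrightarrow> fst (u t) * a t + snd (u t) * b t = H"
    and norm: "t \<in> {0..T} \<Longrightarrow> \<bar>a t\<bar> + \<bar>b t\<bar> = H"
begin

lemma subinterval:
  assumes "0 \<le> s" "r \<le> T"
  shows "lip s r q" "lip s r a" "lip s r b" "lip s r e"
    and "t \<in> {s<..<r} - N \<Longrightarrow> (a has_real_derivative - snd (u t) * e t) (at t within {s..r})"
      "t \<in> {s<..<r} - N \<Longrightarrow> (b has_real_derivative fst (u t) * e t) (at t within {s..r})"
      "t \<in> {s<..<r} - N \<Longrightarrow> (e has_real_derivative fst (u t) * m4 + snd (u t) * m5) (at t within {s..r})"
      "t \<in> {s<..<r} - N \<Longrightarrow> (q has_vector_derivative (fst (u t) *\<^sub>R X1 (q t) + snd (u t) *\<^sub>R X2 (q t))) (at t within {s..r})"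
proof -
  show "lip s r q" "lip s r a" "lip s r b" "lip s r e" by (rule lip_subset[OF _ assms], rule lips)+
  have sub: "{s..r} \<subseteq> {0..T}" using assms by auto
  assume t: "t \<in> {s<..<r} - N"
  then have t: "t \<in> {0..T} - N" using assms by auto
  note d = deriv[OF t]
  show "(a has_real_derivative - snd (u t) * e t) (at t within {s..r})"
    "(b has_real_derivative fst (u t) * e t) (at t within {s..r})"
    "(e has_real_derivative fst (u t) * m4 + snd (u t) * m5) (at t within {s..r})"
    by (rule DERIV_subset[OF d(1) sub] DERIV_subset[OF d(2) sub] DERIV_subset[OF d(3) sub])+
  show "(q has_vector_derivative (fst (u t) *\<^sub>R X1 (q t) + snd (u t) *\<^sub>R X2 (q t))) (at t within {s..r})"
    by (rule has_vector_derivative_within_subset[OF d(4) sub])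
qed

lemma exists_regular: "s < r \<Longrightarrow> \<exists>t. t \<in> {s<..<r} - N"
proof (rule ccontr)
  assume "s < r" "\<nexists>t. t \<in> {s<..<r} - N"
  then have "{s<..<r} \<subseteq> N" by blast
  then have "negligible {s<..<r}" by (rule negligible_subset[OF N])
  then show False using open_not_negligible[of "{s<..<r}"] \<open>s < r\<close> by auto
qed

text \<open>With \<open>norm\<close>, both functions take values in \<open>{- H, 0, H}\<close> and
  are constant by continuity. As the control is nonzero at regular times, their equations force
  \<open>e = 0\<close>, and the equation of \<open>e\<close> then constrains the control.\<close>

lemma singular_interval:
  assumes I: "0 \<le> s" "s < r" "r \<le> T" and z: "\<And>t. t \<in> {s..r} \<Longrightarrow> a t * b t = 0"
  shows "\<And>t. t \<in> {s..r} \<Longrightarrow> a t = a s" "\<And>t. t \<in> {s..r} \<Longrightarrow> b t = b s" "\<And>t. t \<in> {s..r} \<Longrightarrow> e t = 0"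
    "\<And>t. t \<in> {s<..<r} - N \<Longrightarrow> fst (u t) * m4 + snd (u t) * m5 = 0"
proof -
  have const: "f t = f s" if f: "lip s r f" and img: "f ` {s..r} \<subseteq> {- H, 0, H}" and t: "t \<in> {s..r}" for f t
  proof -
    have "f constant_on {s..r}"
    proof (rule continuous_finite_range_constant)
      show "continuous_on {s..r} f" by (rule lip_imp_continuous[OF f])
      show "finite (f ` {s..r})" by (rule finite_subset[OF img]) simp
    qed simp
    then obtain k where k: "\<And>t. t \<in> {s..r} \<Longrightarrow> f t = k" unfolding constant_on_def by blast
    show ?thesis using k[OF t] k[of s] I by simp
  qed
  have vals: "a t \<in> {- H, 0, H} \<and> b t \<in> {- H, 0, H}" if "t \<in> {s..r}" for t
  proof -
    have "a t = 0 \<or> b t = 0" "\<bar>a t\<bar> + \<bar>b t\<bar> = H" using norm[of t] z[OF that] that I by auto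
    then show ?thesis by (auto simp: abs_if split: if_splits)
  qed
  note sub = subinterval[OF I(1,3)]
  show A: "a t = a s" and B: "b t = b s" if "t \<in> {s..r}" for t
  proof -
    have "a ` {s..r} \<subseteq> {- H, 0, H}" "b ` {s..r} \<subseteq> {- H, 0, H}" using vals by blast+
    then show "a t = a s" "b t = b s" using const[OF sub(2) _ that] const[OF sub(3) _ that] by auto
  qed
  have deq: "D = 0" if "(f has_real_derivative D) (at t within {s..r})" "\<And>t. t \<in> {s..r} \<Longrightarrow> f t = f s"
    "t \<in> {s<..<r}" for f D t
  proof -
    note fs = that(2)
    have "(f has_real_derivative D) (at t)" using that(1,3) by (simp add: at_within_Icc_at)
    then have "((\<lambda>t. f s) has_real_derivative D) (at t)"
    proof (rule has_field_derivative_transform_within_open)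
      show "open {s<..<r}" "t \<in> {s<..<r}" using that(3) by auto
      show "f x = f s" if "x \<in> {s<..<r}" for x by (rule fs) (use that in auto)
    qed
    then show ?thesis using DERIV_unique[of "\<lambda>t. f s" D t 0] by simp
  qed
  have "e t = 0" if t: "t \<in> {s<..<r} - N" for t
  proof -
    have "- snd (u t) * e t = 0" "fst (u t) * e t = 0"
      using deq[OF sub(5)[OF t] A] deq[OF sub(6)[OF t] B] t by blast+
    moreover have "fst (u t) \<noteq> 0 \<or> snd (u t) \<noteq> 0" using maximum[of t] t I H by auto
    ultimately show ?thesis by auto
  qed
  then show E: "e t = 0" if "t \<in> {s..r}" for t
    by (rule continuous_negligible_zero[OF lip_imp_continuous[OF sub(4)] I(2) N _ that])
  show "fst (u t) * m4 + snd (u t) * m5 = 0" if t: "t \<in> {s<..<r} - N" for t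
  proof (rule deq[OF sub(7)[OF t]])
    show "e t = e s" if "t \<in> {s..r}" for t using E[OF that] E[of s] I by simp
  qed (use t in simp)
qed

text \<open>The signs of \<open>a\<close> and \<open>b\<close> are constant, equality in the maximum
  condition makes the control the sign vector, and the equations integrate to polynomials.\<close>

lemma edge_interval:
  assumes I: "0 \<le> s" "s < r" "r \<le> T" and nz: "\<And>t. t \<in> {s<..<r} \<Longrightarrow> a t * b t \<noteq> 0"
  obtains w1 w2 where "w1 \<in> {1, -1}" "w2 \<in> {1, -1}"
    "\<And>t. t \<in> {s<..<r} \<Longrightarrow> w1 * a t > 0 \<and> w2 * b t > 0"
    "\<And>t. t \<in> {s..r} \<Longrightarrow> w1 * a t + w2 * b t = H"
    "\<And>t. t \<in> {s<..<r} - N \<Longrightarrow> u t = (w1, w2)"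
    "\<And>t. t \<in> {s..r} \<Longrightarrow> e t = e s + (w1 * m4 + w2 * m5) * (t - s)"
    "\<And>t. t \<in> {s..r} \<Longrightarrow> a t = a s - w2 * (e s * (t - s) + (w1 * m4 + w2 * m5) * (t - s)\<^sup>2 / 2)"
    "\<And>t. t \<in> {s..r} \<Longrightarrow> b t = b s + w1 * (e s * (t - s) + (w1 * m4 + w2 * m5) * (t - s)\<^sup>2 / 2)"
proof -
  note sub = subinterval[OF I(1,3)]
  have sign: "\<exists>w\<in>{1, -1}. \<forall>t\<in>{s<..<r}. w * f t > 0"
    if f: "lip s r f" and fnz: "\<And>t. t \<in> {s<..<r} \<Longrightarrow> f t \<noteq> 0" for f :: "real \<Rightarrow> real"
  proof -
    have "connected (f ` {s<..<r})"
      using lip_imp_continuous[OF f] by (intro connected_continuous_image) (auto intro: continuous_on_subset)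
    moreover have "0 \<notin> f ` {s<..<r}" using fnz by auto
    ultimately have "(\<forall>t\<in>{s<..<r}. f t > 0) \<or> (\<forall>t\<in>{s<..<r}. f t < 0)"
    proof -
      assume c: "connected (f ` {s<..<r})" and 0: "0 \<notin> f ` {s<..<r}"
      show ?thesis
      proof (rule ccontr)
        assume "\<not> ?thesis"
        then obtain x y where "x \<in> {s<..<r}" "f x \<le> 0" "y \<in> {s<..<r}" "0 \<le> f y" by (meson linorder_not_le)
        then show False using connectedD_interval[OF c, of "f x" "f y" 0] 0 by blast
      qed
    qed
    then show ?thesis by auto
  qed
  obtain w1 where w1: "w1 \<in> {1, -1}" "\<forall>t\<in>{s<..<r}. w1 * a t > 0" using sign[OF sub(2)] nz by force
  obtain w2 where w2: "w2 \<in> {1, -1}" "\<forall>t\<in>{s<..<r}. w2 * b t > 0" using sign[OF sub(3)] nz by force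
  have sum: "w1 * a t + w2 * b t = H" if "t \<in> {s..r}" for t
  proof -
    have "w1 * a t + w2 * b t - H = 0"
    proof (rule continuous_negligible_zero[OF _ I(2) N _ that])
      show "continuous_on {s..r} (\<lambda>t. w1 * a t + w2 * b t - H)"
        using sub by (intro continuous_intros lip_imp_continuous)
      show "w1 * a t + w2 * b t - H = 0" if t: "t \<in> {s<..<r} - N" for t
      proof -
        have "w1 * a t > 0" "w2 * b t > 0" "t \<in> {0..T}" using w1 w2 t I by auto
        then show ?thesis using norm[of t] w1(1) w2(1) by auto
      qed
    qed
    then show ?thesis by simp
  qed
  have U: "u t = (w1, w2)" if t: "t \<in> {s<..<r} - N" for t
  proof -
    have w: "w1 * a t > 0" "w2 * b t > 0" and tT: "t \<in> {0..T} - N" using w1 w2 t I by auto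
    have "fst (u t) * a t + snd (u t) * b t = \<bar>a t\<bar> + \<bar>b t\<bar>" using maximum norm tT by auto
    moreover have "x * y \<le> \<bar>y\<bar>" if "\<bar>x\<bar> \<le> 1" for x y :: real
    proof -
      have "x * y \<le> \<bar>x\<bar> * \<bar>y\<bar>" using abs_ge_self[of "x * y"] by (simp add: abs_mult)
      also have "\<dots> \<le> 1 * \<bar>y\<bar>" using that by (intro mult_right_mono) auto
      finally show ?thesis by simp
    qed
    then have "fst (u t) * a t \<le> \<bar>a t\<bar>" "snd (u t) * b t \<le> \<bar>b t\<bar>" using control[of t] tT by auto
    ultimately have "fst (u t) * a t = \<bar>a t\<bar>" "snd (u t) * b t = \<bar>b t\<bar>" by auto
    moreover have "\<bar>a t\<bar> = w1 * a t" "\<bar>b t\<bar> = w2 * b t" "a t \<noteq> 0" "b t \<noteq> 0" using w w1(1) w2(1) by auto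
    ultimately show ?thesis by (auto simp: prod_eq_iff)
  qed
  have E: "e t = e s + (w1 * m4 + w2 * m5) * (t - s)" if "t \<in> {s..r}" for t
  proof (rule lip_AE_unique[OF sub(4) _ N _ that])
    fix t assume t: "t \<in> {s<..<r} - N"
    show "\<exists>D. (e has_real_derivative D) (at t within {s..r}) \<and>
       ((\<lambda>t. e s + (w1 * m4 + w2 * m5) * (t - s)) has_real_derivative D) (at t within {s..r})"
      using sub(7)[OF t] U[OF t] by (intro exI[of _ "w1 * m4 + w2 * m5"] conjI) (auto intro!: derivative_eq_intros)
  qed auto
  define \<phi> where "\<phi> = (\<lambda>t. e s * (t - s) + (w1 * m4 + w2 * m5) * (t - s)\<^sup>2 / 2)"
  have \<phi>: "(\<phi> has_real_derivative e t) (at t within {s..r})" if "t \<in> {s<..<r}" for t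
    unfolding \<phi>_def using E[of t] that by (auto intro!: derivative_eq_intros)
  have L: "lip s r \<phi>" unfolding \<phi>_def by auto
  have A: "a t = a s - w2 * \<phi> t" if "t \<in> {s..r}" for t
  proof (rule lip_AE_unique[OF sub(2) _ N _ that])
    fix t assume t: "t \<in> {s<..<r} - N"
    show "\<exists>D. (a has_real_derivative D) (at t within {s..r}) \<and>
       ((\<lambda>t. a s - w2 * \<phi> t) has_real_derivative D) (at t within {s..r})"
      using sub(5)[OF t] U[OF t] \<phi>[of t] t
      by (intro exI[of _ "- w2 * e t"] conjI) (auto intro!: derivative_eq_intros)
  qed (use L in \<open>auto simp: \<phi>_def\<close>)
  have B: "b t = b s + w1 * \<phi> t" if "t \<in> {s..r}" for t
  proof (rule lip_AE_unique[OF sub(3) _ N _ that])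
    fix t assume t: "t \<in> {s<..<r} - N"
    show "\<exists>D. (b has_real_derivative D) (at t within {s..r}) \<and>
       ((\<lambda>t. b s + w1 * \<phi> t) has_real_derivative D) (at t within {s..r})"
      using sub(6)[OF t] U[OF t] \<phi>[of t] t
      by (intro exI[of _ "w1 * e t"] conjI) (auto intro!: derivative_eq_intros)
  qed (use L in \<open>auto simp: \<phi>_def\<close>)
  show thesis
    by (rule that[OF w1(1) w2(1) _ sum U E A[unfolded \<phi>_def] B[unfolded \<phi>_def]]) (use w1 w2 in auto)
qed

end

section \<open>Cutting the time interval at the zero set\<close>

lemma frontier_UN_finite:
  assumes "finite I" "\<And>i. i \<in> I \<Longrightarrow> finite (frontier (A i))"
  shows "finite (frontier (\<Union>i\<in>I. A i))"
  using assms
proof (induction rule: finite_induct)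
  case (insert i I)
  then show ?case
    using finite_subset[OF frontier_Un_subset[of "A i" "\<Union>i\<in>I. A i"]] by auto
qed simp

text \<open>Cutting at the frontier of the zero set, rather than at all zeros, merges adjacent singular arcs.\<close>

lemma finite_frontier_subdivision:
  fixes Z :: "real set"
  assumes T: "T > 0" and Z: "closed Z" "Z \<subseteq> {0..T}" and fin: "finite (frontier Z)"
  obtains n \<tau> where "subdivision T n \<tau>" "\<And>i. 0 < i \<Longrightarrow> i < n \<Longrightarrow> \<tau> i \<in> Z"
    "\<And>i. i < n \<Longrightarrow> {\<tau> i<..<\<tau> (Suc i)} \<subseteq> Z \<or> {\<tau> i<..<\<tau> (Suc i)} \<inter> Z = {}"
    "\<And>i. Suc i < n \<Longrightarrow> \<not> ({\<tau> i<..<\<tau> (Suc i)} \<subseteq> Z \<and> {\<tau> (Suc i)<..<\<tau> (Suc (Suc i))} \<subseteq> Z)"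
    "\<And>\<alpha> \<beta>. 0 \<le> \<alpha> \<Longrightarrow> \<alpha> < \<beta> \<Longrightarrow> \<beta> \<le> T \<Longrightarrow> {\<alpha>..\<beta>} \<subseteq> Z \<Longrightarrow> \<exists>i<n. {\<tau> i<..<\<tau> (Suc i)} \<subseteq> Z"
    "\<And>\<alpha> \<beta>. 0 \<le> \<alpha> \<Longrightarrow> \<alpha> < \<beta> \<Longrightarrow> \<beta> \<le> T \<Longrightarrow> finite ({\<alpha>..\<beta>} \<inter> Z) \<Longrightarrow> \<exists>i<n. {\<tau> i<..<\<tau> (Suc i)} \<inter> Z = {}"
proof -
  define F where "F = insert 0 (insert T (frontier Z))"
  have F: "finite F" "0 \<in> F" "T \<in> F" using fin by (auto simp: F_def)
  have frZ: "frontier Z \<subseteq> Z" using Z(1) by (simp add: frontier_subset_closed)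
  then have F0T: "x \<in> F \<Longrightarrow> 0 \<le> x \<and> x \<le> T" for x using Z T by (auto simp: F_def)
  define xs where "xs = sorted_list_of_set F"
  have xs: "sorted_wrt (<) xs" "set xs = F" unfolding xs_def using F by auto
  have less: "xs ! i < xs ! j" if "i < j" "j < length xs" for i j
    using sorted_wrt_nth_less[OF xs(1)] that by blast
  have "xs \<noteq> []" using xs F by auto
  define n where "n = length xs - 1"
  have len: "length xs = Suc n" using \<open>xs \<noteq> []\<close> by (simp add: n_def)
  have idx: "\<exists>i\<le>n. xs ! i = x" if "x \<in> F" for x
    using that unfolding xs(2)[symmetric] in_set_conv_nth len by (auto simp: less_Suc_eq_le)
  have mem: "xs ! i \<in> F" if "i \<le> n" for i using that xs(2) len by (metis le_imp_less_Suc nth_mem)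
  have first: "xs ! 0 = 0"
  proof -
    obtain i where "i \<le> n" "xs ! i = 0" using idx F by blast
    then show ?thesis using less[of 0 i] len mem[of 0] F0T[of "xs ! 0"] by (cases "i = 0") auto
  qed
  have last: "xs ! n = T"
  proof -
    obtain i where "i \<le> n" "xs ! i = T" using idx F by blast
    then show ?thesis using less[of i n] len mem[of n] F0T[of "xs ! n"] by (cases "i = n") auto
  qed
  have gap: "x \<notin> F" if "i < n" "xs ! i < x" "x < xs ! Suc i" for i x
  proof
    assume "x \<in> F"
    then obtain k where k: "k \<le> n" "xs ! k = x" using idx by blast
    consider "k \<le> i" | "Suc i \<le> k" by linarith
    then show False
    proof cases
      case 1 then show ?thesis using less[of k i] k that len by (cases "k = i") auto
    next
      case 2 then show ?thesis using less[of "Suc i" k] k that len by (cases "k = Suc i") auto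
    qed
  qed
  have inside: "\<exists>i<n. xs ! i < x \<and> x < xs ! Suc i" if x: "0 \<le> x" "x \<le> T" "x \<notin> F" for x
  proof -
    have "x < xs ! n" using x last F by (metis order_le_less)
    define k where "k = (LEAST k. x < xs ! k)"
    have k: "x < xs ! k" "k \<le> n" unfolding k_def using \<open>x < xs ! n\<close> by (auto intro: LeastI Least_le)
    then have "k \<noteq> 0" using first x by (cases k) auto
    then obtain i where i: "k = Suc i" by (cases k) auto
    then have "\<not> x < xs ! i" using not_less_Least[of i "\<lambda>k. x < xs ! k"] by (simp add: k_def)
    moreover have "xs ! i \<noteq> x" using mem[of i] k i x by auto
    ultimately show ?thesis using k i by (intro exI[of _ i]) auto
  qed
  have dich: "{xs ! i<..<xs ! Suc i} \<subseteq> Z \<or> {xs ! i<..<xs ! Suc i} \<inter> Z = {}" if "i < n" for i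
  proof (rule ccontr)
    assume "\<not> ?thesis"
    then have "{xs ! i<..<xs ! Suc i} \<inter> Z \<noteq> {}" "{xs ! i<..<xs ! Suc i} - Z \<noteq> {}" by auto
    then have "{xs ! i<..<xs ! Suc i} \<inter> frontier Z \<noteq> {}"
      by (intro connected_Int_frontier) auto
    then show False using gap[OF that] by (auto simp: F_def)
  qed
  have sub: "subdivision T n (\<lambda>i. xs ! i)"
    using first last less len by (auto simp: subdivision_def)
  have frt: "xs ! i \<in> frontier Z" if "0 < i" "i < n" for i
    using mem[of i] less[of 0 i] less[of i n] that len first last by (auto simp: F_def)
  show thesis
  proof (rule that[OF sub])
    show "xs ! i \<in> Z" if "0 < i" "i < n" for i using frt[OF that] frZ by auto
    show "\<not> ({xs ! i<..<xs ! Suc i} \<subseteq> Z \<and> {xs ! Suc i<..<xs ! Suc (Suc i)} \<subseteq> Z)" if "Suc i < n" for i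
    proof
      assume A: "{xs ! i<..<xs ! Suc i} \<subseteq> Z \<and> {xs ! Suc i<..<xs ! Suc (Suc i)} \<subseteq> Z"
      have fr: "xs ! Suc i \<in> frontier Z" using frt that by simp
      then have "{xs ! i<..<xs ! Suc (Suc i)} \<subseteq> Z" using A frZ by (smt (verit) greaterThanLessThan_iff subset_iff)
      then have "{xs ! i<..<xs ! Suc (Suc i)} \<subseteq> interior Z" by (simp add: interior_maximal)
      then have "xs ! Suc i \<in> interior Z" using less[of i "Suc i"] less[of "Suc i" "Suc (Suc i)"] len that by auto
      then show False using fr by (simp add: frontier_def)
    qed
    show "\<exists>i<n. {xs ! i<..<xs ! Suc i} \<subseteq> Z" if ab: "0 \<le> \<alpha>" "\<alpha> < \<beta>" "\<beta> \<le> T" "{\<alpha>..\<beta>} \<subseteq> Z" for \<alpha> \<beta>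
    proof -
      have "infinite ({\<alpha>..\<beta>} - F)" using F(1) ab by (simp add: infinite_Icc Diff_infinite_finite)
      then obtain x where x: "x \<in> {\<alpha>..\<beta>} - F" by (metis finite.emptyI all_not_in_conv)
      then obtain i where "i < n" "xs ! i < x" "x < xs ! Suc i" using inside[of x] ab by auto
      moreover from this have "x \<in> {xs ! i<..<xs ! Suc i} \<inter> Z" using x ab by auto
      ultimately show ?thesis using dich[of i] by (intro exI[of _ i]) blast
    qed
    show "\<exists>i<n. {xs ! i<..<xs ! Suc i} \<inter> Z = {}" if ab: "0 \<le> \<alpha>" "\<alpha> < \<beta>" "\<beta> \<le> T" "finite ({\<alpha>..\<beta>} \<inter> Z)" for \<alpha> \<beta>
    proof -
      have "infinite ({\<alpha>..\<beta>} - (F \<union> {\<alpha>..\<beta>} \<inter> Z))"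
        using F(1) ab by (simp add: infinite_Icc Diff_infinite_finite)
      then obtain x where x: "x \<in> {\<alpha>..\<beta>} - (F \<union> {\<alpha>..\<beta>} \<inter> Z)" by (metis finite.emptyI all_not_in_conv)
      then obtain i where "i < n" "xs ! i < x" "x < xs ! Suc i" using inside[of x] ab by auto
      moreover from this have "x \<in> {xs ! i<..<xs ! Suc i} - Z" using x by auto
      ultimately show ?thesis using dich[of i] by (intro exI[of _ i]) blast
    qed
  qed (use dich in auto)
qed

text \<open>The subdivision given by \<open>mixed\<close> may cut arcs arbitrarily, so only
  properties of the zero set are retained: bang-bang pieces contribute finitely many points and
  singular pieces whole intervals.\<close>

lemma mixed_zero_set:
  assumes T: "T > 0" and cont: "continuous_on {0..T} (\<lambda>t. h1 (lam t))" "continuous_on {0..T} (\<lambda>t. h2 (lam t))"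
    and m: "mixed T lam" and Z: "Z = {t \<in> {0..T}. h1 (lam t) * h2 (lam t) = 0}"
  shows "closed Z" "finite (frontier Z)"
    "\<exists>\<alpha> \<beta>. 0 \<le> \<alpha> \<and> \<alpha> < \<beta> \<and> \<beta> \<le> T \<and> {\<alpha>..\<beta>} \<subseteq> Z"
    "\<exists>\<alpha> \<beta>. 0 \<le> \<alpha> \<and> \<alpha> < \<beta> \<and> \<beta> \<le> T \<and> finite ({\<alpha>..\<beta>} \<inter> Z)"
proof -
  obtain n \<tau> where s: "subdivision T n \<tau>"
    and arcs: "\<And>i. i < n \<Longrightarrow> bang_bang_arc lam {\<tau> i..\<tau> (Suc i)} \<or> singular_arc lam {\<tau> i..\<tau> (Suc i)}"
    and ex: "\<exists>i<n. bang_bang_arc lam {\<tau> i..\<tau> (Suc i)}" "\<exists>i<n. singular_arc lam {\<tau> i..\<tau> (Suc i)}"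
    using m by (auto simp: mixed_def)
  have \<tau>: "\<tau> 0 = 0" "\<tau> n = T" "\<And>i. i < n \<Longrightarrow> \<tau> i < \<tau> (Suc i)" using s by (auto simp: subdivision_def)
  have mono: "\<tau> i \<le> \<tau> j" if "i \<le> j" "j \<le> n" for i j
    using that
  proof (induction j)
    case (Suc j)
    then show ?case using \<tau>(3)[of j] by (cases "i = Suc j") auto
  qed simp
  have rng: "0 \<le> \<tau> i" "\<tau> (Suc i) \<le> T" if "i < n" for i
    using mono[of 0 i] mono[of "Suc i" n] \<tau> that by auto
  have eqZ: "Z = {0..T} \<inter> (\<lambda>t. h1 (lam t) * h2 (lam t)) -` {0}" using Z by auto
  show cZ: "closed Z"
    unfolding eqZ by (intro continuous_closed_preimage continuous_intros cont closed_singleton closed_atLeastAtMost)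
  have bang: "finite ({\<tau> i..\<tau> (Suc i)} \<inter> Z)" if "bang_bang_arc lam {\<tau> i..\<tau> (Suc i)}" for i
    using that unfolding bang_bang_arc_def by (rule rev_finite_subset) (auto simp: Z)
  have sing: "{\<tau> i..\<tau> (Suc i)} \<subseteq> Z" if "singular_arc lam {\<tau> i..\<tau> (Suc i)}" "i < n" for i
    using that rng[of i] by (auto simp: singular_arc_def Z)
  have cover: "\<exists>i<n. \<tau> i \<le> t \<and> t \<le> \<tau> (Suc i)" if "t \<in> {0..T}" for t
  proof -
    define k where "k = (LEAST k. t \<le> \<tau> k)"
    have k: "t \<le> \<tau> k" "k \<le> n" unfolding k_def using that \<tau> by (auto intro: LeastI Least_le)
    show ?thesis
    proof (cases k)
      case 0
      then have "t = \<tau> 0" using k that \<tau> by auto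
      then show ?thesis using \<tau>(1,2) \<tau>(3)[of 0] T by (intro exI[of _ 0]) (cases n; auto)
    next
      case (Suc i)
      then have "\<not> t \<le> \<tau> i" using not_less_Least[of i "\<lambda>k. t \<le> \<tau> k"] by (simp add: k_def)
      then show ?thesis using k Suc by (intro exI[of _ i]) auto
    qed
  qed
  have "Z = (\<Union>i\<in>{..<n}. {\<tau> i..\<tau> (Suc i)} \<inter> Z)" using cover by (fastforce simp: Z)
  moreover have "finite (frontier (\<Union>i\<in>{..<n}. {\<tau> i..\<tau> (Suc i)} \<inter> Z))"
  proof (rule frontier_UN_finite)
    fix i assume i: "i \<in> {..<n}"
    show "finite (frontier ({\<tau> i..\<tau> (Suc i)} \<inter> Z))"
    proof (cases "bang_bang_arc lam {\<tau> i..\<tau> (Suc i)}")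
      case True
      have "closed ({\<tau> i..\<tau> (Suc i)} \<inter> Z)" using cZ by (intro closed_Int) auto
      then show ?thesis using bang[OF True] frontier_subset_closed finite_subset by metis
    next
      case False
      then have "{\<tau> i..\<tau> (Suc i)} \<inter> Z = {\<tau> i..\<tau> (Suc i)}" using arcs[of i] sing[of i] i by auto
      moreover have "frontier {\<tau> i..\<tau> (Suc i)} \<subseteq> {\<tau> i, \<tau> (Suc i)}"
        by (auto simp: frontier_def)
      ultimately show ?thesis by (metis finite.emptyI finite.insertI finite_subset)
    qed
  qed simp
  ultimately show "finite (frontier Z)" by simp
  show "\<exists>\<alpha> \<beta>. 0 \<le> \<alpha> \<and> \<alpha> < \<beta> \<and> \<beta> \<le> T \<and> {\<alpha>..\<beta>} \<subseteq> Z" using ex(2) sing rng \<tau>(3) by blast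
  show "\<exists>\<alpha> \<beta>. 0 \<le> \<alpha> \<and> \<alpha> < \<beta> \<and> \<beta> \<le> T \<and> finite ({\<alpha>..\<beta>} \<inter> Z)" using ex(1) bang rng \<tau>(3) by blast
qed

locale arc_partition = extremal_arc +
  fixes n :: nat and \<tau> :: "nat \<Rightarrow> real"
  assumes sub: "subdivision T n \<tau>"
    and nodes: "0 < i \<Longrightarrow> i < n \<Longrightarrow> a (\<tau> i) * b (\<tau> i) = 0"
    and dich: "i < n \<Longrightarrow> (\<forall>t\<in>{\<tau> i<..<\<tau> (Suc i)}. a t * b t = 0) \<or> (\<forall>t\<in>{\<tau> i<..<\<tau> (Suc i)}. a t * b t \<noteq> 0)"
    and adj: "Suc i < n \<Longrightarrow> \<not> ((\<forall>t\<in>{\<tau> i<..<\<tau> (Suc i)}. a t * b t = 0) \<and> (\<forall>t\<in>{\<tau> (Suc i)<..<\<tau> (Suc (Suc i))}. a t * b t = 0))"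
    and ex: "\<exists>i<n. \<forall>t\<in>{\<tau> i<..<\<tau> (Suc i)}. a t * b t = 0"
      "\<exists>i<n. \<forall>t\<in>{\<tau> i<..<\<tau> (Suc i)}. a t * b t \<noteq> 0"
    and m: "m4 \<noteq> 0 \<or> m5 \<noteq> 0"
begin

definition rests :: "nat \<Rightarrow> bool" where "rests i \<longleftrightarrow> (\<forall>t\<in>{\<tau> i<..<\<tau> (Suc i)}. a t * b t = 0)"
definition len :: "nat \<Rightarrow> real" where "len i = \<tau> (Suc i) - \<tau> i"
text \<open>The control at an arbitrary regular time; it turns out to be the control at all regular
  times of the arc.\<close>

definition ctrl :: "nat \<Rightarrow> real \<times> real" where "ctrl i = u (SOME t. t \<in> {\<tau> i<..<\<tau> (Suc i)} - N)"

lemma node_less: "i < n \<Longrightarrow> \<tau> i < \<tau> (Suc i)" and node_ends: "\<tau> 0 = 0" "\<tau> n = T"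
  using sub by (auto simp: subdivision_def)

lemma node_mono: "i \<le> j \<Longrightarrow> j \<le> n \<Longrightarrow> \<tau> i \<le> \<tau> j"
proof (induction j)
  case (Suc j)
  then show ?case using node_less[of j] by (cases "i = Suc j") auto
qed simp

lemma node_range: "i \<le> n \<Longrightarrow> \<tau> i \<in> {0..T}"
  using node_mono[of 0 i] node_mono[of i n] node_ends by auto

lemma arc_range: "i < n \<Longrightarrow> 0 \<le> \<tau> i \<and> \<tau> i < \<tau> (Suc i) \<and> \<tau> (Suc i) \<le> T"
  using node_range[of i] node_range[of "Suc i"] node_less[of i] by auto

lemma ctrl_regular: "i < n \<Longrightarrow> \<exists>t\<in>{\<tau> i<..<\<tau> (Suc i)} - N. ctrl i = u t"
  unfolding ctrl_def using someI_ex[OF exists_regular[of "\<tau> i" "\<tau> (Suc i)"]] node_less by blast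

text \<open>The maximum condition fixes one control component and the vanishing force the other: its
  coefficient is nonzero because \<open>m4\<close> and \<open>m5\<close> do not both vanish. Hence
  the control is constant.\<close>

lemma rest_arc:
  assumes i: "i < n" and s: "rests i"
  shows "a (\<tau> (Suc i)) = a (\<tau> i)" "b (\<tau> (Suc i)) = b (\<tau> i)" "e (\<tau> i) = 0" "e (\<tau> (Suc i)) = 0"
    "a (\<tau> i) * b (\<tau> i) = 0"
    "fst (ctrl i) * m4 + snd (ctrl i) * m5 = 0" "fst (ctrl i) * a (\<tau> i) + snd (ctrl i) * b (\<tau> i) = H"
    "\<bar>fst (ctrl i)\<bar> \<le> 1" "\<bar>snd (ctrl i)\<bar> \<le> 1" "\<And>t. t \<in> {\<tau> i<..<\<tau> (Suc i)} - N \<Longrightarrow> u t = ctrl i"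
proof -
  note r = arc_range[OF i]
  have "lip (\<tau> i) (\<tau> (Suc i)) (\<lambda>t. a t * b t)"
    using subinterval[of "\<tau> i" "\<tau> (Suc i)"] r by auto
  then have z: "a t * b t = 0" if "t \<in> {\<tau> i..\<tau> (Suc i)}" for t
  proof (rule continuous_negligible_zero[OF lip_imp_continuous _ negligible_empty _ that])
  qed (use s r in \<open>simp_all add: rests_def\<close>)
  have r': "0 \<le> \<tau> i" "\<tau> i < \<tau> (Suc i)" "\<tau> (Suc i) \<le> T" using r by auto
  have S: "a t = a (\<tau> i)" "b t = b (\<tau> i)" "e t = 0" if "t \<in> {\<tau> i..\<tau> (Suc i)}" for t
    using singular_interval(1-3)[OF r' _ that] z by blast+
  have S4: "fst (u t) * m4 + snd (u t) * m5 = 0" if "t \<in> {\<tau> i<..<\<tau> (Suc i)} - N" for t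
    using singular_interval(4)[OF r' _ that] z by blast
  show "a (\<tau> (Suc i)) = a (\<tau> i)" "b (\<tau> (Suc i)) = b (\<tau> i)" "e (\<tau> i) = 0" "e (\<tau> (Suc i)) = 0"
    "a (\<tau> i) * b (\<tau> i) = 0"
    using S(1)[of "\<tau> (Suc i)"] S(2)[of "\<tau> (Suc i)"] S(3) z r by auto
  have U: "fst (u t) * m4 + snd (u t) * m5 = 0" "fst (u t) * a (\<tau> i) + snd (u t) * b (\<tau> i) = H"
    "\<bar>fst (u t)\<bar> \<le> 1" "\<bar>snd (u t)\<bar> \<le> 1" if t: "t \<in> {\<tau> i<..<\<tau> (Suc i)} - N" for t
    using S4[OF t] maximum[of t] S(1)[of t] S(2)[of t] control[of t] t r by auto
  obtain t0 where t0: "t0 \<in> {\<tau> i<..<\<tau> (Suc i)} - N" "ctrl i = u t0" using ctrl_regular[OF i] by blast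
  show W: "fst (ctrl i) * m4 + snd (ctrl i) * m5 = 0" "fst (ctrl i) * a (\<tau> i) + snd (ctrl i) * b (\<tau> i) = H"
    "\<bar>fst (ctrl i)\<bar> \<le> 1" "\<bar>snd (ctrl i)\<bar> \<le> 1" using U[OF t0(1)] t0(2) by auto
  show "u t = ctrl i" if t: "t \<in> {\<tau> i<..<\<tau> (Suc i)} - N" for t
  proof -
    have "a (\<tau> i) = 0 \<or> b (\<tau> i) = 0" using z[of "\<tau> i"] r by auto
    then show ?thesis
    proof
      assume 0: "a (\<tau> i) = 0"
      then have 1: "snd (u t) = snd (ctrl i)" "snd (ctrl i) \<noteq> 0" using U(2)[OF t] W(2) H by auto
      then have "m4 \<noteq> 0" using W(1) m by auto
      then have "fst (u t) = fst (ctrl i)" using U(1)[OF t] W(1) 1 by (metis add_right_cancel mult_right_cancel)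
      with 1 show ?thesis by (simp add: prod_eq_iff)
    next
      assume 0: "b (\<tau> i) = 0"
      then have 1: "fst (u t) = fst (ctrl i)" "fst (ctrl i) \<noteq> 0" using U(2)[OF t] W(2) H by auto
      then have "m5 \<noteq> 0" using W(1) m by auto
      then have "snd (u t) = snd (ctrl i)" using U(1)[OF t] W(1) 1 by (metis add_left_cancel mult_right_cancel)
      with 1 show ?thesis by (simp add: prod_eq_iff)
    qed
  qed
qed

lemma edge_arc:
  assumes i: "i < n" and s: "\<not> rests i"
  obtains w1 w2 where "ctrl i = (w1, w2)" "w1 \<in> {1, -1}" "w2 \<in> {1, -1}"
    "w1 * a (\<tau> i) + w2 * b (\<tau> i) = H"
    "\<And>t. t \<in> {\<tau> i<..<\<tau> (Suc i)} - N \<Longrightarrow> u t = ctrl i"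
    "\<And>s. s \<in> {0<..<len i} \<Longrightarrow> w1 * (a (\<tau> i) - w2 * (e (\<tau> i) * s + (w1 * m4 + w2 * m5) * s\<^sup>2 / 2)) > 0
       \<and> w2 * (b (\<tau> i) + w1 * (e (\<tau> i) * s + (w1 * m4 + w2 * m5) * s\<^sup>2 / 2)) > 0"
    "e (\<tau> (Suc i)) = e (\<tau> i) + (w1 * m4 + w2 * m5) * len i"
    "a (\<tau> (Suc i)) = a (\<tau> i) - w2 * (e (\<tau> i) * len i + (w1 * m4 + w2 * m5) * (len i)\<^sup>2 / 2)"
    "b (\<tau> (Suc i)) = b (\<tau> i) + w1 * (e (\<tau> i) * len i + (w1 * m4 + w2 * m5) * (len i)\<^sup>2 / 2)"
proof -
  have r: "0 \<le> \<tau> i" "\<tau> i < \<tau> (Suc i)" "\<tau> (Suc i) \<le> T" using arc_range[OF i] by auto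
  have nz: "a t * b t \<noteq> 0" if "t \<in> {\<tau> i<..<\<tau> (Suc i)}" for t
    using dich[OF i] s that unfolding rests_def by blast
  obtain w1 w2 where W: "w1 \<in> {1, -1}" "w2 \<in> {1, -1}"
    "\<And>t. t \<in> {\<tau> i<..<\<tau> (Suc i)} \<Longrightarrow> w1 * a t > 0 \<and> w2 * b t > 0"
    "\<And>t. t \<in> {\<tau> i..\<tau> (Suc i)} \<Longrightarrow> w1 * a t + w2 * b t = H"
    "\<And>t. t \<in> {\<tau> i<..<\<tau> (Suc i)} - N \<Longrightarrow> u t = (w1, w2)"
    "\<And>t. t \<in> {\<tau> i..\<tau> (Suc i)} \<Longrightarrow> e t = e (\<tau> i) + (w1 * m4 + w2 * m5) * (t - \<tau> i)"
    "\<And>t. t \<in> {\<tau> i..\<tau> (Suc i)} \<Longrightarrow> a t = a (\<tau> i) - w2 * (e (\<tau> i) * (t - \<tau> i) + (w1 * m4 + w2 * m5) * (t - \<tau> i)\<^sup>2 / 2)"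
    "\<And>t. t \<in> {\<tau> i..\<tau> (Suc i)} \<Longrightarrow> b t = b (\<tau> i) + w1 * (e (\<tau> i) * (t - \<tau> i) + (w1 * m4 + w2 * m5) * (t - \<tau> i)\<^sup>2 / 2)"
    by (rule edge_interval[OF r nz]) (assumption, blast)
  have ctrl: "ctrl i = (w1, w2)" using ctrl_regular[OF i] W(5) by auto
  show thesis
  proof (rule that[OF ctrl W(1,2)])
    show "w1 * a (\<tau> i) + w2 * b (\<tau> i) = H" using W(4) r by simp
    show "u t = ctrl i" if "t \<in> {\<tau> i<..<\<tau> (Suc i)} - N" for t using W(5)[OF that] ctrl by simp
    show "e (\<tau> (Suc i)) = e (\<tau> i) + (w1 * m4 + w2 * m5) * len i"
      unfolding len_def by (rule W(6)) (use r in auto)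
    show "a (\<tau> (Suc i)) = a (\<tau> i) - w2 * (e (\<tau> i) * len i + (w1 * m4 + w2 * m5) * (len i)\<^sup>2 / 2)"
      unfolding len_def by (rule W(7)) (use r in auto)
    show "b (\<tau> (Suc i)) = b (\<tau> i) + w1 * (e (\<tau> i) * len i + (w1 * m4 + w2 * m5) * (len i)\<^sup>2 / 2)"
      unfolding len_def by (rule W(8)) (use r in auto)
    show "w1 * (a (\<tau> i) - w2 * (e (\<tau> i) * s + (w1 * m4 + w2 * m5) * s\<^sup>2 / 2)) > 0
       \<and> w2 * (b (\<tau> i) + w1 * (e (\<tau> i) * s + (w1 * m4 + w2 * m5) * s\<^sup>2 / 2)) > 0" if "s \<in> {0<..<len i}" for s
      using W(3)[of "\<tau> i + s"] W(7)[of "\<tau> i + s"] W(8)[of "\<tau> i + s"] that by (simp add: len_def)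
  qed
qed

lemma arc_control: "i < n \<Longrightarrow> t \<in> {\<tau> i<..<\<tau> (Suc i)} - N \<Longrightarrow> u t = ctrl i"
  using rest_arc(10) edge_arc by (cases "rests i") metis+

lemma arc_flow: "i < n \<Longrightarrow> q (\<tau> (Suc i)) = flow (len i, ctrl i) (q (\<tau> i))"
proof -
  assume i: "i < n"
  have r: "0 \<le> \<tau> i" "\<tau> i < \<tau> (Suc i)" "\<tau> (Suc i) \<le> T" using arc_range[OF i] by auto
  note s = subinterval[OF r(1,3)]
  show ?thesis
    unfolding len_def
  proof (rule flow_unique[OF s(1) N])
    show "(q has_vector_derivative (fst (ctrl i) *\<^sub>R X1 (q t) + snd (ctrl i) *\<^sub>R X2 (q t))) (at t within {\<tau> i..\<tau> (Suc i)})"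
      if t: "t \<in> {\<tau> i<..<\<tau> (Suc i)} - N" for t
      using s(8)[OF t] arc_control[OF i t] by simp
  qed (use r in auto)
qed

lemma word_run: "k \<le> n \<Longrightarrow> run (map (\<lambda>i. (len i, ctrl i)) [0..<k]) (q 0) = q (\<tau> k)"
  by (induction k) (auto simp: arc_flow node_ends)

lemma word_dur: "k \<le> n \<Longrightarrow> dur (map (\<lambda>i. (len i, ctrl i)) [0..<k]) = \<tau> k"
proof (induction k)
  case (Suc k)
  then show ?case using node_less[of k] by (auto simp: dur_def len_def)
qed (simp add: dur_def node_ends)

lemma few_switchings:
  assumes "n \<le> 14" shows "at_most_switchings T u 13"
proof -
  \<comment> \<open>The default \<open>0\<close> is taken at nodes only, a null set inside
    \<open>{0..T}\<close>; interior discontinuities of \<open>v\<close> lie among the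
    \<open>n - 1\<close> interior nodes.\<close>
  define v where "v t = (if \<exists>i<n. t \<in> {\<tau> i<..<\<tau> (Suc i)} then ctrl (SOME i. i < n \<and> t \<in> {\<tau> i<..<\<tau> (Suc i)}) else 0)" for t
  have uniq: "i = j" if "i < n" "j < n" "t \<in> {\<tau> i<..<\<tau> (Suc i)}" "t \<in> {\<tau> j<..<\<tau> (Suc j)}" for i j t
  proof (rule ccontr)
    assume "i \<noteq> j"
    then have "Suc i \<le> j \<or> Suc j \<le> i" by linarith
    then show False using node_mono[of "Suc i" j] node_mono[of "Suc j" i] that by auto
  qed
  have v: "v t = ctrl i" if i: "i < n" "t \<in> {\<tau> i<..<\<tau> (Suc i)}" for t i
  proof -
    have "(SOME i. i < n \<and> t \<in> {\<tau> i<..<\<tau> (Suc i)}) = i"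
      by (rule some_equality) (use i uniq in blast)+
    then show ?thesis using i by (auto simp: v_def)
  qed
  have cover: "\<exists>i<n. t \<in> {\<tau> i<..<\<tau> (Suc i)}" if t: "t \<in> {0<..<T}" "t \<notin> \<tau> ` {1..<n}" for t
  proof -
    define k where "k = (LEAST k. t < \<tau> k)"
    have k: "t < \<tau> k" "k \<le> n" unfolding k_def using t node_ends by (auto intro: LeastI Least_le)
    then have "k \<noteq> 0" using t node_ends by (cases k) auto
    then obtain i where i: "k = Suc i" by (cases k) auto
    then have "\<tau> i \<le> t" using not_less_Least[of i "\<lambda>k. t < \<tau> k"] by (simp add: k_def)
    moreover have "\<tau> i \<noteq> t" using t k i node_ends by (cases i) auto
    ultimately show ?thesis using k i by (intro exI[of _ i]) auto
  qed
  have "switchings T v \<subseteq> \<tau> ` {1..<n}"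
  proof
    fix t assume t: "t \<in> switchings T v"
    show "t \<in> \<tau> ` {1..<n}"
    proof (rule ccontr)
      assume "t \<notin> \<tau> ` {1..<n}"
      then obtain i where i: "i < n" "t \<in> {\<tau> i<..<\<tau> (Suc i)}" using cover[of t] t by (auto simp: switchings_def)
      have "continuous_on {\<tau> i<..<\<tau> (Suc i)} v"
        by (subst continuous_on_cong[OF refl v[OF i(1)]]) auto
      then have "isCont v t" using i(2) continuous_on_eq_continuous_at[of "{\<tau> i<..<\<tau> (Suc i)}" v] by auto
      then show False using t by (simp add: switchings_def)
    qed
  qed
  moreover have "card (\<tau> ` {1..<n}) \<le> 13"
    using card_image_le[of "{1..<n}" \<tau>] assms by simp
  ultimately have "finite (switchings T v)" "card (switchings T v) \<le> 13"
    by (meson finite_atLeastLessThan finite_imageI finite_subset, meson card_mono finite_atLeastLessThan finite_imageI order_trans)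
  moreover have "piecewise_constant T v"
    unfolding piecewise_constant_def
    by (rule exI[of _ n], rule exI[of _ \<tau>]) (use sub v in \<open>auto simp: constant_on_def\<close>)
  moreover have "AE t in lebesgue_on {0..T}. v t = u t"
  proof (subst AE_lebesgue_on_iff)
    show "\<exists>M. negligible M \<and> (\<forall>t\<in>{0..T} - M. v t = u t)"
    proof (intro exI[of _ "N \<union> insert 0 (insert T (\<tau> ` {1..<n}))"] conjI ballI)
      show "negligible (N \<union> insert 0 (insert T (\<tau> ` {1..<n})))"
        using N by (simp add: negligible_finite)
      fix t assume t: "t \<in> {0..T} - (N \<union> insert 0 (insert T (\<tau> ` {1..<n})))"
      then obtain i where i: "i < n" "t \<in> {\<tau> i<..<\<tau> (Suc i)}" using cover[of t] by auto
      then show "v t = u t" using v[OF i] arc_control[OF i(1), of t] t by auto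
    qed
  qed simp
  ultimately show ?thesis unfolding at_most_switchings_def by blast
qed

lemma partition_bound:
  assumes opt: "optimal T q u" shows "n \<le> 14"
proof -
  obtain i0 where i0: "i0 < n" "rests i0" using ex(1) by (auto simp: rests_def)
  obtain k0 where k0: "k0 < n" "\<not> rests k0"
  proof -
    obtain k where "k < n" "\<forall>t\<in>{\<tau> k<..<\<tau> (Suc k)}. a t * b t \<noteq> 0" using ex(2) by blast
    moreover from this have "(\<tau> k + \<tau> (Suc k)) / 2 \<in> {\<tau> k<..<\<tau> (Suc k)}" using node_less[of k] by simp
    ultimately show thesis using that[of k] unfolding rests_def by blast
  qed
  have n2: "n \<ge> 2" using i0 k0 by (cases "i0 = k0") auto
  note s0 = rest_arc[OF i0]
  have n0: "\<bar>a (\<tau> i0)\<bar> + \<bar>b (\<tau> i0)\<bar> = H" using norm node_range i0 by simp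
  \<comment> \<open>\<open>G = (g1, g2)\<close> and \<open>K = (g2, - g1)\<close> are the ends of
    the side of the control square on which the maximum is attained during the singular arc
    \<open>i0\<close>. There \<open>(h1, h2)\<close> equals \<open>h\<close> times
    \<open>G + K\<close>, that is, \<open>X = Y = h\<close>.\<close>
  define g1 where "g1 = (a (\<tau> i0) - b (\<tau> i0)) / H"
  define g2 where "g2 = (a (\<tau> i0) + b (\<tau> i0)) / H"
  have at: "(a (\<tau> i0) = 0 \<and> (b (\<tau> i0) = H \<or> b (\<tau> i0) = - H)) \<or> (b (\<tau> i0) = 0 \<and> (a (\<tau> i0) = H \<or> a (\<tau> i0) = - H))"
    using n0 s0(5) by (auto simp: abs_if split: if_splits)
  then have g: "g1 \<in> {1, -1}" "g2 \<in> {1, -1}" using H by (auto simp: g1_def g2_def)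
  have gg: "g1 * g1 = 1" "g2 * g2 = 1" using g by auto
  define h P Q where hPQ: "h = H / 2" "P = g1 * m4 + g2 * m5" "Q = g1 * m5 - g2 * m4"
  define X Y C where XYC: "X = (\<lambda>i. (a (\<tau> i) * g1 + b (\<tau> i) * g2) / 2)"
    "Y = (\<lambda>i. (a (\<tau> i) * g2 - b (\<tau> i) * g1) / 2)" "C = (\<lambda>i. e (\<tau> i))"
  define c where "c = (\<lambda>i. ((fst (ctrl i) * g1 + snd (ctrl i) * g2) / 2, (fst (ctrl i) * g2 - snd (ctrl i) * g1) / 2))"
  have h: "h > 0" using H by (simp add: hPQ)
  have X0: "X i0 = h" "Y i0 = h" "C i0 = 0"
  proof -
    have "X i0 = (a (\<tau> i0) * a (\<tau> i0) + b (\<tau> i0) * b (\<tau> i0)) / H / 2"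
      "Y i0 = (a (\<tau> i0) * a (\<tau> i0) + b (\<tau> i0) * b (\<tau> i0)) / H / 2"
      unfolding XYC g1_def g2_def using H by (simp_all add: field_simps)
    moreover have "a (\<tau> i0) * a (\<tau> i0) + b (\<tau> i0) * b (\<tau> i0) = H * H" using at by auto
    ultimately show "X i0 = h" "Y i0 = h" using H by (simp_all add: hPQ)
    show "C i0 = 0" using s0(3) by (simp add: XYC)
  qed
  have force: "fst (c i) * P - snd (c i) * Q = fst (ctrl i) * m4 + snd (ctrl i) * m5" for i
  proof -
    have "2 * (fst (c i) * P - snd (c i) * Q) = fst (ctrl i) * m4 * (g1 * g1 + g2 * g2) + snd (ctrl i) * m5 * (g1 * g1 + g2 * g2)"
      unfolding c_def hPQ by (simp add: field_simps)
    then show ?thesis by (simp add: gg)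
  qed
  have pairing: "fst (c i) * X i + snd (c i) * Y i = (fst (ctrl i) * a (\<tau> i) + snd (ctrl i) * b (\<tau> i)) / 2" for i
  proof -
    have "4 * (fst (c i) * X i + snd (c i) * Y i)
      = fst (ctrl i) * a (\<tau> i) * (g1 * g1 + g2 * g2) + snd (ctrl i) * b (\<tau> i) * (g1 * g1 + g2 * g2)"
      unfolding c_def XYC by (simp add: field_simps)
    then show ?thesis by (simp add: gg)
  qed
  have corner: "\<bar>X i\<bar> = h \<and> \<bar>Y i\<bar> = h" if "i \<le> n" "a (\<tau> i) * b (\<tau> i) = 0" for i
  proof -
    have "\<bar>a (\<tau> i)\<bar> + \<bar>b (\<tau> i)\<bar> = H" using norm node_range that by simp
    then show ?thesis using that(2) g unfolding XYC hPQ by (auto simp: abs_if split: if_splits)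
  qed
  have vert: "\<bar>X i\<bar> = h \<and> \<bar>Y i\<bar> = h" if "0 < i" "i < n" for i
    using corner[of i] nodes[of i] that by simp
  have box: "\<bar>X i\<bar> \<le> h \<and> \<bar>Y i\<bar> \<le> h" if "i \<le> n" for i
  proof -
    have "\<bar>a (\<tau> i)\<bar> + \<bar>b (\<tau> i)\<bar> = H" using norm node_range that by simp
    moreover have "\<bar>X i\<bar> \<le> (\<bar>a (\<tau> i)\<bar> + \<bar>b (\<tau> i)\<bar>) / 2" "\<bar>Y i\<bar> \<le> (\<bar>a (\<tau> i)\<bar> + \<bar>b (\<tau> i)\<bar>) / 2"
      using abs_triangle_ineq[of "a (\<tau> i) * g1" "b (\<tau> i) * g2"]
        abs_triangle_ineq4[of "a (\<tau> i) * g2" "b (\<tau> i) * g1"] g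
      by (auto simp: XYC abs_mult)
    ultimately show ?thesis by (simp add: hPQ)
  qed
  have sing: "C i = 0 \<and> C (Suc i) = 0 \<and> X (Suc i) = X i \<and> Y (Suc i) = Y i
          \<and> \<bar>X i\<bar> = h \<and> \<bar>Y i\<bar> = h \<and> fst (c i) * P = snd (c i) * Q \<and> fst (c i) * X i + snd (c i) * Y i = h"
    if "i < n" "rests i" for i
    using rest_arc[OF that] corner[of i] force[of i] pairing[of i] that by (simp add: XYC hPQ)
  have edge: "c i \<in> {(1, 0), (0, -1), (-1, 0), (0, 1)}
          \<and> fst (c i) * X i + snd (c i) * Y i = h
          \<and> (\<forall>s\<in>{0<..<len i}. \<bar>fst (c i) * Y i - snd (c i) * X i
                - (C i * s + (fst (c i) * P - snd (c i) * Q) * s\<^sup>2 / 2)\<bar> < h)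
          \<and> X (Suc i) = X i + snd (c i) * (C i * len i + (fst (c i) * P - snd (c i) * Q) * (len i)\<^sup>2 / 2)
          \<and> Y (Suc i) = Y i - fst (c i) * (C i * len i + (fst (c i) * P - snd (c i) * Q) * (len i)\<^sup>2 / 2)
          \<and> C (Suc i) = C i + (fst (c i) * P - snd (c i) * Q) * len i"
    if i: "i < n" "\<not> rests i" for i
  proof -
    obtain w1 w2 where W: "ctrl i = (w1, w2)" "w1 \<in> {1, -1}" "w2 \<in> {1, -1}"
      "w1 * a (\<tau> i) + w2 * b (\<tau> i) = H"
      "\<And>t. t \<in> {\<tau> i<..<\<tau> (Suc i)} - N \<Longrightarrow> u t = ctrl i"
      "\<And>s. s \<in> {0<..<len i} \<Longrightarrow> w1 * (a (\<tau> i) - w2 * (e (\<tau> i) * s + (w1 * m4 + w2 * m5) * s\<^sup>2 / 2)) > 0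
         \<and> w2 * (b (\<tau> i) + w1 * (e (\<tau> i) * s + (w1 * m4 + w2 * m5) * s\<^sup>2 / 2)) > 0"
      "e (\<tau> (Suc i)) = e (\<tau> i) + (w1 * m4 + w2 * m5) * len i"
      "a (\<tau> (Suc i)) = a (\<tau> i) - w2 * (e (\<tau> i) * len i + (w1 * m4 + w2 * m5) * (len i)\<^sup>2 / 2)"
      "b (\<tau> (Suc i)) = b (\<tau> i) + w1 * (e (\<tau> i) * len i + (w1 * m4 + w2 * m5) * (len i)\<^sup>2 / 2)"
      by (rule edge_arc[OF i]) blast
    define F where "F = w1 * m4 + w2 * m5"
    define \<phi> where "\<phi> = (\<lambda>s. e (\<tau> i) * s + F * s\<^sup>2 / 2)"
    have Fc: "fst (c i) * P - snd (c i) * Q = F" using force[of i] W(1) by (simp add: F_def)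
    have W': "\<And>s. s \<in> {0<..<len i} \<Longrightarrow> w1 * (a (\<tau> i) - w2 * \<phi> s) > 0 \<and> w2 * (b (\<tau> i) + w1 * \<phi> s) > 0"
      "e (\<tau> (Suc i)) = e (\<tau> i) + F * len i"
      "a (\<tau> (Suc i)) = a (\<tau> i) - w2 * \<phi> (len i)" "b (\<tau> (Suc i)) = b (\<tau> i) + w1 * \<phi> (len i)"
      using W(6-9) by (simp_all add: F_def \<phi>_def)
    have c: "c i = ((w1 * g1 + w2 * g2) / 2, (w1 * g2 - w2 * g1) / 2)" by (simp add: c_def W(1))
    have axis: "c i \<in> {(1, 0), (0, -1), (-1, 0), (0, 1)}" using W(2,3) g by (auto simp: c)
    have Z: "fst (c i) * Y i - snd (c i) * X i = (w2 * a (\<tau> i) - w1 * b (\<tau> i)) / 2"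
      using W(2,3) g by (auto simp: c XYC field_simps)
    have small: "\<bar>(w2 * a (\<tau> i) - w1 * b (\<tau> i)) / 2 - \<phi> s\<bar> < h" if "s \<in> {0<..<len i}" for s
      using W'(1)[OF that] W(2-4) unfolding hPQ abs_less_iff by (auto simp: field_simps)
    have "X (Suc i) = X i + snd (c i) * \<phi> (len i)" "Y (Suc i) = Y i - fst (c i) * \<phi> (len i)"
      unfolding XYC c W'(3,4) by (simp_all add: field_simps)
    moreover have "fst (c i) * X i + snd (c i) * Y i = h" using pairing[of i] W(1,4) by (simp add: hPQ)
    ultimately show ?thesis
      unfolding Fc Z using axis small W'(2) by (simp add: \<phi>_def XYC)
  qed
  \<comment> \<open>The energy is conserved along every arc and vanishes at \<open>i0\<close>, which
    places the whole extremal on the separatrix.\<close>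
  define E where "E = (\<lambda>i. (C i)\<^sup>2 - 2 * (P * (h - Y i) + Q * (h - X i)))"
  have Estep: "E (Suc i) = E i" if "i < n" for i
  proof (cases "rests i")
    case True then show ?thesis using sing[OF that] by (simp add: E_def)
  next
    case False
    define F where "F = fst (c i) * P - snd (c i) * Q"
    define \<phi> where "\<phi> = C i * len i + F * (len i)\<^sup>2 / 2"
    have eqs: "X (Suc i) = X i + snd (c i) * \<phi>" "Y (Suc i) = Y i - fst (c i) * \<phi>" "C (Suc i) = C i + F * len i"
      using edge[OF that False] by (simp_all add: F_def \<phi>_def)
    have sq: "(C i + F * len i)\<^sup>2 = (C i)\<^sup>2 + 2 * F * \<phi>"
      by (simp add: \<phi>_def power2_eq_square field_simps)
    have "E (Suc i) = E i + 2 * (F - (fst (c i) * P - snd (c i) * Q)) * \<phi>"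
      unfolding E_def eqs sq by (simp add: algebra_simps)
    then show ?thesis by (simp add: F_def)
  qed
  have EC: "E i = E 0" if "i \<le> n" for i using that by (induction i) (auto simp: Estep)
  have E0: "E i = E i0" if "i \<le> n" for i using EC[OF that] EC[of i0] i0 by linarith
  have energy: "(C i)\<^sup>2 = 2 * (P * (h - Y i) + Q * (h - X i))" if "i \<le> n" for i
    using E0[OF that] X0 by (simp add: E_def)
  have nPQ: "P \<noteq> 0 \<or> Q \<noteq> 0"
  proof (rule ccontr)
    assume "\<not> ?thesis"
    then have "P = 0" "Q = 0" by auto
    have "g1 * P - g2 * Q = (g1 * g1 + g2 * g2) * m4" "g2 * P + g1 * Q = (g1 * g1 + g2 * g2) * m5"
      by (simp_all add: hPQ algebra_simps)
    then show False using m gg \<open>P = 0\<close> \<open>Q = 0\<close> by auto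
  qed
  have c0: "fst (c i0) + snd (c i0) = 1" "fst (c i0) \<ge> 0" "snd (c i0) \<ge> 0" "fst (c i0) * P = snd (c i0) * Q"
  proof -
    show "fst (c i0) * P = snd (c i0) * Q" using sing[OF i0] by simp
    have "(fst (c i0) + snd (c i0)) * h = 1 * h" using sing[OF i0] X0 by (simp add: algebra_simps)
    then show s: "fst (c i0) + snd (c i0) = 1" using h by (metis less_irrefl mult_right_cancel)
    have "\<bar>fst (c i0)\<bar> \<le> 1 \<and> \<bar>snd (c i0)\<bar> \<le> 1"
      using s0(8,9) g by (auto simp: c_def abs_le_iff)
    then show "fst (c i0) \<ge> 0" "snd (c i0) \<ge> 0" using s by auto
  qed
  \<comment> \<open>The singular control is a convex combination balancing \<open>P\<close> against
    \<open>Q\<close>, so they cannot have opposite signs. Were both nonpositive, the energy relation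
    would keep \<open>C\<close> at zero and the bang arc \<open>k0\<close> could not move along its
    side.\<close>
  have PQ: "P \<ge> 0 \<and> Q \<ge> 0"
  proof (rule ccontr)
    assume neg: "\<not> ?thesis"
    have "P \<le> 0 \<and> Q \<le> 0"
    proof -
      have "\<not> (p < 0 \<and> q > 0)" if "x * p = y * q" "x \<ge> 0" "y \<ge> 0" "x + y = 1" for x y p q :: real
      proof
        assume pq: "p < 0 \<and> q > 0"
        then have "x * p \<le> 0" "y * q \<ge> 0"
          using mult_nonneg_nonpos[of x p] mult_nonneg_nonneg[of y q] that by linarith+
        then have "x * p = 0" "y * q = 0" using that(1) by linarith+
        then show False using pq that by auto
      qed
      from this[of "fst (c i0)" P "snd (c i0)" Q] this[of "snd (c i0)" Q "fst (c i0)" P]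
      have "\<not> (P < 0 \<and> Q > 0)" "\<not> (Q < 0 \<and> P > 0)" using c0 by auto
      then show ?thesis using neg by linarith
    qed
    then have zero: "C i = 0" if "i \<le> n" for i
    proof -
      have "P * (h - Y i) \<le> 0" "Q * (h - X i) \<le> 0"
        using \<open>P \<le> 0 \<and> Q \<le> 0\<close> box[OF that] by (auto intro: mult_nonpos_nonneg)
      then have "(C i)\<^sup>2 \<le> 0" using energy[OF that] by simp
      then show ?thesis by simp
    qed
    note ed = edge[OF k0]
    have lk: "len k0 > 0" using node_less k0 by (simp add: len_def)
    have F0: "fst (c k0) * P - snd (c k0) * Q = 0"
      using ed zero[of k0] zero[of "Suc k0"] k0 lk by auto
    have "len k0 / 2 \<in> {0<..<len k0}" using lk by simp
    then have "\<bar>fst (c k0) * Y k0 - snd (c k0) * X k0 - (C k0 * (len k0 / 2) + 0 * (len k0 / 2)\<^sup>2 / 2)\<bar> < h"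
      using ed[unfolded F0] by blast
    then have "\<bar>fst (c k0) * Y k0 - snd (c k0) * X k0\<bar> < h" using zero[of k0] k0 by simp
    moreover have "X (Suc k0) = X k0" "Y (Suc k0) = Y k0" using ed[unfolded F0] zero[of k0] k0 by auto
    moreover have "\<bar>X k0\<bar> = h \<and> \<bar>Y k0\<bar> = h \<or> \<bar>X (Suc k0)\<bar> = h \<and> \<bar>Y (Suc k0)\<bar> = h"
      using vert[of k0] vert[of "Suc k0"] k0 n2 by (cases "k0 = 0") auto
    ultimately show False using ed by auto
  qed
  interpret ch: chain n P Q h len X Y C c rests
  proof unfold_locales
    show "h > 0" "P \<ge> 0" "Q \<ge> 0" "P + Q > 0" "n \<ge> 2" using h PQ nPQ n2 by auto
    show "len i > 0" if "i < n" for i using node_less[OF that] by (simp add: len_def)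
    show "Suc i < n \<Longrightarrow> rests i \<Longrightarrow> \<not> rests (Suc i)" for i using adj[of i] by (auto simp: rests_def)
    show "i \<le> n \<Longrightarrow> \<bar>X i\<bar> \<le> h" "i \<le> n \<Longrightarrow> \<bar>Y i\<bar> \<le> h" for i using box[of i] by auto
  qed (fact vert energy sing edge)+
  interpret sw: chain n Q P h len Y X "\<lambda>i. - C i" "\<lambda>i. (snd (c i), fst (c i))" rests by (rule ch.swap)
  have comb: "comb (g1, g2) (g2, - g1) (c i) = ctrl i" for i
  proof -
    have "fst (c i) * g1 + snd (c i) * g2 = fst (ctrl i) * (g1 * g1 + g2 * g2) / 2"
      "fst (c i) * g2 - snd (c i) * g1 = snd (ctrl i) * (g1 * g1 + g2 * g2) / 2"
      by (simp_all add: c_def field_simps)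
    then show ?thesis by (simp add: comb_def prod_eq_iff gg)
  qed
  have ell: "\<bar>fst (c i)\<bar> + \<bar>snd (c i)\<bar> \<le> 1" if "i < n" for i
  proof (cases "rests i")
    case True
    have "\<bar>(x + y) / 2\<bar> + \<bar>(x - y) / 2\<bar> \<le> 1" if "\<bar>x\<bar> \<le> 1" "\<bar>y\<bar> \<le> 1" for x y :: real
      using that by (auto simp: abs_le_iff abs_if field_simps)
    from this[of "fst (ctrl i) * g1" "snd (ctrl i) * g2"] this[of "fst (ctrl i) * g2" "snd (ctrl i) * g1"]
    have "\<bar>(fst (ctrl i) * g1 + snd (ctrl i) * g2) / 2\<bar> + \<bar>(fst (ctrl i) * g1 - snd (ctrl i) * g2) / 2\<bar> \<le> 1"
      using rest_arc(8,9)[OF that True] g by (auto simp: abs_mult)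
    moreover have "\<bar>fst (ctrl i) * g1 - snd (ctrl i) * g2\<bar> = \<bar>fst (ctrl i) * g2 - snd (ctrl i) * g1\<bar>"
      using g by (auto simp: abs_minus_commute)
    ultimately show ?thesis by (simp add: c_def)
  next
    case False
    then show ?thesis using edge[OF that False] by auto
  qed
  have ell1: "ell1 (ch.seg 0 n)" "ell1 (sw.seg 0 n)" using ell by (simp_all add: ell1_def case_prod_beta add.commute)
  have l1: "in_frame (g1, g2) (g2, - g1) (ch.seg 0 n) = map (\<lambda>i. (len i, ctrl i)) [0..<n]"
    by (simp add: in_frame_def comb)
  have l2: "in_frame (g2, - g1) (g1, g2) (sw.seg 0 n) = map (\<lambda>i. (len i, ctrl i)) [0..<n]"
    using comb by (simp add: in_frame_def comb_def add.commute)
  have du: "dur (ch.seg 0 n) = T" "dur (sw.seg 0 n) = T"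
    using word_dur[of n] node_ends by (simp_all add: dur_def o_def)
  have bounds: "\<bar>g1\<bar> \<le> 1" "\<bar>g2\<bar> \<le> 1" using g by auto
  have short: "shortest (ch.seg 0 n)" "shortest (sw.seg 0 n)"
  proof -
    show "shortest (ch.seg 0 n)"
      by (rule optimal_shortest_word[of T q u "(g1, g2)" "(g2, - g1)", OF opt _ du(1)])
         (use l1 word_run[of n] bounds in \<open>simp_all add: node_ends\<close>)
    show "shortest (sw.seg 0 n)"
      by (rule optimal_shortest_word[of T q u "(g2, - g1)" "(g1, g2)", OF opt _ du(2)])
         (use l2 word_run[of n] bounds in \<open>simp_all add: node_ends\<close>)
  qed
  \<comment> \<open>\<open>P = 0\<close> is the flat case with the frame vectors exchanged, for
    which the second word was prepared.\<close>
  consider "P > 0" "Q > 0" | "Q = 0" | "P = 0" using PQ by linarith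
  then show ?thesis
  proof cases
    case 1 then show ?thesis using ch.generic_bound short ell1 by blast
  next
    case 2 then show ?thesis using ch.flat_bound short ell1 i0 by blast
  next
    case 3 then show ?thesis using sw.flat_bound short ell1 i0 by blast
  qed
qed

end

text \<open>Each Hamiltonian is a polynomial in the base coordinates and the components of the
  covector, all Lipschitz on a compact interval.\<close>

lemma lip_hamil:
  assumes "lip a b lam"
  shows "lip a b (\<lambda>t. h1 (lam t))" "lip a b (\<lambda>t. h2 (lam t))" "lip a b (\<lambda>t. h3 (lam t))"
    "lip a b (\<lambda>t. h4 (lam t))" "lip a b (\<lambda>t. h5 (lam t))"
proof -
  have L: "lip a b (\<lambda>t. blinfun_apply (snd (lam t)) p)" for p
    by (rule lip_bounded_linear[OF bounded_linear_compose[OF blinfun.bounded_linear_left bounded_linear_snd] assms])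
  define x where "x = (\<lambda>t. fst (fst (lam t)))"
  define y where "y = (\<lambda>t. fst (snd (fst (lam t))))"
  have xy: "lip a b x" "lip a b y" unfolding x_def y_def by (intro lip_fst lip_snd assms)+
  define E where "E = (\<lambda>i t. blinfun_apply (snd (lam t))
     (([(1, 0, 0, 0, 0), (0, 1, 0, 0, 0), (0, 0, 1, 0, 0), (0, 0, 0, 1, 0), (0, 0, 0, 0, 1)] :: point list) ! i))"
  have E: "lip a b (E i)" for i unfolding E_def by (rule L)
  have 1: "X1 (fst (lam t)) = (1, 0, 0, 0, 0) + (- y t / 2) *\<^sub>R (0, 0, 1, 0, 0)
      + (- ((x t)\<^sup>2 + (y t)\<^sup>2) / 2) *\<^sub>R (0, 0, 0, 0, 1)"
    and 2: "X2 (fst (lam t)) = (0, 1, 0, 0, 0) + (x t / 2) *\<^sub>R (0, 0, 1, 0, 0)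
      + (((x t)\<^sup>2 + (y t)\<^sup>2) / 2) *\<^sub>R (0, 0, 0, 1, 0)"
    and 3: "X3 (fst (lam t)) = (0, 0, 1, 0, 0) + x t *\<^sub>R (0, 0, 0, 1, 0) + y t *\<^sub>R (0, 0, 0, 0, 1)"
    and 4: "X4 (fst (lam t)) = (0, 0, 0, 1, 0)" and 5: "X5 (fst (lam t)) = (0, 0, 0, 0, 1)" for t
    by (cases "fst (lam t)"; simp add: x_def y_def X1_def X2_def X3_def X4_def X5_def)+
  have h: "h1 (lam t) = E 0 t + (- y t / 2) * E 2 t + (- ((x t)\<^sup>2 + (y t)\<^sup>2) / 2) * E 4 t"
    "h2 (lam t) = E 1 t + (x t / 2) * E 2 t + (((x t)\<^sup>2 + (y t)\<^sup>2) / 2) * E 3 t"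
    "h3 (lam t) = E 2 t + x t * E 3 t + y t * E 4 t" "h4 (lam t) = E 3 t" "h5 (lam t) = E 4 t" for t
    unfolding hamil_def 1 2 3 4 5 blinfun.add_right blinfun.scaleR_right E_def by simp_all
  show "lip a b (\<lambda>t. h1 (lam t))" "lip a b (\<lambda>t. h2 (lam t))" "lip a b (\<lambda>t. h3 (lam t))"
    "lip a b (\<lambda>t. h4 (lam t))" "lip a b (\<lambda>t. h5 (lam t))"
    unfolding h by (intro lip_add lip_mult lip_divide lip_minus lip_power xy E)+
qed

text \<open>Without force \<open>e\<close> is constant, and it vanishes on the singular interval;
  then \<open>a\<close> and \<open>b\<close> are constant, and their product cannot vanish at one
  time only.\<close>

lemma (in extremal_arc) force_nonzero:
  assumes sing: "0 \<le> \<alpha>" "\<alpha> < \<beta>" "\<beta> \<le> T" "\<And>t. t \<in> {\<alpha>..\<beta>} \<Longrightarrow> a t * b t = 0"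
    and t: "t \<in> {0..T}" "a t * b t \<noteq> 0"
  shows "m4 \<noteq> 0 \<or> m5 \<noteq> 0"
proof (rule ccontr)
  assume "\<not> ?thesis"
  then have m: "m4 = 0" "m5 = 0" by auto
  note const = lip_zero_deriv_const[OF _ N]
  have e: "e t = e 0" if "t \<in> {0..T}" for t
  proof (rule const[OF lips(4) _ that])
    show "(e has_real_derivative 0) (at t within {0..T})" if "t \<in> {0..T} - N" for t
      using deriv(3)[OF that] m by simp
  qed
  have "e \<alpha> = 0" by (rule singular_interval(3)[OF sing(1-3)]) (use sing in auto)
  then have e0: "e t = 0" if "t \<in> {0..T}" for t using e[OF that] e[of \<alpha>] sing by simp
  have "a t = a 0" "b t = b 0" if t: "t \<in> {0..T}" for t
  proof -
    show "a t = a 0"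
    proof (rule const[OF lips(2) _ t])
      show "(a has_real_derivative 0) (at t within {0..T})" if "t \<in> {0..T} - N" for t
        using deriv(1)[OF that] e0[of t] that by simp
    qed
    show "b t = b 0"
    proof (rule const[OF lips(3) _ t])
      show "(b has_real_derivative 0) (at t within {0..T})" if "t \<in> {0..T} - N" for t
        using deriv(2)[OF that] e0[of t] that by simp
    qed
  qed
  from this[of \<alpha>] this[OF t(1)] show False using sing(4)[of \<alpha>] t(2) sing(1-3) by auto
qed

theorem theorem8:
  fixes T :: real
    and q :: "real \<Rightarrow> point"
    and u :: "real \<Rightarrow> real \<times> real"
    and lam :: "real \<Rightarrow> covector"
  assumes "normal_extremal T q u lam"
    and "mixed T lam"
    and "optimal T q u"
  shows "at_most_switchings T u 13"
proof -
  have T: "T > 0"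
  proof -
    obtain n \<tau> where s: "subdivision T n \<tau>" "n > 0" using assms(2) by (auto simp: mixed_def)
    then have "\<tau> 0 < \<tau> k" if "0 < k" "k \<le> n" for k
      using that
    proof (induction k)
      case (Suc k)
      then have "\<tau> k < \<tau> (Suc k)" by (simp add: subdivision_def)
      then show ?case using Suc by (cases "k = 0") auto
    qed simp
    from this[of n] show ?thesis using s by (simp add: subdivision_def)
  qed
  have traj: "trajectory T q u" and base: "\<And>t. t \<in> {0..T} \<Longrightarrow> fst (lam t) = q t" and lip: "lip 0 T lam"
    using assms(1) by (auto simp: normal_extremal_def lip_def)
  define C where "C = (\<lambda>t. (q has_vector_derivative (fst (u t) *\<^sub>R X1 (q t) + snd (u t) *\<^sub>R X2 (q t))) (at t within {0..T}))"
  define D where "D = (\<lambda>H t. ((\<lambda>s. h1 (lam s)) has_real_derivative - snd (u t) * h3 (lam t)) (at t within {0..T}) \<and>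
       ((\<lambda>s. h2 (lam s)) has_real_derivative fst (u t) * h3 (lam t)) (at t within {0..T}) \<and>
       ((\<lambda>s. h3 (lam s)) has_real_derivative
          fst (u t) * h4 (lam t) + snd (u t) * h5 (lam t)) (at t within {0..T}) \<and>
       ((\<lambda>s. h4 (lam s)) has_real_derivative 0) (at t within {0..T}) \<and>
       ((\<lambda>s. h5 (lam s)) has_real_derivative 0) (at t within {0..T}) \<and>
       fst (u t) * h1 (lam t) + snd (u t) * h2 (lam t) = \<bar>h1 (lam t)\<bar> + \<bar>h2 (lam t)\<bar> \<and>
       \<bar>h1 (lam t)\<bar> + \<bar>h2 (lam t)\<bar> = H)"
  obtain H where H: "H > 0" "AE t in lebesgue_on {0..T}. D H t"
    using assms(1) unfolding normal_extremal_def D_def by blast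
  have "AE t in lebesgue_on {0..T}. C t" using traj by (simp add: trajectory_def C_def)
  with H(2) have "AE t in lebesgue_on {0..T}. C t \<and> D H t" by eventually_elim simp
  then obtain N where N: "negligible N" "\<And>t. t \<in> {0..T} - N \<Longrightarrow> C t \<and> D H t"
    by (subst (asm) AE_lebesgue_on_iff) auto
  note hl = lip_hamil[OF lip]
  have "lip 0 T (\<lambda>t. fst (lam t))" using lip by (rule lip_fst)
  then obtain L where "L-lipschitz_on {0..T} (\<lambda>t. fst (lam t))" by (auto simp: lip_def)
  then have "L-lipschitz_on {0..T} q" by (rule lipschitz_on_transform) (simp add: base)
  then have lipq: "lip 0 T q" by (auto simp: lip_def)
  have h4: "h4 (lam t) = h4 (lam 0)" and h5: "h5 (lam t) = h5 (lam 0)" if t: "t \<in> {0..T}" for t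
  proof -
    have c: "((\<lambda>s. h4 (lam s)) has_real_derivative 0) (at t within {0..T})"
      "((\<lambda>s. h5 (lam s)) has_real_derivative 0) (at t within {0..T})" if "t \<in> {0..T} - N" for t
      using N(2)[OF that] unfolding D_def by blast+
    show "h4 (lam t) = h4 (lam 0)" by (rule lip_zero_deriv_const[OF hl(4) N(1) _ t]) (rule c(1))
    show "h5 (lam t) = h5 (lam 0)" by (rule lip_zero_deriv_const[OF hl(5) N(1) _ t]) (rule c(2))
  qed
  have norm: "\<bar>h1 (lam t)\<bar> + \<bar>h2 (lam t)\<bar> = H" if "t \<in> {0..T}" for t
  proof -
    have "\<bar>h1 (lam t)\<bar> + \<bar>h2 (lam t)\<bar> - H = 0"
    proof (rule continuous_negligible_zero[OF _ T N(1) _ that])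
      show "continuous_on {0..T} (\<lambda>t. \<bar>h1 (lam t)\<bar> + \<bar>h2 (lam t)\<bar> - H)"
        by (intro continuous_intros lip_imp_continuous hl)
      show "\<bar>h1 (lam t)\<bar> + \<bar>h2 (lam t)\<bar> - H = 0" if "t \<in> {0<..<T} - N" for t
        using N(2)[of t] that by (auto simp: D_def)
    qed
    then show ?thesis by simp
  qed
  interpret extremal_arc T H "h4 (lam 0)" "h5 (lam 0)" q u "\<lambda>t. h1 (lam t)" "\<lambda>t. h2 (lam t)" "\<lambda>t. h3 (lam t)" N
  proof unfold_locales
    show "\<bar>fst (u t)\<bar> \<le> 1" "\<bar>snd (u t)\<bar> \<le> 1" if "t \<in> {0..T}" for t
      using traj that by (auto simp: trajectory_def admissible_control_def)
    fix t assume t: "t \<in> {0..T} - N"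
    then have tT: "t \<in> {0..T}" by simp
    note CD = N(2)[OF t, unfolded C_def D_def h4[OF tT] h5[OF tT]]
    show "((\<lambda>t. h1 (lam t)) has_real_derivative - snd (u t) * h3 (lam t)) (at t within {0..T})"
      "((\<lambda>t. h2 (lam t)) has_real_derivative fst (u t) * h3 (lam t)) (at t within {0..T})"
      "((\<lambda>t. h3 (lam t)) has_real_derivative fst (u t) * h4 (lam 0) + snd (u t) * h5 (lam 0)) (at t within {0..T})"
      "(q has_vector_derivative (fst (u t) *\<^sub>R X1 (q t) + snd (u t) *\<^sub>R X2 (q t))) (at t within {0..T})"
      "fst (u t) * h1 (lam t) + snd (u t) * h2 (lam t) = H"
      using CD by auto
  qed (fact T H(1) N(1) lipq hl(1-3) norm)+
  define Z where "Z = {t \<in> {0..T}. h1 (lam t) * h2 (lam t) = 0}"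
  note zs = mixed_zero_set[OF T lip_imp_continuous[OF hl(1)] lip_imp_continuous[OF hl(2)] assms(2) Z_def]
  obtain \<alpha> \<beta> where ab: "0 \<le> \<alpha>" "\<alpha> < \<beta>" "\<beta> \<le> T" "{\<alpha>..\<beta>} \<subseteq> Z" using zs(3) by blast
  obtain \<alpha>' \<beta>' where ab': "0 \<le> \<alpha>'" "\<alpha>' < \<beta>'" "\<beta>' \<le> T" "finite ({\<alpha>'..\<beta>'} \<inter> Z)" using zs(4) by blast
  have m: "h4 (lam 0) \<noteq> 0 \<or> h5 (lam 0) \<noteq> 0"
  proof -
    have "\<not> {\<alpha>'..\<beta>'} \<subseteq> Z" using ab'(2,4) infinite_Icc[of \<alpha>' \<beta>'] by (metis inf.absorb1)
    then obtain t where "t \<in> {\<alpha>'..\<beta>'}" "t \<notin> Z" by blast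
    then have t: "t \<in> {0..T}" "h1 (lam t) * h2 (lam t) \<noteq> 0" using ab' by (auto simp: Z_def)
    show ?thesis by (rule force_nonzero[OF ab(1-3) _ t]) (use ab(4) in \<open>auto simp: Z_def\<close>)
  qed
  have "Z \<subseteq> {0..T}" by (auto simp: Z_def)
  obtain n \<tau> where s: "subdivision T n \<tau>" "\<And>i. 0 < i \<Longrightarrow> i < n \<Longrightarrow> \<tau> i \<in> Z"
    "\<And>i. i < n \<Longrightarrow> {\<tau> i<..<\<tau> (Suc i)} \<subseteq> Z \<or> {\<tau> i<..<\<tau> (Suc i)} \<inter> Z = {}"
    "\<And>i. Suc i < n \<Longrightarrow> \<not> ({\<tau> i<..<\<tau> (Suc i)} \<subseteq> Z \<and> {\<tau> (Suc i)<..<\<tau> (Suc (Suc i))} \<subseteq> Z)"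
    "\<And>\<alpha> \<beta>. 0 \<le> \<alpha> \<Longrightarrow> \<alpha> < \<beta> \<Longrightarrow> \<beta> \<le> T \<Longrightarrow> {\<alpha>..\<beta>} \<subseteq> Z \<Longrightarrow> \<exists>i<n. {\<tau> i<..<\<tau> (Suc i)} \<subseteq> Z"
    "\<And>\<alpha> \<beta>. 0 \<le> \<alpha> \<Longrightarrow> \<alpha> < \<beta> \<Longrightarrow> \<beta> \<le> T \<Longrightarrow> finite ({\<alpha>..\<beta>} \<inter> Z) \<Longrightarrow> \<exists>i<n. {\<tau> i<..<\<tau> (Suc i)} \<inter> Z = {}"
    by (rule finite_frontier_subdivision[OF T zs(1) \<open>Z \<subseteq> {0..T}\<close> zs(2)]) blast
  have rng: "\<tau> i \<ge> 0 \<and> \<tau> (Suc i) \<le> T" if "i < n" for i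
  proof -
    have mono: "\<tau> i \<le> \<tau> j" if "i \<le> j" "j \<le> n" for i j
      using that
    proof (induction j)
      case (Suc j)
      then have "\<tau> j < \<tau> (Suc j)" using s(1) by (simp add: subdivision_def)
      then show ?case using Suc by (cases "i = Suc j") auto
    qed simp
    show ?thesis using mono[of 0 i] mono[of "Suc i" n] that s(1) by (simp add: subdivision_def)
  qed
  have sg: "(\<forall>t\<in>{\<tau> i<..<\<tau> (Suc i)}. h1 (lam t) * h2 (lam t) = 0) \<longleftrightarrow> {\<tau> i<..<\<tau> (Suc i)} \<subseteq> Z"
    "(\<forall>t\<in>{\<tau> i<..<\<tau> (Suc i)}. h1 (lam t) * h2 (lam t) \<noteq> 0) \<longleftrightarrow> {\<tau> i<..<\<tau> (Suc i)} \<inter> Z = {}" if "i < n" for i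
  proof -
    have "{\<tau> i<..<\<tau> (Suc i)} \<subseteq> {0..T}" using rng[OF that] by auto
    then show "(\<forall>t\<in>{\<tau> i<..<\<tau> (Suc i)}. h1 (lam t) * h2 (lam t) = 0) \<longleftrightarrow> {\<tau> i<..<\<tau> (Suc i)} \<subseteq> Z"
      "(\<forall>t\<in>{\<tau> i<..<\<tau> (Suc i)}. h1 (lam t) * h2 (lam t) \<noteq> 0) \<longleftrightarrow> {\<tau> i<..<\<tau> (Suc i)} \<inter> Z = {}"
      unfolding Z_def by blast+
  qed
  interpret arc_partition T H "h4 (lam 0)" "h5 (lam 0)" q u "\<lambda>t. h1 (lam t)" "\<lambda>t. h2 (lam t)" "\<lambda>t. h3 (lam t)" N n \<tau>
  proof unfold_locales
    show "h1 (lam (\<tau> i)) * h2 (lam (\<tau> i)) = 0" if "0 < i" "i < n" for i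
      using s(2)[OF that] by (simp add: Z_def)
    show "(\<forall>t\<in>{\<tau> i<..<\<tau> (Suc i)}. h1 (lam t) * h2 (lam t) = 0) \<or> (\<forall>t\<in>{\<tau> i<..<\<tau> (Suc i)}. h1 (lam t) * h2 (lam t) \<noteq> 0)"
      if "i < n" for i using s(3)[OF that] unfolding sg[OF that] .
    show "\<not> ((\<forall>t\<in>{\<tau> i<..<\<tau> (Suc i)}. h1 (lam t) * h2 (lam t) = 0) \<and>
         (\<forall>t\<in>{\<tau> (Suc i)<..<\<tau> (Suc (Suc i))}. h1 (lam t) * h2 (lam t) = 0))" if "Suc i < n" for i
      using s(4)[OF that] unfolding sg(1)[OF that] sg(1)[OF Suc_lessD[OF that]] .
    show "\<exists>i<n. \<forall>t\<in>{\<tau> i<..<\<tau> (Suc i)}. h1 (lam t) * h2 (lam t) = 0"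
      using s(5)[OF ab] sg(1) by blast
    show "\<exists>i<n. \<forall>t\<in>{\<tau> i<..<\<tau> (Suc i)}. h1 (lam t) * h2 (lam t) \<noteq> 0"
      using s(6)[OF ab'] sg(2) by blast
  qed (fact s(1) m)+
  show ?thesis using few_switchings[OF partition_bound[OF assms(3)]] .
qed

end
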